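(* Let $N\ge 1$, $1\le p<\infty$ and $0<s<1$ be such that $s\,p\le N$, and let $p\le q<p^*_s$. There exists a constant $\sigma=\sigma(N,p,s,q)>0$ such that for every $0<\gamma<1$ and every open set $\Omega\subseteq\mathbb{R}^N$ $$\gamma\,\sigma\,\left(\frac{1}{R^s_{p,\gamma}(\Omega)}\right)^{s\,p-N+N\frac{p}{q}}\le \lambda^s_{p,q}(\Omega).$$ Moreover, for $1\le p<\infty$ we have $\sigma(N,p,s,q)\sim \frac1s$ as $s\searrow 0$, and for $1\le p\le N$ we have $\sigma(N,p,s,q)\sim\frac{1}{1-s}$ as $s\nearrow 1$.
   Context: $p^*_s=\frac{Np}{N-sp}$ if $sp<N$ and $p^*_s=\infty$ if $sp\ge N$. For an open set $\Omega\subseteq\mathbb{R}^N$, $$\lambda^s_{p,q}(\Omega)=\inf_{u\in C^\infty_0(\Omega)}\left\{\iint_{\mathbb{R}^N\times\mathbb{R}^N}\frac{|u(x)-u(y)|^p}{|x-y|^{N+sp}}\,dx\,dy:\ \|u\|_{L^q(\Omega)}=1\right\},$$ where $C^\infty_0(\Omega)$ is the set of smooth functions with compact support in $\Omega$ (extended by $0$). For an open set $E$ and a compact set $\Sigma\subseteq E$, the relative $(s,p)$-capacity is $$\widetilde{\mathrm{cap}}_{s,p}(\Sigma;E)=\inf_{\varphi\in C^\infty_0(E)}\left\{\iint_{\mathbb{R}^N\times\mathbb{R}^N}\frac{|\varphi(x)-\varphi(y)|^p}{|x-y|^{N+sp}}\,dx\,dy:\ \varphi\ge 1\text{ on }\Sigma\right\}.$$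 $B_r(x_0)$ is the open ball of centre $x_0$ and radius $r$. For $0<\gamma<1$, a compact set $\Sigma\subseteq\overline{B_r(x_0)}$ is $(s,p,\gamma)$-negligible if $\widetilde{\mathrm{cap}}_{s,p}(\Sigma;B_{2r}(x_0))\le\gamma\,\widetilde{\mathrm{cap}}_{s,p}(\overline{B_r(x_0)};B_{2r}(x_0))$. The fractional capacitary inradius is $$R^s_{p,\gamma}(\Omega)=\sup\{r>0:\ \exists\, B_r(x_0)\text{ such that }\overline{B_r(x_0)}\setminus\Omega\text{ is }(s,p,\gamma)\text{-negligible}\}\in(0,+\infty],$$ and $1/(+\infty)=0$. The notation $u\sim v$ for $x\to x_0$ means $0<\liminf_{x\to x_0}u(x)/v(x)\le\limsup_{x\to x_0}u(x)/v(x)<\infty$. In the limits in $s$ the exponents are always subject to $p\le q<p^*_s$. *)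

theory Defs
  imports "HOL-Analysis.Analysis"
begin

(* Smoothness: partial derivatives of every order exist and are continuous. *)
primrec C_k :: "nat \<Rightarrow> (real ^ 'n \<Rightarrow> real) \<Rightarrow> bool" where
  "C_k 0 f \<longleftrightarrow> continuous_on UNIV f"
| "C_k (Suc k) f \<longleftrightarrow> (\<forall>x. f differentiable (at x)) \<and>
     (\<forall>i. C_k k (\<lambda>x. frechet_derivative f (at x) (axis i 1)))"

definition smooth :: "(real ^ 'n \<Rightarrow> real) \<Rightarrow> bool" where
  "smooth f \<longleftrightarrow> (\<forall>k. C_k k f)"

(* For open E, these are exactly the extensions by zero of the smooth functions
   on E with compact support in E. *)
definition test_functions :: "(real ^ 'n) set \<Rightarrow> (real ^ 'n \<Rightarrow> real) set" where
  "test_functions E =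
     {u. smooth u \<and> compact (closure {x. u x \<noteq> 0}) \<and> closure {x. u x \<noteq> 0} \<subseteq> E}"

(* The p-th power of the Gagliardo seminorm. On the diagonal, which is a null set,
   the integrand is 0 / 0 = 0. *)
definition gagliardo :: "real \<Rightarrow> real \<Rightarrow> (real ^ 'n \<Rightarrow> real) \<Rightarrow> ennreal" where
  "gagliardo s p u =
     (\<integral>\<^sup>+ (x, y). ennreal (\<bar>u x - u y\<bar> powr p / norm (x - y) powr (real CARD('n) + s * p))
        \<partial>(lborel \<Otimes>\<^sub>M lborel))"

definition Lq_norm :: "real \<Rightarrow> (real ^ 'n) set \<Rightarrow> (real ^ 'n \<Rightarrow> real) \<Rightarrow> real" where
  "Lq_norm q E u = (LINT x:E|lborel. \<bar>u x\<bar> powr q) powr (1 / q)"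

definition crit_exponent :: "nat \<Rightarrow> real \<Rightarrow> real \<Rightarrow> ereal" where
  "crit_exponent N s p =
     (if s * p < real N then ereal (real N * p / (real N - s * p)) else \<infinity>)"

(* An infimum over the empty set is infinity. *)
definition frac_lambda :: "real \<Rightarrow> real \<Rightarrow> real \<Rightarrow> (real ^ 'n) set \<Rightarrow> ennreal" where
  "frac_lambda s p q \<Omega> = (INF u \<in> {u \<in> test_functions \<Omega>. Lq_norm q \<Omega> u = 1}. gagliardo s p u)"

definition rel_cap :: "real \<Rightarrow> real \<Rightarrow> (real ^ 'n) set \<Rightarrow> (real ^ 'n) set \<Rightarrow> ennreal" where
  "rel_cap s p \<Sigma> E =
     (INF \<phi> \<in> {\<phi> \<in> test_functions E. \<forall>x\<in>\<Sigma>. 1 \<le> \<phi> x}. gagliardo s p \<phi>)"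

definition negligible_set ::
  "real \<Rightarrow> real \<Rightarrow> real \<Rightarrow> real ^ 'n \<Rightarrow> real \<Rightarrow> (real ^ 'n) set \<Rightarrow> bool" where
  "negligible_set s p \<gamma> x\<^sub>0 r \<Sigma> \<longleftrightarrow>
     compact \<Sigma> \<and> \<Sigma> \<subseteq> cball x\<^sub>0 r \<and>
     rel_cap s p \<Sigma> (ball x\<^sub>0 (2 * r)) \<le> ennreal \<gamma> * rel_cap s p (cball x\<^sub>0 r) (ball x\<^sub>0 (2 * r))"

(* Takes the value 0 only for the empty set; a nonempty open set contains a closed ball. *)
definition cap_inradius :: "real \<Rightarrow> real \<Rightarrow> real \<Rightarrow> (real ^ 'n) set \<Rightarrow> ennreal" where
  "cap_inradius s p \<gamma> \<Omega> =
     Sup {ennreal r | r. 0 < r \<and> (\<exists>x\<^sub>0. negligible_set s p \<gamma> x\<^sub>0 r (cball x\<^sub>0 r - \<Omega>))}"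

(* Real powers on [0, \<infinity>], to be used for exponents a > 0 only: 0 has power 0 and
   \<infinity> has power \<infinity>. *)
definition ennreal_powr :: "ennreal \<Rightarrow> real \<Rightarrow> ennreal" where
  "ennreal_powr t a = (if t = \<infinity> then \<infinity> else ennreal (enn2real t powr a))"

definition comparable_at :: "real filter \<Rightarrow> (real \<Rightarrow> real) \<Rightarrow> (real \<Rightarrow> real) \<Rightarrow> bool" where
  "comparable_at F u v \<longleftrightarrow>
     0 < Liminf F (\<lambda>x. ereal (u x / v x)) \<and>
     Liminf F (\<lambda>x. ereal (u x / v x)) \<le> Limsup F (\<lambda>x. ereal (u x / v x)) \<and>
     Limsup F (\<lambda>x. ereal (u x / v x)) < \<infinity>"

definition admissible :: "nat \<Rightarrow> real \<Rightarrow> real \<Rightarrow> real \<Rightarrow> bool" where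
  "admissible N p s q \<longleftrightarrow>
     1 \<le> p \<and> 0 < s \<and> s < 1 \<and> s * p \<le> real N \<and> p \<le> q \<and> ereal q < crit_exponent N s p"

end

theory Submission
  imports Defs
begin

text \<open>Throughout, \<open>N\<close> is the dimension, \<open>E\<close> the energy (the \<open>p\<close>-th power of the Gagliardo seminorm) of a test
function \<open>u\<close> of \<open>\<Omega>\<close>, and \<open>D(t)\<close> the integral of \<open>|u(x) - u(y)|^p\<close> over all pairs at distance less than \<open>t\<close>.
Constants \<open>C\<close>, \<open>c\<close> depend on \<open>N\<close> and \<open>p\<close> only.

Let \<open>r\<close> exceed the capacitary inradius. Then at every scale \<open>t \<ge> r\<close> and for every centre \<open>z\<close> the set
\<open>cball z t - \<Omega>\<close>, on which \<open>u\<close> vanishes, has at least \<open>\<gamma>\<close> times the capacity of the ball, and the latter is at least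
\<open>c t^(N - sp) / (s (1 - s))\<close> (\<open>ball_capacity_lower_bound\<close>). If \<open>u(z) \<noteq> 0\<close> and \<open>\<eta>\<close> is a cutoff that is 1 on
\<open>cball z t\<close> and supported in \<open>ball z (2t)\<close>, then \<open>\<eta> (1 - u / u(z))\<close> competes in the capacity of \<open>cball z t - \<Omega>\<close>,
so \<open>|u(z)|^p\<close> times this capacity is at most the energy of \<open>\<eta> (u(z) - u)\<close>. Normalising by the value at the
centre, instead of by a mean over the ball, allows one to integrate over all centres \<open>z\<close>: this replaces a covering
of space by balls and a Poincare inequality on each of them, and yields (\<open>thick_scale_inequality\<close>)
\<open>\<gamma> \<integral>|u|^p \<le> C (s (1 - s) t^(sp) E + t^(-N) D(2t))\<close> for all \<open>t \<ge> r\<close>.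

The behaviour for \<open>s\<close> near 0 and 1 comes from the identity
\<open>E = (N + sp) \<integral> t^(-N - sp - 1) D(t) dt\<close> over \<open>t > 0\<close>. Passing through midpoints gives
\<open>D(2t) \<le> 2^(N + p) D(t)\<close>, so \<open>D(t)\<close> decays at most like \<open>t^(N + p)\<close> towards small scales, and the identity gives
\<open>D(t) \<le> C (1 - s) t^(N + sp) E\<close>. With \<open>t = r\<close> the scale inequality becomes
\<open>\<gamma> \<integral>|u|^p \<le> C (1 - s) r^(sp) E\<close>. Integrated instead against \<open>t^(-2sp - 1) dt\<close> over \<open>t > r\<close>, it becomes
\<open>\<gamma> \<integral>|u|^p \<le> C s r^(sp) E\<close>, because each scale contributes its own share of \<open>E\<close> to the right-hand side
(\<open>capacitary_poincare\<close>). This is the case \<open>q = p\<close>.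

For general \<open>q\<close>, let \<open>\<integral>|u|^q = 1\<close> and \<open>m = p + spq/N\<close>; the exponent \<open>q\<close> is subcritical exactly if \<open>q < m\<close>. Around a
point \<open>x\<close> most values of \<open>|u|\<close> are below \<open>|u(x)| / 8\<close> at all large scales, and summing over these scales shows that
\<open>|u(x)|^m\<close> is at most a constant times \<open>s\<close> times the energy density at \<open>x\<close> (\<open>pointwise_sobolev\<close>). Interpolating
\<open>|u|^q\<close> between \<open>|u|^p\<close> and \<open>|u|^m\<close> gives the theorem with \<open>\<sigma> = c / s\<close>, the constant depending on \<open>q\<close> only
through an upper bound for it (\<open>normalized_lower_bound\<close>). For \<open>s\<close> near 1 the same interpolation is used at a fixed
order \<open>s0 < s\<close> at which \<open>q\<close> is still subcritical; the energy of order \<open>s0\<close> is bounded by \<open>(1 - s) E\<close> and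
\<open>\<integral>|u|^p\<close>, which gives \<open>\<sigma> = c / (1 - s)\<close> (\<open>normalized_lower_bound_near_1\<close>). Choosing \<open>\<sigma>\<close> equal to the second value
for \<open>s\<close> near 1 and to the first one elsewhere makes it exactly proportional to \<open>1 / (1 - s)\<close> and \<open>1 / s\<close> in the two
limits.\<close>

section \<open>Elementary inequalities and integrals\<close>

text \<open>The factor \<open>2 powr (p - 1)\<close> of convexity, and not merely some constant, is needed: it bounds the growth of \<open>D\<close>
under doubling of the scale by \<open>2 powr (N + p)\<close>, and a larger exponent would lose the factor \<open>1 - s\<close>.\<close>

lemma abs_add_powr_le:
  fixes a b p :: real
  assumes p: "1 \<le> p"
  shows "\<bar>a + b\<bar> powr p \<le> 2 powr (p - 1) * (\<bar>a\<bar> powr p + \<bar>b\<bar> powr p)"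
proof -
  have key: "((x + y) / 2) powr p \<le> (x powr p + y powr p) / 2" if "0 \<le> x" "0 \<le> y" for x y :: real
  proof (cases "x = 0 \<or> y = 0")
    case True
    have "(z / 2) powr p \<le> z powr p / 2" if "0 \<le> z" for z :: real
    proof -
      have "(2::real) powr 1 \<le> 2 powr p" by (rule powr_mono) (use p in auto)
      then have "z powr p / 2 powr p \<le> z powr p / 2" by (intro divide_left_mono) auto
      then show ?thesis using that by (simp add: powr_divide)
    qed
    then show ?thesis using True that p by auto
  next
    case False
    then have pos: "0 < x" "0 < y" using that by auto
    have "((1 - 1/2) *\<^sub>R x + (1/2) *\<^sub>R y) powr p \<le> (1 - 1/2) * x powr p + (1/2) * y powr p"
      using convex_onD[OF powr_convex[OF p], of "1/2" x y] pos by simp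
    then show ?thesis by (simp add: field_simps)
  qed
  have "\<bar>a + b\<bar> powr p \<le> (\<bar>a\<bar> + \<bar>b\<bar>) powr p" by (rule powr_mono2) (use p in auto)
  also have "\<dots> = 2 powr p * ((\<bar>a\<bar> + \<bar>b\<bar>) / 2) powr p" by (simp add: powr_divide)
  also have "\<dots> \<le> 2 powr p * ((\<bar>a\<bar> powr p + \<bar>b\<bar> powr p) / 2)" by (intro mult_left_mono key) auto
  also have "\<dots> = 2 powr (p - 1) * (\<bar>a\<bar> powr p + \<bar>b\<bar> powr p)" by (simp add: powr_diff)
  finally show ?thesis .
qed

lemma nn_integral_powr_tail:
  fixes a r :: real
  assumes "0 < a" "0 < r"
  shows "(\<integral>\<^sup>+t. ennreal (t powr (-a - 1)) * indicator {r<..} t \<partial>lborel) = ennreal (r powr (-a) / a)"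
proof -
  have "(\<integral>\<^sup>+t. ennreal (t powr (-a - 1)) * indicator {r<..} t \<partial>lborel)
      = (\<integral>\<^sup>+t. ennreal (t powr (-a - 1)) * indicator {r..} t \<partial>lborel)"
    by (rule nn_integral_cong_AE, rule AE_mp[OF AE_lborel_singleton[of r]])
       (auto simp: indicator_def)
  also have "\<dots> = ennreal (- (r powr (-a - 1 + 1)) / (-a - 1 + 1))"
    by (rule nn_integral_has_integral_lebesgue'[OF _ has_integral_powr_to_inf]) (use assms in auto)
  finally show ?thesis by simp
qed

lemma nn_integral_powr_head:
  fixes b T :: real
  assumes "0 < b" "0 \<le> T"
  shows "(\<integral>\<^sup>+t. ennreal (t powr (b - 1)) * indicator {0<..T} t \<partial>lborel) = ennreal (T powr b / b)"
proof -
  have "(\<integral>\<^sup>+t. ennreal (t powr (b - 1)) * indicator {0<..T} t \<partial>lborel)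
      = (\<integral>\<^sup>+t. ennreal (t powr (b - 1)) * indicator {0..T} t \<partial>lborel)"
    by (rule nn_integral_cong_AE, rule AE_mp[OF AE_lborel_singleton[of 0]])
       (auto simp: indicator_def)
  also have "\<dots> = ennreal (T powr (b - 1 + 1) / (b - 1 + 1))"
    by (rule nn_integral_has_integral_lebesgue'[OF _ has_integral_powr_from_0]) (use assms in auto)
  finally show ?thesis by simp
qed

section \<open>The energy as an integral over scales\<close>

text \<open>Layer cake: \<open>|x - y|^(-a)\<close> is \<open>a\<close> times the integral of \<open>t^(-a - 1)\<close> over \<open>t > |x - y|\<close>. At \<open>y = x\<close> that integral
is infinite while \<open>0 powr (-a) = 0\<close>, whence the condition on \<open>g x\<close>. This formula stands in for polar coordinates
in every singular integral below.\<close>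

lemma nn_integral_inverse_power_layers:
  fixes g :: "'a::euclidean_space \<Rightarrow> ennreal" and x :: 'a
  assumes [measurable]: "g \<in> borel_measurable borel" and g0: "g x = 0" and a: "0 < a"
  shows "(\<integral>\<^sup>+y. g y * ennreal (norm (x - y) powr (-a)) \<partial>lborel)
       = ennreal a * (\<integral>\<^sup>+t. ennreal (t powr (-a - 1)) * indicator {0<..} t *
            (\<integral>\<^sup>+y. (if norm (x - y) < t then g y else 0) \<partial>lborel) \<partial>lborel)"
proof -
  have "g y * ennreal (norm (x - y) powr (-a))
      = (\<integral>\<^sup>+t. ennreal a * (ennreal (t powr (-a - 1)) * indicator {0<..} t * (if norm (x - y) < t then g y else 0)) \<partial>lborel)"
    for y
  proof (cases "y = x")
    case True
    then show ?thesis using g0 by (simp cong: if_cong)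
  next
    case False
    then have pos: "0 < norm (x - y)" by simp
    have "(\<integral>\<^sup>+t. ennreal a * (ennreal (t powr (-a - 1)) * indicator {0<..} t * (if norm (x - y) < t then g y else 0)) \<partial>lborel)
      = (\<integral>\<^sup>+t. (ennreal a * g y) * (ennreal (t powr (-a - 1)) * indicator {norm (x - y)<..} t) \<partial>lborel)"
      using less_trans[OF pos] by (intro nn_integral_cong) (auto simp: indicator_def mult_ac)
    also have "\<dots> = (ennreal a * g y) * ennreal (norm (x - y) powr (-a) / a)"
      by (subst nn_integral_cmult) (simp_all add: nn_integral_powr_tail[OF a pos])
    also have "\<dots> = g y * (ennreal a * ennreal (norm (x - y) powr (-a) / a))" by (simp add: mult_ac)
    also have "ennreal a * ennreal (norm (x - y) powr (-a) / a) = ennreal (norm (x - y) powr (-a))"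
      using a by (simp flip: ennreal_mult)
    finally show ?thesis by simp
  qed
  then have "(\<integral>\<^sup>+y. g y * ennreal (norm (x - y) powr (-a)) \<partial>lborel)
    = (\<integral>\<^sup>+y. \<integral>\<^sup>+t. ennreal a * (ennreal (t powr (-a - 1)) * indicator {0<..} t * (if norm (x - y) < t then g y else 0)) \<partial>lborel \<partial>lborel)"
    by simp
  also have "\<dots> = (\<integral>\<^sup>+t. \<integral>\<^sup>+y. ennreal a * (ennreal (t powr (-a - 1)) * indicator {0<..} t * (if norm (x - y) < t then g y else 0)) \<partial>lborel \<partial>lborel)"
    by (rule lborel_pair.Fubini') measurable
  also have "\<dots> = ennreal a * (\<integral>\<^sup>+t. ennreal (t powr (-a - 1)) * indicator {0<..} t *
            (\<integral>\<^sup>+y. (if norm (x - y) < t then g y else 0) \<partial>lborel) \<partial>lborel)"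
    by (simp add: nn_integral_cmult)
  finally show ?thesis .
qed

text \<open>The integral of this function over all \<open>x\<close>, defined next as \<open>increment\<close>, is the \<open>D(t)\<close> of the introduction.\<close>

definition local_increment :: "real \<Rightarrow> (real ^ 'n \<Rightarrow> real) \<Rightarrow> real ^ 'n \<Rightarrow> real \<Rightarrow> ennreal" where
  "local_increment p u x t = (\<integral>\<^sup>+y. (if norm (x - y) < t then ennreal (\<bar>u x - u y\<bar> powr p) else 0) \<partial>lborel)"

definition increment :: "real \<Rightarrow> (real ^ 'n \<Rightarrow> real) \<Rightarrow> real \<Rightarrow> ennreal" where
  "increment p u t = (\<integral>\<^sup>+x. local_increment p u x t \<partial>lborel)"

definition gagliardo_density :: "real \<Rightarrow> real \<Rightarrow> (real ^ 'n \<Rightarrow> real) \<Rightarrow> real ^ 'n \<Rightarrow> ennreal" where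
  "gagliardo_density s p u x =
     (\<integral>\<^sup>+y. ennreal (\<bar>u x - u y\<bar> powr p / norm (x - y) powr (real CARD('n) + s * p)) \<partial>lborel)"

lemma local_increment_measurable [measurable]:
  fixes u :: "real ^ 'n \<Rightarrow> real"
  assumes [measurable]: "u \<in> borel_measurable borel" "f \<in> borel_measurable M" "g \<in> borel_measurable M"
  shows "(\<lambda>z. local_increment p u (f z) (g z)) \<in> borel_measurable M"
  unfolding local_increment_def by measurable

lemma increment_measurable [measurable]:
  fixes u :: "real ^ 'n \<Rightarrow> real"
  assumes [measurable]: "u \<in> borel_measurable borel" "g \<in> borel_measurable M"
  shows "(\<lambda>z. increment p u (g z)) \<in> borel_measurable M"
  unfolding increment_def by measurable

lemma gagliardo_density_measurable [measurable]:
  fixes u :: "real ^ 'n \<Rightarrow> real"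
  assumes [measurable]: "u \<in> borel_measurable borel"
  shows "gagliardo_density s p u \<in> borel_measurable borel"
  unfolding gagliardo_density_def by measurable

lemma gagliardo_eq_nn_integral_density:
  fixes u :: "real ^ 'n \<Rightarrow> real"
  assumes [measurable]: "u \<in> borel_measurable borel"
  shows "gagliardo s p u = (\<integral>\<^sup>+x. gagliardo_density s p u x \<partial>lborel)"
  unfolding gagliardo_def gagliardo_density_def
  by (subst lborel.nn_integral_fst[symmetric]) (simp_all add: case_prod_beta)

lemma gagliardo_density_layers:
  fixes u :: "real ^ 'n \<Rightarrow> real"
  assumes [measurable]: "u \<in> borel_measurable borel" and p: "1 \<le> p" and s: "0 < s"
  shows "gagliardo_density s p u x = ennreal (real CARD('n) + s * p) *
    (\<integral>\<^sup>+t. ennreal (t powr (- (real CARD('n) + s * p) - 1)) * indicator {0<..} t * local_increment p u x t \<partial>lborel)"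
proof -
  have "0 < real CARD('n) + s * p" using p s by (simp add: add_pos_nonneg)
  moreover have "ennreal (\<bar>u x - u y\<bar> powr p / norm (x - y) powr (real CARD('n) + s * p))
      = ennreal (\<bar>u x - u y\<bar> powr p) * ennreal (norm (x - y) powr (- (real CARD('n) + s * p)))" for y
    unfolding powr_minus by (simp add: divide_inverse flip: ennreal_mult)
  ultimately show ?thesis unfolding gagliardo_density_def local_increment_def
    by (subst nn_integral_inverse_power_layers[symmetric]) (simp_all only: assms, simp_all)
qed

lemma gagliardo_layers:
  fixes u :: "real ^ 'n \<Rightarrow> real"
  assumes [measurable]: "u \<in> borel_measurable borel" and p: "1 \<le> p" and s: "0 < s"
  shows "gagliardo s p u = ennreal (real CARD('n) + s * p) *
    (\<integral>\<^sup>+t. ennreal (t powr (- (real CARD('n) + s * p) - 1)) * indicator {0<..} t * increment p u t \<partial>lborel)"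
proof -
  let ?w = "\<lambda>t::real. ennreal (t powr (- (real CARD('n) + s * p) - 1)) * indicator {0<..} t"
  have "gagliardo s p u = ennreal (real CARD('n) + s * p) *
     (\<integral>\<^sup>+x. \<integral>\<^sup>+t. ?w t * local_increment p u x t \<partial>lborel \<partial>lborel)"
    by (simp add: gagliardo_eq_nn_integral_density gagliardo_density_layers[OF _ p s] nn_integral_cmult)
  also have "(\<integral>\<^sup>+x. \<integral>\<^sup>+t. ?w t * local_increment p u x t \<partial>lborel \<partial>lborel)
    = (\<integral>\<^sup>+t. \<integral>\<^sup>+x. ?w t * local_increment p u x t \<partial>lborel \<partial>lborel)"
    by (rule lborel_pair.Fubini') measurable
  also have "\<dots> = (\<integral>\<^sup>+t. ?w t * increment p u t \<partial>lborel)"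
    unfolding increment_def by (simp add: nn_integral_cmult)
  finally show ?thesis .
qed

lemma nn_integral_lborel_shift:
  fixes f :: "'a::euclidean_space \<Rightarrow> ennreal"
  assumes [measurable]: "f \<in> borel_measurable borel"
  shows "(\<integral>\<^sup>+y. f (c + y) \<partial>lborel) = (\<integral>\<^sup>+y. f y \<partial>lborel)"
  by (subst (2) lborel_distr_plus[of c, symmetric]) (simp add: nn_integral_distr)

lemma nn_integral_lborel_scale:
  fixes f :: "'a::euclidean_space \<Rightarrow> ennreal"
  assumes [measurable]: "f \<in> borel_measurable borel" and c: "c \<noteq> 0"
  shows "(\<integral>\<^sup>+y. f y \<partial>lborel) = ennreal (\<bar>c\<bar> ^ DIM('a)) * (\<integral>\<^sup>+y. f (c *\<^sub>R y) \<partial>lborel)"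
  by (subst lborel_affine[OF c, of 0]) (simp add: nn_integral_density nn_integral_distr nn_integral_cmult)

text \<open>Substituting \<open>y = x + h\<close> separates the distance \<open>h\<close> from the base point, so that dilations in \<open>h\<close> and translations
in \<open>x\<close> can be performed independently.\<close>

lemma increment_shift:
  fixes u :: "real ^ 'n \<Rightarrow> real"
  assumes [measurable]: "u \<in> borel_measurable borel"
  shows "increment p u t = (\<integral>\<^sup>+h. (if norm h < t then \<integral>\<^sup>+x. ennreal (\<bar>u (x + h) - u x\<bar> powr p) \<partial>lborel else 0) \<partial>lborel)"
proof -
  have "local_increment p u x t = (\<integral>\<^sup>+h. (if norm h < t then ennreal (\<bar>u (x + h) - u x\<bar> powr p) else 0) \<partial>lborel)" for x
    unfolding local_increment_def
    by (subst nn_integral_lborel_shift[of _ x, symmetric]) (simp_all add: abs_minus_commute[of "u x"] cong: if_cong)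
  then have "increment p u t = (\<integral>\<^sup>+x. \<integral>\<^sup>+h. (if norm h < t then ennreal (\<bar>u (x + h) - u x\<bar> powr p) else 0) \<partial>lborel \<partial>lborel)"
    by (simp add: increment_def)
  also have "\<dots> = (\<integral>\<^sup>+h. \<integral>\<^sup>+x. (if norm h < t then ennreal (\<bar>u (x + h) - u x\<bar> powr p) else 0) \<partial>lborel \<partial>lborel)"
    by (rule lborel_pair.Fubini') measurable
  also have "\<dots> = (\<integral>\<^sup>+h. (if norm h < t then \<integral>\<^sup>+x. ennreal (\<bar>u (x + h) - u x\<bar> powr p) \<partial>lborel else 0) \<partial>lborel)"
    by (intro nn_integral_cong) auto
  finally show ?thesis .
qed

lemma increment_mono: "s \<le> t \<Longrightarrow> increment p u s \<le> increment p u t"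
  unfolding increment_def local_increment_def by (intro nn_integral_mono) auto

text \<open>The difference over \<open>2h\<close> is the sum of two differences over \<open>h\<close>, one of them translated; convexity bounds its
\<open>p\<close>-th power integral by \<open>2 powr p\<close> times that of the difference over \<open>h\<close>. The dilation \<open>h \<mapsto> 2h\<close> contributes
\<open>2 powr N\<close>.\<close>

lemma increment_double:
  fixes u :: "real ^ 'n \<Rightarrow> real"
  assumes [measurable]: "u \<in> borel_measurable borel" and p: "1 \<le> p"
  shows "increment p u (2 * t) \<le> ennreal (2 powr (real CARD('n) + p)) * increment p u t"
proof -
  define J where "J h = (\<integral>\<^sup>+x. ennreal (\<bar>u (x + h) - u x\<bar> powr p) \<partial>lborel)" for h
  have [measurable]: "J \<in> borel_measurable borel" unfolding J_def by measurable
  have J2: "J (2 *\<^sub>R h) \<le> ennreal (2 powr p) * J h" for h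
  proof -
    have "J (2 *\<^sub>R h) \<le> (\<integral>\<^sup>+x. ennreal (2 powr (p - 1)) *
        (ennreal (\<bar>u (h + x + h) - u (h + x)\<bar> powr p) + ennreal (\<bar>u (x + h) - u x\<bar> powr p)) \<partial>lborel)"
      unfolding J_def
    proof (intro nn_integral_mono)
      fix x
      have e: "x + 2 *\<^sub>R h = h + x + h" by (simp add: scaleR_2)
      have "\<bar>u (h + x + h) - u x\<bar> powr p \<le> 2 powr (p - 1) *
        (\<bar>u (h + x + h) - u (h + x)\<bar> powr p + \<bar>u (x + h) - u x\<bar> powr p)"
        using abs_add_powr_le[OF p, of "u (h + x + h) - u (h + x)" "u (x + h) - u x"]
        by (simp add: add.commute)
      then show "ennreal (\<bar>u (x + 2 *\<^sub>R h) - u x\<bar> powr p) \<le> ennreal (2 powr (p - 1)) *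
        (ennreal (\<bar>u (h + x + h) - u (h + x)\<bar> powr p) + ennreal (\<bar>u (x + h) - u x\<bar> powr p))"
        unfolding e by (simp add: ennreal_leI flip: ennreal_plus ennreal_mult)
    qed
    also have "\<dots> = ennreal (2 powr (p - 1)) * (J h + J h)"
      using nn_integral_lborel_shift[of "\<lambda>x. ennreal (\<bar>u (x + h) - u x\<bar> powr p)" h]
      by (simp add: nn_integral_cmult nn_integral_add J_def)
    also have "\<dots> = ennreal (2 powr (p - 1)) * (ennreal 2 * J h)"
      by (simp add: mult_2)
    also have "\<dots> = ennreal (2 powr p) * J h"
      by (simp add: mult.assoc[symmetric] ennreal_mult[symmetric] powr_diff del: ennreal_numeral)
    finally show ?thesis .
  qed
  have "increment p u (2 * t) = (\<integral>\<^sup>+h. (if norm h < 2 * t then J h else 0) \<partial>lborel)"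
    by (simp add: increment_shift J_def cong: if_cong)
  also have "\<dots> = ennreal (2 ^ CARD('n)) * (\<integral>\<^sup>+h. (if norm h < t then J (2 *\<^sub>R h) else 0) \<partial>lborel)"
    by (subst nn_integral_lborel_scale[of _ 2]) simp_all
  also have "\<dots> \<le> ennreal (2 ^ CARD('n)) * (\<integral>\<^sup>+h. ennreal (2 powr p) * (if norm h < t then J h else 0) \<partial>lborel)"
    by (intro mult_left_mono nn_integral_mono) (auto simp: J2)
  also have "\<dots> = ennreal (2 ^ CARD('n)) * (ennreal (2 powr p) * increment p u t)"
    by (subst nn_integral_cmult) (simp_all add: increment_shift J_def cong: if_cong)
  also have "\<dots> = ennreal (2 powr (real CARD('n) + p)) * increment p u t"
    by (simp add: mult.assoc[symmetric] ennreal_mult[symmetric] powr_add powr_realpow)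
  finally show ?thesis .
qed

section \<open>Increments are controlled by the energy\<close>

lemma ennreal_le_cmult_iff:
  assumes "0 < k"
  shows "D \<le> ennreal k * G \<longleftrightarrow> ennreal (1 / k) * D \<le> G"
proof
  assume "D \<le> ennreal k * G"
  then have "ennreal (1 / k) * D \<le> ennreal (1 / k) * (ennreal k * G)" by (rule mult_left_mono) simp
  also have "\<dots> = G" using assms by (simp add: mult.assoc[symmetric] ennreal_mult[symmetric])
  finally show "ennreal (1 / k) * D \<le> G" .
next
  assume "ennreal (1 / k) * D \<le> G"
  then have "ennreal k * (ennreal (1 / k) * D) \<le> ennreal k * G" by (rule mult_left_mono) simp
  moreover have "ennreal k * (ennreal (1 / k) * D) = D"
    using assms by (simp add: mult.assoc[symmetric] ennreal_mult[symmetric])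
  ultimately show "D \<le> ennreal k * G" by simp
qed

lemma layers_le_gagliardo:
  fixes u :: "real ^ 'n \<Rightarrow> real"
  assumes u: "u \<in> borel_measurable borel" and p: "1 \<le> p" and s: "0 < s"
  shows "(\<integral>\<^sup>+t. ennreal (t powr (- (real CARD('n) + s * p) - 1)) * indicator {0<..} t * increment p u t \<partial>lborel)
    \<le> gagliardo s p u"
proof -
  have "1 \<le> real CARD('n)" by (simp add: Suc_le_eq)
  moreover have "0 \<le> s * p" using p s by simp
  ultimately have "ennreal 1 \<le> ennreal (real CARD('n) + s * p)" by (intro ennreal_leI) linarith
  from mult_right_mono[OF this zero_le] show ?thesis
    unfolding gagliardo_layers[OF u p s] by simp
qed

lemma increment_growth:
  fixes u :: "real ^ 'n \<Rightarrow> real"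
  assumes u: "u \<in> borel_measurable borel" and p: "1 \<le> p" and t: "0 < t" "t \<le> T"
  shows "increment p u T \<le> ennreal ((2 * T / t) powr (real CARD('n) + p)) * increment p u t"
proof -
  let ?b = "real CARD('n) + p"
  have iter: "increment p u (2 ^ k * t) \<le> ennreal ((2 ^ k) powr ?b) * increment p u t" for k
  proof (induction k)
    case (Suc k)
    have "increment p u (2 ^ Suc k * t) = increment p u (2 * (2 ^ k * t))" by (simp add: mult_ac)
    also have "\<dots> \<le> ennreal (2 powr ?b) * increment p u (2 ^ k * t)" by (rule increment_double[OF u p])
    also have "\<dots> \<le> ennreal (2 powr ?b) * (ennreal ((2 ^ k) powr ?b) * increment p u t)"
      by (intro mult_left_mono Suc) simp
    also have "\<dots> = ennreal ((2 ^ Suc k) powr ?b) * increment p u t"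
      by (simp add: mult.assoc[symmetric] ennreal_mult[symmetric] powr_mult)
    finally show ?case .
  qed simp
  \<comment> \<open>The least number of doublings that leads from \<open>t\<close> beyond \<open>T\<close>; it overshoots by a factor of at most 2.\<close>
  define k where "k = nat \<lceil>log 2 (T / t)\<rceil>"
  have T1: "1 \<le> T / t" using t by simp
  have Tp: "0 < T" using t by simp
  then have l0: "0 \<le> log 2 (T / t)" using T1 by simp
  have "T / t = 2 powr (log 2 (T / t))" using t by simp
  also have "\<dots> \<le> 2 powr real k" unfolding k_def using l0 by (intro powr_mono) linarith+
  finally have "T / t \<le> 2 ^ k" by (simp add: powr_realpow)
  then have le1: "T \<le> 2 ^ k * t" using t by (simp add: field_simps)
  have "real k \<le> log 2 (T / t) + 1" unfolding k_def using l0 by linarith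
  then have "2 powr real k \<le> 2 powr (log 2 (T / t) + 1)" by (intro powr_mono) auto
  also have "\<dots> = 2 * T / t" using t Tp by (simp add: powr_add)
  finally have le2: "2 ^ k \<le> 2 * T / t" by (simp add: powr_realpow)
  have "increment p u T \<le> increment p u (2 ^ k * t)" by (rule increment_mono[OF le1])
  also have "\<dots> \<le> ennreal ((2 ^ k) powr ?b) * increment p u t" by (rule iter)
  also have "\<dots> \<le> ennreal ((2 * T / t) powr ?b) * increment p u t"
    using p by (intro mult_right_mono ennreal_leI powr_mono2 le2) auto
  finally show ?thesis .
qed

text \<open>The estimate of Bourgain, Brezis and Mironescu. By \<open>increment_growth\<close> the value of \<open>D\<close> at \<open>T\<close> forces
\<open>D(t)\<close> to be at least of order \<open>(t / T)^(N + p) D(T)\<close> at all smaller scales, and these scales contribute the integral of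
\<open>t^(p (1 - s) - 1)\<close> to the energy. This integral is of order \<open>1 / (1 - s)\<close>.\<close>

lemma increment_le_gagliardo:
  fixes u :: "real ^ 'n \<Rightarrow> real"
  assumes [measurable]: "u \<in> borel_measurable borel"
    and p: "1 \<le> p" and s: "0 < s" "s < 1" and T: "0 < T"
  shows "increment p u T \<le>
    ennreal (2 powr (real CARD('n) + p) * p * (1 - s) * T powr (real CARD('n) + s * p)) * gagliardo s p u"
proof -
  let ?N = "real CARD('n)"
  let ?D = "increment p u T"
  have N: "1 \<le> ?N" by (simp add: Suc_le_eq)
  have b: "0 < p * (1 - s)" using p s by simp
  define c where "c = (2 * T) powr (- (?N + p))"
  have c: "0 < c" unfolding c_def using T by simp
  have pt: "ennreal (c * t powr (p * (1 - s) - 1)) * indicator {0<..T} t * ?D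
     \<le> ennreal (t powr (- (?N + s * p) - 1)) * indicator {0<..} t * increment p u t" for t
  proof (cases "0 < t \<and> t \<le> T")
    case True
    then have t: "0 < t" "t \<le> T" by auto
    have "ennreal (1 / (2 * T / t) powr (?N + p)) * ?D \<le> increment p u t"
      using increment_growth[OF assms(1) p t] t T by (subst (asm) ennreal_le_cmult_iff) auto
    then have "ennreal (t powr (- (?N + s * p) - 1)) * (ennreal (1 / (2 * T / t) powr (?N + p)) * ?D)
      \<le> ennreal (t powr (- (?N + s * p) - 1)) * increment p u t" by (rule mult_left_mono) simp
    moreover have "t powr (- (?N + s * p) - 1) * (1 / (2 * T / t) powr (?N + p)) = c * t powr (p * (1 - s) - 1)"
    proof -
      have "t powr (- (?N + s * p) - 1) * (1 / (2 * T / t) powr (?N + p))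
         = c * (t powr (- (?N + s * p) - 1) * t powr (?N + p))"
        unfolding c_def powr_minus using t T by (simp add: powr_divide field_simps)
      also have "t powr (- (?N + s * p) - 1) * t powr (?N + p) = t powr (p * (1 - s) - 1)"
        by (simp add: powr_add[symmetric] algebra_simps)
      finally show ?thesis .
    qed
    ultimately show ?thesis using t
      by (simp add: mult.assoc[symmetric] ennreal_mult[symmetric])
  qed auto
  have "ennreal (c * (T powr (p * (1 - s)) / (p * (1 - s)))) * ?D
      = ennreal c * (\<integral>\<^sup>+t. ennreal (t powr (p * (1 - s) - 1)) * indicator {0<..T} t \<partial>lborel) * ?D"
    using b c T by (subst nn_integral_powr_head) (simp_all flip: ennreal_mult)
  also have "\<dots> = (\<integral>\<^sup>+t. ennreal c * (ennreal (t powr (p * (1 - s) - 1)) * indicator {0<..T} t) * ?D \<partial>lborel)"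
    by (simp add: nn_integral_multc nn_integral_cmult)
  also have "\<dots> = (\<integral>\<^sup>+t. ennreal (c * t powr (p * (1 - s) - 1)) * indicator {0<..T} t * ?D \<partial>lborel)"
    using c by (simp add: ennreal_mult mult.assoc)
  also have "\<dots> \<le> (\<integral>\<^sup>+t. ennreal (t powr (- (?N + s * p) - 1)) * indicator {0<..} t * increment p u t \<partial>lborel)"
    by (intro nn_integral_mono pt)
  also have "\<dots> \<le> gagliardo s p u" by (rule layers_le_gagliardo[OF _ p s(1)]) simp
  finally have fin: "ennreal (c * (T powr (p * (1 - s)) / (p * (1 - s)))) * ?D \<le> gagliardo s p u" .
  define k where "k = 2 powr (?N + p) * p * (1 - s) * T powr (?N + s * p)"
  have k: "0 < k" unfolding k_def using p s T by simp
  have "1 / k = c * (T powr (p * (1 - s)) / (p * (1 - s)))"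
  proof -
    have e1: "T powr (p * (1 - s)) = T powr (?N + p) / T powr (?N + s * p)"
      by (simp add: powr_diff[symmetric] algebra_simps)
    have e2: "c = inverse (2 powr (?N + p) * T powr (?N + p))"
      unfolding c_def powr_minus using T by (simp add: powr_mult)
    have gen: "1 / (C * P * Q * B) = inverse (C * A) * (A / B / (P * Q))"
      if "A \<noteq> 0" "B \<noteq> 0" "C \<noteq> 0" "P \<noteq> 0" "Q \<noteq> 0" for A B C P Q :: real
      using that by (simp add: field_simps)
    show ?thesis unfolding k_def e1 e2 by (rule gen) (use T p s in auto)
  qed
  then show ?thesis using fin k unfolding k_def[symmetric] by (subst ennreal_le_cmult_iff) auto
qed

section \<open>The capacity of a ball\<close>

lemma test_functions_continuous: "u \<in> test_functions E \<Longrightarrow> continuous_on UNIV u"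
  unfolding test_functions_def smooth_def by (metis (mono_tags, lifting) C_k.simps(1) mem_Collect_eq)

lemma test_functions_measurable: "u \<in> test_functions E \<Longrightarrow> u \<in> borel_measurable borel"
  by (rule borel_measurable_continuous_onI[OF test_functions_continuous])

lemma test_functions_outside:
  assumes "u \<in> test_functions E" "x \<notin> E" shows "u x = 0"
  using assms closure_subset[of "{x. u x \<noteq> 0}"] unfolding test_functions_def by blast

lemma emeasure_lborel_ball:
  fixes x :: "real ^ 'n"
  assumes "0 \<le> r"
  shows "emeasure lborel (ball x r) = ennreal (unit_ball_vol (real CARD('n)) * r powr real CARD('n))"
  using emeasure_ball[OF assms, of x] assms by (cases "r = 0") (auto simp: powr_realpow powr_0 zero_power)

text \<open>For \<open>t \<ge> 4r\<close> every point of \<open>ball z r\<close> sees \<open>ball z (2r)\<close> within distance \<open>t\<close>, and at least half of its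
\<open>t\<close>-neighbourhood lies outside \<open>ball z (2r)\<close>, where \<open>\<phi>\<close> vanishes.\<close>

lemma increment_ge_of_cutoff:
  fixes \<phi> :: "real ^ 'n \<Rightarrow> real"
  assumes p: "1 \<le> p" and r: "0 < r" and t: "4 * r \<le> t"
    and in1: "\<And>x. x \<in> ball z r \<Longrightarrow> 1 \<le> \<phi> x" and out: "\<And>x. x \<notin> ball z (2 * r) \<Longrightarrow> \<phi> x = 0"
  shows "ennreal ((unit_ball_vol (real CARD('n)))\<^sup>2 / 2 * r powr real CARD('n) * t powr real CARD('n))
    \<le> increment p \<phi> t"
proof -
  let ?N = "real CARD('n)"
  let ?w = "unit_ball_vol ?N"
  have w: "0 < ?w" by simp
  have N: "1 \<le> ?N" by (simp add: Suc_le_eq)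
  have loc: "ennreal (?w * t powr ?N / 2) \<le> local_increment p \<phi> x t" if x: "x \<in> ball z r" for x
  proof -
    have sub: "ball z (2 * r) \<subseteq> ball x t"
    proof
      fix y assume "y \<in> ball z (2 * r)"
      then show "y \<in> ball x t" using x t r dist_triangle[of x y z] by (auto simp: dist_commute)
    qed
    have "2 * (2 * r) powr ?N \<le> 2 powr ?N * (2 * r) powr ?N"
      using powr_mono[OF N, of 2] by (intro mult_right_mono) auto
    also have "\<dots> = (4 * r) powr ?N" using r by (simp add: powr_mult[symmetric])
    also have "\<dots> \<le> t powr ?N" using t r by (intro powr_mono2) auto
    finally have le: "2 * (2 * r) powr ?N \<le> t powr ?N" .
    then have "?w * (2 * (2 * r) powr ?N) \<le> ?w * t powr ?N" by (intro mult_left_mono) auto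
    then have "ennreal (?w * t powr ?N / 2) \<le> ennreal (?w * t powr ?N - ?w * (2 * r) powr ?N)"
      by (intro ennreal_leI) simp
    also have "\<dots> = emeasure lborel (ball x t - ball z (2 * r))"
      using sub r t by (subst emeasure_Diff) (auto simp: emeasure_lborel_ball ennreal_minus)
    also have "\<dots> = (\<integral>\<^sup>+y. indicator (ball x t - ball z (2 * r)) y \<partial>lborel)" by simp
    also have "\<dots> \<le> local_increment p \<phi> x t"
      unfolding local_increment_def
    proof (intro nn_integral_mono)
      fix y
      have "1 powr p \<le> \<bar>\<phi> x\<bar> powr p" using in1[OF x] p by (intro powr_mono2) auto
      then show "indicator (ball x t - ball z (2 * r)) y
          \<le> (if norm (x - y) < t then ennreal (\<bar>\<phi> x - \<phi> y\<bar> powr p) else 0)"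
        using out[of y] by (auto simp: indicator_def dist_norm)
    qed
    finally show ?thesis .
  qed
  have "ennreal (?w\<^sup>2 / 2 * r powr ?N * t powr ?N) = ennreal (?w * t powr ?N / 2) * ennreal (?w * r powr ?N)"
    using w by (simp flip: ennreal_mult add: power2_eq_square mult_ac)
  also have "\<dots> = ennreal (?w * t powr ?N / 2) * emeasure lborel (ball z r)"
    using r by (simp add: emeasure_lborel_ball)
  also have "\<dots> = (\<integral>\<^sup>+x. ennreal (?w * t powr ?N / 2) * indicator (ball z r) x \<partial>lborel)"
    by (subst nn_integral_cmult_indicator) simp_all
  also have "\<dots> \<le> increment p \<phi> t"
    unfolding increment_def using loc by (intro nn_integral_mono) (auto simp: indicator_def)
  finally show ?thesis .
qed

text \<open>Two lower bounds for the energy of a competitor are added. The scales \<open>t > 4r\<close> alone contribute a multiple of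
\<open>1 / s\<close>, and the increments at scale \<open>4r\<close> force a multiple of \<open>1 / (1 - s)\<close> by \<open>increment_le_gagliardo\<close>. The
sum of \<open>1 / s\<close> and \<open>1 / (1 - s)\<close> is \<open>1 / (s (1 - s))\<close>.\<close>

lemma ball_capacity_lower_bound:
  fixes p :: real
  assumes p: "1 \<le> p"
  shows "\<exists>c>0. \<forall>s (z :: real ^ 'n) r. 0 < s \<and> s < 1 \<and> 0 < r \<longrightarrow>
    ennreal (c * r powr (real CARD('n) - s * p) / (s * (1 - s))) \<le> rel_cap s p (cball z r) (ball z (2 * r))"
proof -
  let ?N = "real CARD('n)"
  define w where "w = unit_ball_vol ?N"
  have w: "0 < w" by (simp add: w_def)
  have N: "1 \<le> ?N" by (simp add: Suc_le_eq)
  define c where "c = w\<^sup>2 / 2 * 4 powr (-p) / (2 powr (?N + p) * p)"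
  have c: "0 < c" using w p by (simp add: c_def)
  have "ennreal (c / 2 * r powr (?N - s * p) / (s * (1 - s))) \<le> gagliardo s p \<phi>"
    if s: "0 < s" "s < 1" and r: "0 < r" and \<phi>: "\<phi> \<in> test_functions (ball z (2 * r))"
      and \<phi>1: "\<And>x. x \<in> cball z r \<Longrightarrow> 1 \<le> \<phi> x" for s r and z :: "real ^ 'n" and \<phi>
  proof -
    let ?G = "gagliardo s p \<phi>"
    note [measurable] = test_functions_measurable[OF \<phi>]
    have inc: "ennreal (w\<^sup>2 / 2 * r powr ?N * t powr ?N) \<le> increment p \<phi> t" if "4 * r \<le> t" for t
      unfolding w_def
      by (rule increment_ge_of_cutoff[OF p r that, where z = z])
         (use \<phi>1 test_functions_outside[OF \<phi>] in auto)
    have sp: "0 < s * p" "s * p \<le> p" using s p by auto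
    have four: "4 powr (-p) \<le> 4 powr (- (s * p))" using sp by (intro powr_mono) auto
    have e1: "ennreal (c * r powr (?N - s * p) * (1 / s)) \<le> ?G"
    proof -
      have "c \<le> w\<^sup>2 / 2 * 4 powr (- (s * p)) / p"
      proof -
        have "1 powr (?N + p) \<le> 2 powr (?N + p)" using p by (intro powr_mono2) auto
        then have "1 * p \<le> 2 powr (?N + p) * p" using p by (intro mult_right_mono) auto
        then have "c \<le> w\<^sup>2 / 2 * 4 powr (-p) / p"
          unfolding c_def using w p by (intro divide_left_mono) auto
        also have "\<dots> \<le> w\<^sup>2 / 2 * 4 powr (- (s * p)) / p"
          using four p by (intro divide_right_mono mult_left_mono) auto
        finally show ?thesis .
      qed
      then have "c * r powr (?N - s * p) * (1 / s)
        \<le> (w\<^sup>2 / 2 * 4 powr (- (s * p)) / p) * r powr (?N - s * p) * (1 / s)"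
        using s by (intro mult_right_mono) auto
      also have "\<dots> = w\<^sup>2 / 2 * r powr ?N * ((4 * r) powr (- (s * p)) / (s * p))"
        using r s p by (simp add: powr_mult powr_diff powr_minus field_simps)
      finally have "ennreal (c * r powr (?N - s * p) * (1 / s))
        \<le> ennreal (w\<^sup>2 / 2 * r powr ?N * ((4 * r) powr (- (s * p)) / (s * p)))" by (rule ennreal_leI)
      also have "\<dots> = (\<integral>\<^sup>+t. ennreal (w\<^sup>2 / 2 * r powr ?N) *
          (ennreal (t powr (- (s * p) - 1)) * indicator {4 * r<..} t) \<partial>lborel)"
        using nn_integral_powr_tail[OF sp(1), of "4 * r"] r sp
        by (subst nn_integral_cmult) (simp_all flip: ennreal_mult)
      also have "\<dots> \<le> (\<integral>\<^sup>+t. ennreal (t powr (- (?N + s * p) - 1)) * indicator {0<..} t * increment p \<phi> t \<partial>lborel)"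
      proof (intro nn_integral_mono)
        fix t :: real
        show "ennreal (w\<^sup>2 / 2 * r powr ?N) * (ennreal (t powr (- (s * p) - 1)) * indicator {4 * r<..} t)
          \<le> ennreal (t powr (- (?N + s * p) - 1)) * indicator {0<..} t * increment p \<phi> t"
        proof (cases "4 * r < t")
          case True
          have "t powr (- (s * p) - 1) = t powr (- (?N + s * p) - 1) * t powr ?N"
            by (simp add: powr_add[symmetric])
          then have "ennreal (w\<^sup>2 / 2 * r powr ?N) * ennreal (t powr (- (s * p) - 1))
             = ennreal (t powr (- (?N + s * p) - 1)) * ennreal (w\<^sup>2 / 2 * r powr ?N * t powr ?N)"
            by (simp flip: ennreal_mult add: mult_ac)
          also have "\<dots> \<le> ennreal (t powr (- (?N + s * p) - 1)) * increment p \<phi> t"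
            by (intro mult_left_mono inc) (use True in auto)
          finally show ?thesis using True r by (auto simp: indicator_def)
        qed auto
      qed
      also have "\<dots> \<le> ?G" by (rule layers_le_gagliardo[OF _ p s(1)]) simp
      finally show ?thesis .
    qed
    have e2: "ennreal (c * r powr (?N - s * p) * (1 / (1 - s))) \<le> ?G"
    proof -
      let ?k = "2 powr (?N + p) * p * (1 - s) * (4 * r) powr (?N + s * p)"
      have k: "0 < ?k" using p s r by simp
      have "ennreal (w\<^sup>2 / 2 * r powr ?N * (4 * r) powr ?N) \<le> ennreal ?k * ?G"
        by (rule order_trans[OF inc increment_le_gagliardo]) (use p s r in auto)
      then have "ennreal (1 / ?k) * ennreal (w\<^sup>2 / 2 * r powr ?N * (4 * r) powr ?N) \<le> ?G"
        using k by (subst (asm) ennreal_le_cmult_iff) auto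
      moreover have A0: "0 \<le> w\<^sup>2 / 2 * r powr ?N * (4 * r) powr ?N" by simp
      have "c * r powr (?N - s * p) * (1 / (1 - s)) \<le> 1 / ?k * (w\<^sup>2 / 2 * r powr ?N * (4 * r) powr ?N)"
      proof -
        have gen1: "W / 2 * F / (C * P) * R * (1 / Q) = W / 2 / (C * P * Q) * R * F"
          if "C \<noteq> 0" "P \<noteq> 0" "Q \<noteq> 0" for W F C P R Q :: real
          using that by (simp add: field_simps)
        have "c * r powr (?N - s * p) * (1 / (1 - s)) =
          w\<^sup>2 / 2 / (2 powr (?N + p) * p * (1 - s)) * r powr (?N - s * p) * 4 powr (-p)"
          unfolding c_def by (rule gen1) (use p s in auto)
        also have "\<dots> \<le> w\<^sup>2 / 2 / (2 powr (?N + p) * p * (1 - s)) * r powr (?N - s * p) * 4 powr (- (s * p))"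
          using four p s by (intro mult_left_mono) auto
        also have "\<dots> = 1 / ?k * (w\<^sup>2 / 2 * r powr ?N * (4 * r) powr ?N)"
        proof -
          have gen: "W / 2 / K * (B / S) * inverse F = 1 / (K * ((A * F) * (B * S))) * (W / 2 * B * (A * B))"
            if "A \<noteq> 0" "B \<noteq> 0" "F \<noteq> 0" "K \<noteq> 0" "S \<noteq> 0" for A B F K S W :: real
            using that by (simp add: field_simps)
          have e: "(4 * r) powr (?N + s * p) = (4 powr ?N * 4 powr (s * p)) * (r powr ?N * r powr (s * p))"
            "(4 * r) powr ?N = 4 powr ?N * r powr ?N"
            using r by (simp_all add: powr_mult powr_add)
          show ?thesis unfolding powr_diff[of r] powr_minus[of 4] e by (rule gen) (use r p s in auto)
        qed
        finally show ?thesis .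
      qed
      then have "ennreal (c * r powr (?N - s * p) * (1 / (1 - s)))
          \<le> ennreal (1 / ?k) * ennreal (w\<^sup>2 / 2 * r powr ?N * (4 * r) powr ?N)"
        unfolding ennreal_mult[OF less_imp_le[OF divide_pos_pos[OF zero_less_one k]] A0, symmetric]
        by (rule ennreal_leI)
      ultimately show ?thesis by (rule order_trans[rotated])
    qed
    have "ennreal (c * r powr (?N - s * p) / (s * (1 - s))) =
       ennreal (c * r powr (?N - s * p) * (1 / s)) + ennreal (c * r powr (?N - s * p) * (1 / (1 - s)))"
      using s c by (subst ennreal_plus[symmetric]) (auto simp: field_simps)
    also have "\<dots> \<le> ?G + ?G" by (intro add_mono e1 e2)
    also have "\<dots> = ennreal 2 * ?G" by (simp add: mult_2)
    finally have "ennreal (1 / 2) * ennreal (c * r powr (?N - s * p) / (s * (1 - s))) \<le> ?G"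
      by (subst (asm) ennreal_le_cmult_iff) auto
    moreover have "c / 2 * r powr (?N - s * p) / (s * (1 - s)) = 1 / 2 * (c * r powr (?N - s * p) / (s * (1 - s)))"
      by simp
    ultimately show ?thesis by (simp only: ennreal_mult'[of "1 / 2"] divide_nonneg_nonneg zero_le_one zero_le_numeral)
  qed
  then show ?thesis using c
    by (intro exI[of _ "c / 2"]) (auto simp: rel_cap_def intro!: INF_greatest)
qed

section \<open>Smooth cutoffs\<close>

lemma C_k_SucD: "C_k (Suc k) f \<Longrightarrow> C_k k f"
proof (induction k arbitrary: f)
  case 0
  then show ?case
    by (auto intro!: differentiable_imp_continuous_on simp: differentiable_on_def differentiable_at_withinI)
next
  case (Suc k)
  have "C_k k (\<lambda>x. frechet_derivative f (at x) (axis i 1))" for i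
    by (rule Suc.IH) (use Suc.prems in simp)
  then show ?case using Suc.prems by simp
qed

lemma C_k_const: "C_k k (\<lambda>x. c)"
  by (induction k arbitrary: c) (auto simp: frechet_derivative_const)

lemma C_k_component: "C_k k (\<lambda>x :: real ^ 'n. x $ j)"
proof (cases k)
  case (Suc l)
  have d: "((\<lambda>x. x $ j) has_derivative (\<lambda>h. h $ j)) (at x)" for x :: "real ^ 'n"
    by (rule bounded_linear_imp_has_derivative) (rule bounded_linear_vec_nth)
  have "(\<lambda>x. frechet_derivative (\<lambda>x. x $ j) (at x) (axis i 1)) = (\<lambda>x :: real ^ 'n. axis i 1 $ j)" for i
    by (simp add: frechet_derivative_at[OF d, symmetric])
  then show ?thesis using d C_k_const Suc by (auto simp: differentiable_def)
qed (auto intro!: continuous_intros)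

lemma C_k_add: "C_k k f \<Longrightarrow> C_k k g \<Longrightarrow> C_k k (\<lambda>x. f x + g x)"
proof (induction k arbitrary: f g)
  case (Suc k)
  have df: "(f has_derivative frechet_derivative f (at x)) (at x)"
   and dg: "(g has_derivative frechet_derivative g (at x)) (at x)" for x
    using Suc.prems by (simp_all add: frechet_derivative_works[symmetric])
  have "(\<lambda>x. frechet_derivative (\<lambda>x. f x + g x) (at x) (axis i 1)) =
     (\<lambda>x. frechet_derivative f (at x) (axis i 1) + frechet_derivative g (at x) (axis i 1))" for i
    by (simp add: frechet_derivative_at[OF has_derivative_add[OF df dg], symmetric])
  then show ?case using Suc by (auto intro!: derivative_intros)
qed (auto intro!: continuous_intros)

lemma C_k_mult: "C_k k f \<Longrightarrow> C_k k g \<Longrightarrow> C_k k (\<lambda>x. f x * g x)"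
proof (induction k arbitrary: f g)
  case (Suc k)
  have df: "(f has_derivative frechet_derivative f (at x)) (at x)"
   and dg: "(g has_derivative frechet_derivative g (at x)) (at x)" for x
    using Suc.prems by (simp_all add: frechet_derivative_works[symmetric])
  have "(\<lambda>x. frechet_derivative (\<lambda>x. f x * g x) (at x) (axis i 1)) =
     (\<lambda>x. f x * frechet_derivative g (at x) (axis i 1) + frechet_derivative f (at x) (axis i 1) * g x)" for i
    by (simp add: frechet_derivative_at[OF has_derivative_mult[OF df dg], symmetric])
  moreover have "C_k k (\<lambda>x. f x * frechet_derivative g (at x) (axis i 1) + frechet_derivative f (at x) (axis i 1) * g x)" for i
    by (intro C_k_add Suc.IH C_k_SucD[OF Suc.prems(1)] C_k_SucD[OF Suc.prems(2)]) (use Suc.prems in auto)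
  ultimately show ?case using Suc.prems by (auto intro!: derivative_intros)
qed (auto intro!: continuous_intros)

lemma C_k_sum: "(\<And>i. i \<in> A \<Longrightarrow> C_k k (f i)) \<Longrightarrow> C_k k (\<lambda>x. \<Sum>i\<in>A. f i x)"
  by (induction A rule: infinite_finite_induct) (auto intro: C_k_const C_k_add)

text \<open>The functions \<open>P(1/x) exp(-1/x)\<close>, extended by zero to \<open>x \<le> 0\<close>. Allowing all polynomials \<open>P\<close> makes the family closed
under differentiation, so smoothness of all its members follows by one induction.\<close>

definition flat_exp :: "real poly \<Rightarrow> real \<Rightarrow> real" where
  "flat_exp P x = (if 0 < x then poly P (1 / x) * exp (- (1 / x)) else 0)"

lemma poly_times_exp_tendsto_0: "((\<lambda>y. poly P y * exp (- y)) \<longlongrightarrow> (0::real)) at_top"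
proof -
  have "(\<lambda>y. poly P y * exp (- y)) = (\<lambda>y. \<Sum>i\<le>degree P. coeff P i * (y ^ i / exp y))"
    by (simp add: poly_altdef sum_distrib_right exp_minus divide_inverse mult.assoc)
  moreover have "((\<lambda>y. \<Sum>i\<le>degree P. coeff P i * (y ^ i / exp y)) \<longlongrightarrow> (\<Sum>i\<le>degree P. coeff P i * 0)) at_top"
    by (intro tendsto_intros tendsto_power_div_exp_0)
  ultimately show ?thesis by simp
qed

text \<open>For \<open>x > 0\<close> and \<open>y = 1/x\<close> the derivative of \<open>P(y) exp(-y)\<close> in \<open>x\<close> is \<open>y^2 (P(y) - P'(y)) exp(-y)\<close>. At 0 the
difference quotient is of the form \<open>y P(y) exp(-y)\<close>, which vanishes as \<open>y\<close> tends to infinity.\<close>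

lemma flat_exp_has_derivative:
  "(flat_exp P has_real_derivative flat_exp (monom 1 2 * (P - pderiv P)) x) (at x)"
proof (cases x "0 :: real" rule: linorder_cases)
  case greater
  have d: "((\<lambda>x. poly P (1 / x) * exp (- (1 / x))) has_real_derivative flat_exp (monom 1 2 * (P - pderiv P)) x) (at x)"
    unfolding flat_exp_def using greater
    by (auto intro!: derivative_eq_intros simp: poly_monom field_simps power2_eq_square)
  show ?thesis
    by (rule has_field_derivative_transform_within_open[OF d open_greaterThan[of 0]])
       (use greater in \<open>auto simp: flat_exp_def\<close>)
next
  case less
  have d: "((\<lambda>x. 0) has_real_derivative flat_exp (monom 1 2 * (P - pderiv P)) x) (at x)"
    using less by (auto simp: flat_exp_def)
  show ?thesis
    by (rule has_field_derivative_transform_within_open[OF d open_lessThan[of 0]])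
       (use less in \<open>auto simp: flat_exp_def\<close>)
next
  case equal
  let ?q = "\<lambda>h. (flat_exp P (0 + h) - flat_exp P 0) / h"
  have "((\<lambda>h. poly (monom 1 1 * P) (inverse h) * exp (- inverse h)) \<longlongrightarrow> 0) (at_right 0)"
    by (rule filterlim_compose[OF poly_times_exp_tendsto_0 filterlim_inverse_at_top_right])
  then have right: "(?q \<longlongrightarrow> 0) (at_right 0)"
    by (rule Lim_transform_eventually)
       (auto simp: eventually_at_right_field flat_exp_def poly_monom divide_inverse mult_ac intro!: exI[of _ 1])
  have left: "(?q \<longlongrightarrow> 0) (at_left 0)"
    by (rule Lim_transform_eventually[OF tendsto_const])
       (auto simp: eventually_at_left_field flat_exp_def intro!: exI[of _ "-1"])
  have "(?q \<longlongrightarrow> 0) (at 0)" by (rule filterlim_split_at[OF left right])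
  then show ?thesis by (simp add: DERIV_def equal flat_exp_def)
qed

lemma continuous_on_flat_exp: "continuous_on UNIV (flat_exp P)"
  by (metis flat_exp_has_derivative DERIV_isCont continuous_at_imp_continuous_on)

lemma C_k_flat_exp: "C_k k h \<Longrightarrow> C_k k (\<lambda>x. flat_exp P (h x))"
proof (induction k arbitrary: P)
  case 0
  then show ?case by (auto intro: continuous_on_compose2[OF continuous_on_flat_exp])
next
  case (Suc k)
  let ?P' = "monom 1 2 * (P - pderiv P)"
  have dh: "(h has_derivative frechet_derivative h (at x)) (at x)" for x
    using Suc.prems by (simp add: frechet_derivative_works[symmetric])
  have d: "((\<lambda>x. flat_exp P (h x)) has_derivative (\<lambda>v. flat_exp ?P' (h x) * frechet_derivative h (at x) v)) (at x)" for x
    using has_derivative_compose[OF dh flat_exp_has_derivative[THEN has_field_derivative_imp_has_derivative]] .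
  have "C_k k (\<lambda>x. flat_exp ?P' (h x) * frechet_derivative h (at x) (axis i 1))" for i
    by (intro C_k_mult Suc.IH C_k_SucD[OF Suc.prems]) (use Suc.prems in simp)
  then show ?case using d by (auto simp: differentiable_def frechet_derivative_at[OF d, symmetric])
qed

text \<open>With \<open>f = flat_exp 1\<close>, the composition \<open>f(f(1) - f(x))\<close> is constant for \<open>x \<le> 0\<close>, where \<open>f(x) = 0\<close>, and zero for
\<open>x \<ge> 1\<close>, where \<open>f(1) - f(x) \<le> 0\<close>. This produces a smooth step from compositions alone, without dividing by a
function and without integrating a bump.\<close>

definition smooth_step :: "real \<Rightarrow> real" where
  "smooth_step x = flat_exp 1 (flat_exp 1 1 - flat_exp 1 x) / flat_exp 1 (flat_exp 1 1)"

lemma flat_exp_one_mono: "x \<le> y \<Longrightarrow> flat_exp 1 x \<le> flat_exp 1 y"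
  by (auto simp: flat_exp_def frac_le)

lemma flat_exp_one_pos: "0 < x \<Longrightarrow> 0 < flat_exp 1 x"
  by (simp add: flat_exp_def)

lemma flat_exp_nonpos_eq_0: "x \<le> 0 \<Longrightarrow> flat_exp P x = 0"
  by (simp add: flat_exp_def)

lemma smooth_step_bounds: "0 \<le> smooth_step x" "smooth_step x \<le> 1"
proof -
  have pos: "0 < flat_exp 1 (flat_exp 1 1)" by (intro flat_exp_one_pos) simp
  have nn: "0 \<le> flat_exp 1 y" for y by (simp add: flat_exp_def)
  show "0 \<le> smooth_step x" unfolding smooth_step_def using nn pos by (simp add: less_imp_le)
  show "smooth_step x \<le> 1" unfolding smooth_step_def using pos
    by (simp add: divide_le_eq_1_pos) (rule flat_exp_one_mono, use nn in simp)
qed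

lemma smooth_step_left: "x \<le> 0 \<Longrightarrow> smooth_step x = 1"
proof -
  assume "x \<le> 0"
  moreover have "0 < flat_exp 1 (flat_exp 1 1)" by (intro flat_exp_one_pos) simp
  ultimately show ?thesis by (simp add: smooth_step_def flat_exp_nonpos_eq_0)
qed

lemma smooth_step_right: "1 \<le> x \<Longrightarrow> smooth_step x = 0"
  using flat_exp_one_mono[of 1 x] by (simp add: smooth_step_def flat_exp_nonpos_eq_0)

text \<open>The derivative is continuous and vanishes outside \<open>[-2, 2]\<close>, hence is bounded.\<close>

lemma radial_profile_lipschitz:
  "\<exists>L\<ge>1. \<forall>a b. \<bar>smooth_step (a\<^sup>2 - 1) - smooth_step (b\<^sup>2 - 1)\<bar> \<le> L * \<bar>a - b\<bar>"
proof -
  let ?Q = "monom 1 2 * (1 - pderiv 1) :: real poly"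
  define D where "D = (\<lambda>a::real. flat_exp ?Q (flat_exp 1 1 - flat_exp 1 (a\<^sup>2 - 1)) *
    (- (flat_exp ?Q (a\<^sup>2 - 1) * (2 * a))) / flat_exp 1 (flat_exp 1 1))"
  have der: "((\<lambda>a. smooth_step (a\<^sup>2 - 1)) has_field_derivative D a) (at a within S)" for a S
    unfolding smooth_step_def D_def
    by (rule DERIV_cdivide, rule DERIV_chain2[OF flat_exp_has_derivative])
       (auto intro!: derivative_eq_intros DERIV_chain2[OF flat_exp_has_derivative[where P = 1]])
  have cont: "continuous_on A D" for A
    unfolding D_def using flat_exp_one_pos[OF flat_exp_one_pos[of 1]]
    by (intro continuous_intros continuous_on_compose2[OF continuous_on_flat_exp]) auto
  have "bounded (D ` {-2..2})"
    by (intro compact_imp_bounded compact_continuous_image cont) simp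
  then obtain B where B: "\<And>a. a \<in> {-2..2} \<Longrightarrow> \<bar>D a\<bar> \<le> B"
    unfolding bounded_iff by (metis imageI real_norm_def)
  have D0: "D a = 0" if "a \<notin> {-2..2}" for a
  proof -
    have "2 \<le> \<bar>a\<bar>" using that by auto
    then have "2\<^sup>2 \<le> \<bar>a\<bar>\<^sup>2" by (intro power_mono) auto
    then have "1 \<le> a\<^sup>2 - 1" by simp
    then show ?thesis using flat_exp_one_mono[of 1 "a\<^sup>2 - 1"] by (simp add: D_def flat_exp_nonpos_eq_0)
  qed
  have bd: "norm (D a) \<le> max 1 B" for a using B[of a] D0[of a] by (cases "a \<in> {-2..2}") auto
  have "\<bar>smooth_step (a\<^sup>2 - 1) - smooth_step (b\<^sup>2 - 1)\<bar> \<le> max 1 B * \<bar>a - b\<bar>" for a b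
    using field_differentiable_bound[OF convex_UNIV der bd, of a b] by simp
  then show ?thesis by (intro exI[of _ "max 1 B"]) auto
qed

text \<open>The square of the norm makes the argument of the step a polynomial in the coordinates. The step is at 1 for
\<open>|x - z| \<le> r\<close> and at 0 for \<open>|x - z|^2 \<ge> 2 r^2\<close>, which is well inside the ball of radius \<open>2r\<close>.\<close>

definition cutoff :: "real ^ 'n \<Rightarrow> real \<Rightarrow> real ^ 'n \<Rightarrow> real" where
  "cutoff z r x = smooth_step ((norm (x - z) / r)\<^sup>2 - 1)"

lemma C_k_cutoff: "C_k k (cutoff z r)"
proof -
  have e: "(norm (x - z) / r)\<^sup>2 - 1 = (1 / r\<^sup>2) * (\<Sum>i\<in>UNIV. (x $ i + - z $ i) * (x $ i + - z $ i)) + - 1" for x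
    unfolding power_divide power2_norm_eq_inner by (simp add: inner_vec_def)
  have "C_k k (\<lambda>x. (1 / flat_exp 1 (flat_exp 1 1)) * flat_exp 1 (flat_exp 1 1 + (-1) * flat_exp 1 ((norm (x - z) / r)\<^sup>2 - 1)))"
    unfolding e by (intro C_k_add C_k_mult C_k_const C_k_sum C_k_component C_k_flat_exp)
  then show ?thesis by (simp add: cutoff_def[abs_def] smooth_step_def)
qed

lemma cutoff_bounds: "0 \<le> cutoff z r x" "cutoff z r x \<le> 1"
  by (simp_all add: cutoff_def smooth_step_bounds)

lemma cutoff_eq_1: "0 < r \<Longrightarrow> x \<in> cball z r \<Longrightarrow> cutoff z r x = 1"
  unfolding cutoff_def
  by (rule smooth_step_left) (auto simp: dist_norm norm_minus_commute divide_le_eq power_le_one_iff abs_square_le_1)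

lemma cutoff_support:
  assumes "0 < r"
  shows "closure {x. cutoff z r x \<noteq> 0} \<subseteq> cball z (3 / 2 * r)"
proof (rule closure_minimal)
  show "{x. cutoff z r x \<noteq> 0} \<subseteq> cball z (3 / 2 * r)"
  proof (rule subsetI, rule ccontr)
    fix x assume x: "x \<in> {x. cutoff z r x \<noteq> 0}" "x \<notin> cball z (3 / 2 * r)"
    then have "3 / 2 \<le> norm (x - z) / r" using assms by (simp add: dist_norm norm_minus_commute le_divide_eq)
    then have "(3 / 2)\<^sup>2 \<le> (norm (x - z) / r)\<^sup>2" by (intro power_mono) auto
    then have "cutoff z r x = 0" unfolding cutoff_def by (intro smooth_step_right) (simp add: power2_eq_square[of "3 / 2"])
    with x show False by simp
  qed
qed simp

lemma cutoff_outside: "0 < r \<Longrightarrow> x \<notin> ball z (2 * r) \<Longrightarrow> cutoff z r x = 0"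
  using cutoff_support[of r z] closure_subset[of "{x. cutoff z r x \<noteq> 0}"] by force

text \<open>One constant \<open>L\<close> serves all centres and radii, because all cutoffs are translates and dilates of one function.\<close>

lemma cutoff_lipschitz:
  "\<exists>L\<ge>1. \<forall>(z :: real ^ 'n) r x y. 0 < r \<longrightarrow> \<bar>cutoff z r x - cutoff z r y\<bar> \<le> L * (norm (x - y) / r)"
proof -
  obtain L where L: "1 \<le> L" "\<And>a b. \<bar>smooth_step (a\<^sup>2 - 1) - smooth_step (b\<^sup>2 - 1)\<bar> \<le> L * \<bar>a - b\<bar>"
    using radial_profile_lipschitz by blast
  have "\<bar>cutoff z r x - cutoff z r y\<bar> \<le> L * (norm (x - y) / r)" if "0 < r" for z x y :: "real ^ 'n" and r
  proof -
    have "\<bar>cutoff z r x - cutoff z r y\<bar> \<le> L * \<bar>norm (x - z) / r - norm (y - z) / r\<bar>"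
      unfolding cutoff_def by (rule L)
    also have "\<bar>norm (x - z) / r - norm (y - z) / r\<bar> = \<bar>norm (x - z) - norm (y - z)\<bar> / r"
      using that by (simp add: diff_divide_distrib[symmetric])
    also have "\<dots> \<le> norm (x - y) / r"
      using norm_triangle_ineq3[of "x - z" "y - z"] that by (intro divide_right_mono) auto
    finally show ?thesis using L(1) by (simp add: mult_left_mono)
  qed
  then show ?thesis using L(1) by blast
qed

text \<open>Outside \<open>\<Omega>\<close> the test function \<open>u\<close> vanishes, so there the function is equal to the cutoff, which is 1 on the ball.\<close>

lemma cutoff_competitor:
  assumes u: "u \<in> test_functions \<Omega>" and r: "0 < r" and m: "m \<noteq> 0"
  shows "(\<lambda>x. cutoff z r x * ((m - u x) / m)) \<in> {\<phi> \<in> test_functions (ball z (2 * r)). \<forall>x\<in>cball z r - \<Omega>. 1 \<le> \<phi> x}"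
proof -
  let ?\<phi> = "\<lambda>x. cutoff z r x * ((m - u x) / m)"
  have "C_k k (\<lambda>x. cutoff z r x * (1 + (- 1 / m) * u x))" for k
    using u by (intro C_k_mult C_k_add C_k_const C_k_cutoff) (auto simp: test_functions_def smooth_def)
  then have "smooth ?\<phi>" using m by (simp add: smooth_def diff_divide_distrib)
  moreover have "{x. ?\<phi> x \<noteq> 0} \<subseteq> {x. cutoff z r x \<noteq> 0}" by auto
  then have "closure {x. ?\<phi> x \<noteq> 0} \<subseteq> closure {x. cutoff z r x \<noteq> 0}" by (rule closure_mono)
  with cutoff_support[OF r, of z] have sub: "closure {x. ?\<phi> x \<noteq> 0} \<subseteq> cball z (3 / 2 * r)" by blast
  then have "compact (closure {x. ?\<phi> x \<noteq> 0})"
    by (meson bounded_cball bounded_subset closed_closure compact_eq_bounded_closed)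
  moreover have "cball z (3 / 2 * r) \<subseteq> ball z (2 * r)" using r by auto
  with sub have "closure {x. ?\<phi> x \<noteq> 0} \<subseteq> ball z (2 * r)" by blast
  moreover have "1 \<le> ?\<phi> x" if "x \<in> cball z r - \<Omega>" for x
    using that cutoff_eq_1[OF r, of x z] test_functions_outside[OF u, of x] m by simp
  ultimately show ?thesis by (simp add: test_functions_def)
qed

section \<open>The energy of a truncated difference\<close>

lemma cutoff_measurable [measurable]: "cutoff z r \<in> borel_measurable borel"
  using C_k_cutoff[of 0] by (auto intro: borel_measurable_continuous_onI)

text \<open>The increment of the cutoff at distance \<open>d\<close> is at most \<open>min(1, L d / r)\<close>. Scales up to \<open>r\<close> therefore contribute
the integral of \<open>t^(p (1 - s) - 1)\<close>, of order \<open>1 / (1 - s)\<close>, and scales beyond \<open>r\<close> that of \<open>t^(-sp - 1)\<close>, of order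
\<open>1 / s\<close>. The factor \<open>1 / (s (1 - s))\<close> matches the one in \<open>ball_capacity_lower_bound\<close>.\<close>

lemma cutoff_gagliardo_density:
  fixes p :: real
  assumes p: "1 \<le> p"
  shows "\<exists>C>0. \<forall>s (z :: real ^ 'n) r x. 0 < s \<and> s < 1 \<and> 0 < r \<longrightarrow>
    gagliardo_density s p (cutoff z r) x \<le> ennreal (C * r powr (- (s * p)) / (s * (1 - s)))"
proof -
  let ?N = "real CARD('n)"
  define w where "w = unit_ball_vol ?N"
  have w: "0 < w" by (simp add: w_def)
  have N: "1 \<le> ?N" by (simp add: Suc_le_eq)
  obtain L where L: "1 \<le> L"
    and lip: "\<And>(z :: real ^ 'n) r x y. 0 < r \<Longrightarrow> \<bar>cutoff z r x - cutoff z r y\<bar> \<le> L * (norm (x - y) / r)"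
    using cutoff_lipschitz by blast
  define C where "C = (?N + p) * (w * L powr p) / p"
  have C: "0 < C" using p w L N by (simp add: C_def)
  have "gagliardo_density s p (cutoff z r) x \<le> ennreal (C * r powr (- (s * p)) / (s * (1 - s)))"
    if s: "0 < s" "s < 1" and r: "0 < r" for s and z :: "real ^ 'n" and r x
  proof -
    have sp: "0 < s * p" "s * p \<le> p" "0 < p * (1 - s)" using s p by auto
    let ?m = "\<lambda>t. if t \<le> r then L powr p * (t / r) powr p else L powr p"
    have inc: "\<bar>cutoff z r x - cutoff z r y\<bar> powr p \<le> ?m t" if "norm (x - y) < t" for y t
    proof -
      have t: "0 < t" using that norm_ge_zero[of "x - y"] by linarith
      have "\<bar>cutoff z r x - cutoff z r y\<bar> \<le> 1"
        using cutoff_bounds[of z r x] cutoff_bounds[of z r y] by (auto simp: abs_if)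
      then have 1: "\<bar>cutoff z r x - cutoff z r y\<bar> powr p \<le> 1" using p by (intro powr_le1) auto
      have "\<bar>cutoff z r x - cutoff z r y\<bar> \<le> L * (norm (x - y) / r)" by (rule lip[OF r])
      also have "\<dots> \<le> L * (t / r)" using that L r by (intro mult_left_mono divide_right_mono) auto
      finally have "\<bar>cutoff z r x - cutoff z r y\<bar> powr p \<le> (L * (t / r)) powr p"
        using p by (intro powr_mono2) auto
      also have "\<dots> = L powr p * (t / r) powr p" by (rule powr_mult)
      finally have 2: "\<bar>cutoff z r x - cutoff z r y\<bar> powr p \<le> L powr p * (t / r) powr p" .
      have "1 \<le> L powr p" using L p by (simp add: ge_one_powr_ge_zero)
      with 1 2 show ?thesis by auto
    qed
    have loc: "local_increment p (cutoff z r) x t \<le> ennreal (?m t * (w * t powr ?N))" if t: "0 < t" for t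
    proof -
      have "local_increment p (cutoff z r) x t \<le> (\<integral>\<^sup>+y. ennreal (?m t) * indicator (ball x t) y \<partial>lborel)"
        unfolding local_increment_def
        using inc[of _ t] by (intro nn_integral_mono) (auto simp: indicator_def dist_norm ennreal_leI)
      also have "\<dots> = ennreal (?m t) * emeasure lborel (ball x t)"
        by (rule nn_integral_cmult_indicator) simp
      also have "\<dots> = ennreal (?m t * (w * t powr ?N))"
        using t w by (subst emeasure_lborel_ball) (auto simp: w_def ennreal_mult)
      finally show ?thesis .
    qed
    have pt: "ennreal (t powr (- (?N + s * p) - 1)) * indicator {0<..} t * local_increment p (cutoff z r) x t
      \<le> ennreal (w * L powr p * r powr (-p)) * (ennreal (t powr (p * (1 - s) - 1)) * indicator {0<..r} t)
        + ennreal (w * L powr p) * (ennreal (t powr (- (s * p) - 1)) * indicator {r<..} t)" for t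
    proof (cases "0 < t")
      case t: True
      have "ennreal (t powr (- (?N + s * p) - 1)) * local_increment p (cutoff z r) x t
         \<le> ennreal (t powr (- (?N + s * p) - 1)) * ennreal (?m t * (w * t powr ?N))"
        by (intro mult_left_mono loc t) simp
      also have "\<dots> = ennreal (w * ?m t * (t powr (- (?N + s * p) - 1) * t powr ?N))"
        by (simp flip: ennreal_mult' add: mult_ac)
      also have "t powr (- (?N + s * p) - 1) * t powr ?N = t powr (- (s * p) - 1)"
        by (simp add: powr_add[symmetric])
      also have "ennreal (w * ?m t * t powr (- (s * p) - 1)) =
         ennreal (w * L powr p * r powr (-p)) * (ennreal (t powr (p * (1 - s) - 1)) * indicator {0<..r} t)
        + ennreal (w * L powr p) * (ennreal (t powr (- (s * p) - 1)) * indicator {r<..} t)"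
      proof (cases "t \<le> r")
        case True
        have "(t / r) powr p * t powr (- (s * p) - 1) = r powr (-p) * (t powr p * t powr (- (s * p) - 1))"
          unfolding powr_minus powr_divide by (simp only: divide_inverse mult_ac)
        also have "t powr p * t powr (- (s * p) - 1) = t powr (p * (1 - s) - 1)"
          by (simp add: powr_add[symmetric] algebra_simps)
        finally have "w * (L powr p * (t / r) powr p) * t powr (- (s * p) - 1)
           = w * L powr p * r powr (-p) * t powr (p * (1 - s) - 1)"
          by (simp only: mult.assoc)
        then have "ennreal (w * ?m t * t powr (- (s * p) - 1)) = ennreal (w * L powr p * r powr (-p) * t powr (p * (1 - s) - 1))"
          using True by (simp only: if_True)
        also have "\<dots> = ennreal (w * L powr p * r powr (-p)) * ennreal (t powr (p * (1 - s) - 1))"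
          by (rule ennreal_mult') (use w in simp)
        finally show ?thesis using True t by (simp add: indicator_def)
      qed (use w in \<open>simp add: ennreal_mult\<close>)
      finally show ?thesis using t by simp
    qed simp
    have "gagliardo_density s p (cutoff z r) x = ennreal (?N + s * p) *
       (\<integral>\<^sup>+t. ennreal (t powr (- (?N + s * p) - 1)) * indicator {0<..} t * local_increment p (cutoff z r) x t \<partial>lborel)"
      by (rule gagliardo_density_layers[OF _ p s(1)]) simp
    also have "\<dots> \<le> ennreal (?N + p) * (\<integral>\<^sup>+t.
         ennreal (w * L powr p * r powr (-p)) * (ennreal (t powr (p * (1 - s) - 1)) * indicator {0<..r} t)
        + ennreal (w * L powr p) * (ennreal (t powr (- (s * p) - 1)) * indicator {r<..} t) \<partial>lborel)"
      using sp by (intro mult_mono nn_integral_mono pt ennreal_leI) auto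
    also have "\<dots> = ennreal (?N + p) * (ennreal (w * L powr p * r powr (-p)) * ennreal (r powr (p * (1 - s)) / (p * (1 - s)))
        + ennreal (w * L powr p) * ennreal (r powr (- (s * p)) / (s * p)))"
      using r by (simp add: nn_integral_add nn_integral_cmult nn_integral_powr_head[OF sp(3)] nn_integral_powr_tail[OF sp(1)])
    also have "\<dots> = ennreal ((?N + p) * (w * L powr p * (r powr (-p) * r powr (p * (1 - s))) / (p * (1 - s))
        + w * L powr p * r powr (- (s * p)) / (s * p)))"
      using w sp p by (simp add: ennreal_mult'[symmetric] ennreal_plus[symmetric] mult.assoc del: ennreal_plus)
    also have "r powr (-p) * r powr (p * (1 - s)) = r powr (- (s * p))"
      by (simp add: powr_add[symmetric] algebra_simps)
    also have "(?N + p) * (w * L powr p * r powr (- (s * p)) / (p * (1 - s)) + w * L powr p * r powr (- (s * p)) / (s * p))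
       = C * r powr (- (s * p)) / (s * (1 - s))"
    proof -
      have gen: "M * (A * R / (p * (1 - s)) + A * R / (s * p)) = M * A / p * R / (s * (1 - s))" for M A R
        using s p by (simp add: field_simps)
      show ?thesis unfolding C_def by (rule gen)
    qed
    finally show ?thesis .
  qed
  then show ?thesis using C by blast
qed

lemma gagliardo_cmult:
  fixes u :: "real ^ 'n \<Rightarrow> real"
  assumes [measurable]: "u \<in> borel_measurable borel" 
  shows "gagliardo s p (\<lambda>x. c * u x) = ennreal (\<bar>c\<bar> powr p) * gagliardo s p u"
proof -
  have e: "\<bar>c * a - c * b\<bar> powr p / k = \<bar>c\<bar> powr p * (\<bar>a - b\<bar> powr p / k)" for a b k :: real
    by (simp add: right_diff_distrib[symmetric] abs_mult powr_mult)
  have m: "(\<lambda>(x, y). ennreal (\<bar>u x - u y\<bar> powr p / norm (x - y) powr (real CARD('n) + s * p)))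
    \<in> borel_measurable (lborel \<Otimes>\<^sub>M lborel)" by measurable
  show ?thesis unfolding gagliardo_def e
    by (subst nn_integral_cmult[OF m, symmetric])
       (auto simp only: ennreal_mult'[OF powr_ge_zero] split: prod.split intro!: nn_integral_cong)
qed

text \<open>A product rule for differences in which every term carries an indicator. Here \<open>a\<close> and \<open>b\<close> are the values of the
cutoff at two points \<open>x\<close> and \<open>y\<close>, \<open>U\<close> and \<open>V\<close> those of the other factor, and \<open>P\<close> and \<open>Q\<close> say that \<open>x\<close> and \<open>y\<close> lie in
the support of the cutoff. The usual splitting would leave \<open>U\<close> at points outside the support, where it is not
controlled; if \<open>P\<close> fails then \<open>a = 0\<close> and only \<open>V\<close> is needed.\<close>

lemma cutoff_product_bound:
  fixes a b U V p :: real
  assumes p: "1 \<le> p" and a: "0 \<le> a" "a \<le> 1" and b: "0 \<le> b" "b \<le> 1"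
    and A: "\<not> P \<Longrightarrow> a = 0" and B: "\<not> Q \<Longrightarrow> b = 0"
  shows "\<bar>a * U - b * V\<bar> powr p \<le> 2 powr (p - 1) *
    (of_bool Q * \<bar>U - V\<bar> powr p + \<bar>a - b\<bar> powr p * (of_bool P * \<bar>U\<bar> powr p) + \<bar>a - b\<bar> powr p * (of_bool Q * \<bar>V\<bar> powr p))"
proof (cases P)
  case True
  have "\<bar>b * (U - V) + (a - b) * U\<bar> powr p
    \<le> 2 powr (p - 1) * (\<bar>b * (U - V)\<bar> powr p + \<bar>(a - b) * U\<bar> powr p)" by (rule abs_add_powr_le[OF p])
  moreover have "\<bar>b * (U - V)\<bar> powr p \<le> of_bool Q * \<bar>U - V\<bar> powr p"
  proof (cases Q)
    case True
    have "\<bar>b * (U - V)\<bar> \<le> \<bar>U - V\<bar>" using b by (simp add: abs_mult mult_left_le_one_le)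
    then show ?thesis using True p by (simp add: powr_mono2)
  qed (use B in simp)
  moreover have "\<bar>(a - b) * U\<bar> powr p = \<bar>a - b\<bar> powr p * \<bar>U\<bar> powr p" by (simp add: abs_mult powr_mult)
  moreover have "a * U - b * V = b * (U - V) + (a - b) * U" by (simp add: algebra_simps)
  moreover have "0 \<le> \<bar>a - b\<bar> powr p * (of_bool Q * \<bar>V\<bar> powr p)" by simp
  ultimately have le1: "\<bar>a * U - b * V\<bar> powr p \<le> 2 powr (p - 1) * (\<bar>b * (U - V)\<bar> powr p + \<bar>(a - b) * U\<bar> powr p)"
    and le2: "\<bar>b * (U - V)\<bar> powr p + \<bar>(a - b) * U\<bar> powr p \<le>
     of_bool Q * \<bar>U - V\<bar> powr p + \<bar>a - b\<bar> powr p * (of_bool P * \<bar>U\<bar> powr p) + \<bar>a - b\<bar> powr p * (of_bool Q * \<bar>V\<bar> powr p)"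
    using True by (simp_all add: add_increasing2)
  show ?thesis by (rule order_trans[OF le1 mult_left_mono[OF le2 powr_ge_zero]])
next
  case False
  show ?thesis
  proof (cases Q)
    case True
    have "1 \<le> (2::real) powr (p - 1)" using p by (simp add: ge_one_powr_ge_zero)
    moreover have "\<bar>b * V\<bar> powr p \<le> \<bar>U - V\<bar> powr p + \<bar>b\<bar> powr p * \<bar>V\<bar> powr p" by (simp add: abs_mult powr_mult)
    ultimately have "1 * \<bar>b * V\<bar> powr p \<le> 2 powr (p - 1) * (\<bar>U - V\<bar> powr p + \<bar>b\<bar> powr p * \<bar>V\<bar> powr p)"
      by (intro mult_mono) auto
    then show ?thesis using False True A by simp
  qed (use A B False in simp)
qed

text \<open>The first of the three terms of \<open>cutoff_product_bound\<close> yields the energy density of \<open>u\<close> on the ball. In the other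
two, which are symmetric to each other, the cutoff is integrated out first.\<close>

lemma gagliardo_cutoff_difference:
  fixes u :: "real ^ 'n \<Rightarrow> real"
  assumes [measurable]: "u \<in> borel_measurable borel" and p: "1 \<le> p" and r: "0 < r"
    and K: "\<And>x. gagliardo_density s p (cutoff z r) x \<le> K"
  shows "gagliardo s p (\<lambda>x. cutoff z r x * (m - u x)) \<le> ennreal (2 powr (p - 1)) *
    ((\<integral>\<^sup>+y. (if norm (z - y) < 2 * r then gagliardo_density s p u y else 0) \<partial>lborel)
     + 2 * K * (\<integral>\<^sup>+y. (if norm (z - y) < 2 * r then ennreal (\<bar>m - u y\<bar> powr p) else 0) \<partial>lborel))"
proof -
  let ?\<eta> = "cutoff z r" and ?B = "\<lambda>x. norm (z - x) < 2 * r"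
  let ?U = "\<lambda>x. m - u x"
  let ?k = "\<lambda>x y :: real ^ 'n. norm (x - y) powr (real CARD('n) + s * p)"
  define I where "I = (\<lambda>x. (if ?B x then ennreal (\<bar>?U x\<bar> powr p) else 0))"
  have [measurable]: "I \<in> borel_measurable borel" unfolding I_def by measurable
  define F where "F = (\<lambda>x y. (if ?B y then ennreal (\<bar>u x - u y\<bar> powr p / ?k x y) else 0))"
  define G where "G = (\<lambda>x y. ennreal (\<bar>?\<eta> x - ?\<eta> y\<bar> powr p / ?k x y))"
  have F_measurable: "case_prod F \<in> borel_measurable (borel \<Otimes>\<^sub>M borel)" unfolding F_def by measurable
  have G_measurable: "case_prod G \<in> borel_measurable (borel \<Otimes>\<^sub>M borel)" unfolding G_def by measurable
  note [measurable] = F_measurable G_measurable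
  have Fm[measurable]: "F x \<in> borel_measurable borel" and Gm[measurable]: "G x \<in> borel_measurable borel" for x
    unfolding F_def G_def by measurable
  have k_commute: "?k x y = ?k y x" for x y by (simp add: norm_minus_commute)
  have pt: "ennreal (\<bar>?\<eta> x * ?U x - ?\<eta> y * ?U y\<bar> powr p / ?k x y)
    \<le> ennreal (2 powr (p - 1)) * (F x y + G x y * I x + G x y * I y)" for x y
  proof -
    have "\<bar>?\<eta> x * ?U x - ?\<eta> y * ?U y\<bar> powr p \<le> 2 powr (p - 1) *
      (of_bool (?B y) * \<bar>?U x - ?U y\<bar> powr p + \<bar>?\<eta> x - ?\<eta> y\<bar> powr p * (of_bool (?B x) * \<bar>?U x\<bar> powr p)
       + \<bar>?\<eta> x - ?\<eta> y\<bar> powr p * (of_bool (?B y) * \<bar>?U y\<bar> powr p))"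
      using cutoff_outside[OF r, of _ z]
      by (intro cutoff_product_bound p cutoff_bounds) (auto simp: dist_norm)
    then have "\<bar>?\<eta> x * ?U x - ?\<eta> y * ?U y\<bar> powr p / ?k x y \<le> 2 powr (p - 1) *
      (of_bool (?B y) * \<bar>?U x - ?U y\<bar> powr p + \<bar>?\<eta> x - ?\<eta> y\<bar> powr p * (of_bool (?B x) * \<bar>?U x\<bar> powr p)
       + \<bar>?\<eta> x - ?\<eta> y\<bar> powr p * (of_bool (?B y) * \<bar>?U y\<bar> powr p)) / ?k x y"
      by (rule divide_right_mono) simp
    also have "\<dots> = 2 powr (p - 1) *
      (of_bool (?B y) * (\<bar>?U x - ?U y\<bar> powr p / ?k x y)
       + (\<bar>?\<eta> x - ?\<eta> y\<bar> powr p / ?k x y) * (of_bool (?B x) * \<bar>?U x\<bar> powr p)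
       + (\<bar>?\<eta> x - ?\<eta> y\<bar> powr p / ?k x y) * (of_bool (?B y) * \<bar>?U y\<bar> powr p))"
    proof -
      have gen: "c * (q * a + e * b + e * d) / k = c * (q * (a / k) + (e / k) * b + (e / k) * d)" for c q a e b d k :: real
        by (cases "k = 0") (simp_all add: field_simps)
      show ?thesis by (rule gen)
    qed
    finally have le: "ennreal (\<bar>?\<eta> x * ?U x - ?\<eta> y * ?U y\<bar> powr p / ?k x y) \<le> ennreal \<dots>" by (rule ennreal_leI)
    have UU: "\<bar>?U x - ?U y\<bar> = \<bar>u x - u y\<bar>" by simp
    have gen: "ennreal (c * (of_bool Q * f + g * (of_bool P * a) + g * (of_bool Q * b))) =
        ennreal c * ((if Q then ennreal f else 0) + ennreal g * (if P then ennreal a else 0)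
          + ennreal g * (if Q then ennreal b else 0))"
      if "0 \<le> c" "0 \<le> f" "0 \<le> g" "0 \<le> a" "0 \<le> b" for c f g a b P Q
      using that by (auto simp: ennreal_mult ennreal_plus)
    show ?thesis
      using le unfolding UU F_def G_def I_def by (subst (asm) gen) auto
  qed
  have T1: "(\<integral>\<^sup>+x. \<integral>\<^sup>+y. F x y \<partial>lborel \<partial>lborel) = (\<integral>\<^sup>+y. (if ?B y then gagliardo_density s p u y else 0) \<partial>lborel)"
  proof -
    have "(\<integral>\<^sup>+x. \<integral>\<^sup>+y. F x y \<partial>lborel \<partial>lborel) = (\<integral>\<^sup>+y. \<integral>\<^sup>+x. F x y \<partial>lborel \<partial>lborel)"
      by (rule lborel_pair.Fubini') measurable
    also have "\<dots> = (\<integral>\<^sup>+y. (if ?B y then gagliardo_density s p u y else 0) \<partial>lborel)"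
      by (intro nn_integral_cong)
         (simp add: F_def gagliardo_density_def norm_minus_commute abs_minus_commute)
    finally show ?thesis .
  qed
  have G_int: "(\<integral>\<^sup>+y. G x y \<partial>lborel) \<le> K" for x
    using K[of x] by (simp add: G_def gagliardo_density_def)
  have T2: "(\<integral>\<^sup>+x. \<integral>\<^sup>+y. G x y * I x \<partial>lborel \<partial>lborel) \<le> K * (\<integral>\<^sup>+x. I x \<partial>lborel)"
  proof -
    have "(\<integral>\<^sup>+x. \<integral>\<^sup>+y. G x y * I x \<partial>lborel \<partial>lborel) \<le> (\<integral>\<^sup>+x. K * I x \<partial>lborel)"
      by (intro nn_integral_mono) (simp add: nn_integral_multc mult_right_mono G_int)
    then show ?thesis by (simp add: nn_integral_cmult)
  qed
  have T3: "(\<integral>\<^sup>+x. \<integral>\<^sup>+y. G x y * I y \<partial>lborel \<partial>lborel) = (\<integral>\<^sup>+x. \<integral>\<^sup>+y. G x y * I x \<partial>lborel \<partial>lborel)"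
  proof -
    have "(\<integral>\<^sup>+x. \<integral>\<^sup>+y. G x y * I y \<partial>lborel \<partial>lborel) = (\<integral>\<^sup>+y. \<integral>\<^sup>+x. G x y * I y \<partial>lborel \<partial>lborel)"
      by (rule lborel_pair.Fubini') measurable
    also have "\<dots> = (\<integral>\<^sup>+y. \<integral>\<^sup>+x. G y x * I y \<partial>lborel \<partial>lborel)"
      by (simp add: G_def norm_minus_commute abs_minus_commute)
    finally show ?thesis .
  qed
  have "gagliardo s p (\<lambda>x. ?\<eta> x * ?U x)
      = (\<integral>\<^sup>+x. \<integral>\<^sup>+y. ennreal (\<bar>?\<eta> x * ?U x - ?\<eta> y * ?U y\<bar> powr p / ?k x y) \<partial>lborel \<partial>lborel)"
    by (subst gagliardo_eq_nn_integral_density) (simp_all add: gagliardo_density_def[abs_def])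
  also have "\<dots> \<le> (\<integral>\<^sup>+x. \<integral>\<^sup>+y. ennreal (2 powr (p - 1)) * (F x y + G x y * I x + G x y * I y) \<partial>lborel \<partial>lborel)"
    by (intro nn_integral_mono pt)
  also have "\<dots> = ennreal (2 powr (p - 1)) * ((\<integral>\<^sup>+x. \<integral>\<^sup>+y. F x y \<partial>lborel \<partial>lborel)
     + (\<integral>\<^sup>+x. \<integral>\<^sup>+y. G x y * I x \<partial>lborel \<partial>lborel) + (\<integral>\<^sup>+x. \<integral>\<^sup>+y. G x y * I y \<partial>lborel \<partial>lborel))"
    by (simp add: nn_integral_cmult nn_integral_add)
  also have "\<dots> \<le> ennreal (2 powr (p - 1)) *
     ((\<integral>\<^sup>+y. (if ?B y then gagliardo_density s p u y else 0) \<partial>lborel)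
      + K * (\<integral>\<^sup>+x. I x \<partial>lborel) + K * (\<integral>\<^sup>+x. I x \<partial>lborel))"
    unfolding T1 T3 by (intro mult_left_mono add_mono T2) auto
  also have "\<dots> = ennreal (2 powr (p - 1)) *
     ((\<integral>\<^sup>+y. (if ?B y then gagliardo_density s p u y else 0) \<partial>lborel) + 2 * K * (\<integral>\<^sup>+x. I x \<partial>lborel))"
  proof -
    have gen: "A + K * J + K * J = A + 2 * K * J" for A J by (simp add: mult_2 distrib_right add.assoc)
    show ?thesis unfolding gen ..
  qed
  finally show ?thesis unfolding I_def .
qed

section \<open>A capacitary Poincare inequality\<close>

lemma nn_integral_over_balls:
  fixes f :: "real ^ 'n \<Rightarrow> ennreal"
  assumes [measurable]: "f \<in> borel_measurable borel" and t: "0 \<le> t"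
  shows "(\<integral>\<^sup>+z. \<integral>\<^sup>+y. (if norm (z - y) < t then f y else 0) \<partial>lborel \<partial>lborel)
    = ennreal (unit_ball_vol (real CARD('n)) * t powr real CARD('n)) * (\<integral>\<^sup>+y. f y \<partial>lborel)"
proof -
  have "(\<integral>\<^sup>+z. \<integral>\<^sup>+y. (if norm (z - y) < t then f y else 0) \<partial>lborel \<partial>lborel)
    = (\<integral>\<^sup>+y. \<integral>\<^sup>+z. (if norm (z - y) < t then f y else 0) \<partial>lborel \<partial>lborel)"
    by (rule lborel_pair.Fubini') measurable
  also have "\<dots> = (\<integral>\<^sup>+y. \<integral>\<^sup>+z. f y * indicator (ball y t) z \<partial>lborel \<partial>lborel)"
    by (intro nn_integral_cong) (auto simp: indicator_def dist_norm norm_minus_commute)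
  also have "\<dots> = (\<integral>\<^sup>+y. f y * ennreal (unit_ball_vol (real CARD('n)) * t powr real CARD('n)) \<partial>lborel)"
    using t by (simp add: nn_integral_cmult_indicator emeasure_lborel_ball)
  finally show ?thesis by (simp add: nn_integral_multc mult.commute)
qed

text \<open>What is known about \<open>\<Omega>\<close> at a scale \<open>r\<close> above the capacitary inradius, where no ball of radius \<open>r\<close> is negligible.\<close>

definition thick :: "real \<Rightarrow> real \<Rightarrow> real \<Rightarrow> (real ^ 'n) set \<Rightarrow> real \<Rightarrow> bool" where
  "thick s p \<gamma> \<Omega> r \<longleftrightarrow> (\<forall>z. ennreal \<gamma> * rel_cap s p (cball z r) (ball z (2 * r))
     \<le> rel_cap s p (cball z r - \<Omega>) (ball z (2 * r)))"

lemma capacity_times_value_le: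
  fixes u :: "real ^ 'n \<Rightarrow> real"
  assumes u: "u \<in> test_functions \<Omega>" and r: "0 < r" and p: "1 \<le> p"
  shows "ennreal (\<bar>u z\<bar> powr p) * rel_cap s p (cball z r - \<Omega>) (ball z (2 * r))
    \<le> gagliardo s p (\<lambda>x. cutoff z r x * (u z - u x))"
proof (cases "u z = 0")
  case False
  let ?\<phi> = "\<lambda>x. cutoff z r x * ((u z - u x) / u z)"
  note [measurable] = test_functions_measurable[OF u]
  have "rel_cap s p (cball z r - \<Omega>) (ball z (2 * r)) \<le> gagliardo s p ?\<phi>"
    unfolding rel_cap_def by (rule INF_lower) (rule cutoff_competitor[OF u r False])
  then have "ennreal (\<bar>u z\<bar> powr p) * rel_cap s p (cball z r - \<Omega>) (ball z (2 * r))
     \<le> ennreal (\<bar>u z\<bar> powr p) * gagliardo s p ?\<phi>" by (rule mult_left_mono) simp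
  also have "\<dots> = gagliardo s p (\<lambda>x. u z * ?\<phi> x)"
    by (rule gagliardo_cmult[symmetric]) measurable
  also have "(\<lambda>x. u z * ?\<phi> x) = (\<lambda>x. cutoff z r x * (u z - u x))" using False by simp
  finally show ?thesis .
qed (use p in simp)

text \<open>Integrating \<open>capacity_times_value_le\<close> over all centres turns the energy density on \<open>ball z (2r)\<close> into a multiple of
\<open>r^N\<close> times the energy, and the local increments into \<open>D(2r)\<close>. Dividing by the capacity of a ball leaves
\<open>s (1 - s)\<close> in front of the energy, while in front of \<open>D(2r)\<close> the factors \<open>1 / (s (1 - s))\<close> of the cutoff and of the
capacity cancel.\<close>

lemma thick_scale_inequality:
  fixes p :: real
  assumes p: "1 \<le> p"
  shows "\<exists>C>0. \<forall>s \<gamma> r \<Omega> (u :: real ^ 'n \<Rightarrow> real).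
    0 < s \<and> s < 1 \<and> 0 \<le> \<gamma> \<and> 0 < r \<and> u \<in> test_functions \<Omega> \<and> thick s p \<gamma> \<Omega> r \<longrightarrow>
    ennreal \<gamma> * (\<integral>\<^sup>+x. ennreal (\<bar>u x\<bar> powr p) \<partial>lborel) \<le>
      ennreal (C * (s * (1 - s) * r powr (s * p))) * gagliardo s p u
      + ennreal (C * r powr (- real CARD('n))) * increment p u (2 * r)"
proof -
  let ?N = "real CARD('n)"
  define w where "w = unit_ball_vol ?N"
  have w: "0 < w" by (simp add: w_def)
  obtain c where c: "0 < c" and cap: "\<And>s (z :: real ^ 'n) r. 0 < s \<Longrightarrow> s < 1 \<Longrightarrow> 0 < r \<Longrightarrow>
      ennreal (c * r powr (?N - s * p) / (s * (1 - s))) \<le> rel_cap s p (cball z r) (ball z (2 * r))"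
    using ball_capacity_lower_bound[OF p, where 'n = 'n] by blast
  obtain K where K: "0 < K" and dens: "\<And>s (z :: real ^ 'n) r x. 0 < s \<Longrightarrow> s < 1 \<Longrightarrow> 0 < r \<Longrightarrow>
      gagliardo_density s p (cutoff z r) x \<le> ennreal (K * r powr (- (s * p)) / (s * (1 - s)))"
    using cutoff_gagliardo_density[OF p, where 'n = 'n] by blast
  define Ca where "Ca = 2 powr (p - 1) * w * 2 powr ?N / c"
  define Cb where "Cb = 2 powr (p - 1) * 2 * K / c"
  have Cab: "0 < Ca" "0 < Cb" using w c K by (simp_all add: Ca_def Cb_def)
  have "ennreal \<gamma> * (\<integral>\<^sup>+x. ennreal (\<bar>u x\<bar> powr p) \<partial>lborel) \<le>
      ennreal ((Ca + Cb) * (s * (1 - s) * r powr (s * p))) * gagliardo s p u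
      + ennreal ((Ca + Cb) * r powr (- ?N)) * increment p u (2 * r)"
    if s: "0 < s" "s < 1" and \<gamma>: "0 \<le> \<gamma>" and r: "0 < r" and u: "u \<in> test_functions \<Omega>"
      and thick: "thick s p \<gamma> \<Omega> r" for s \<gamma> r \<Omega> and u :: "real ^ 'n \<Rightarrow> real"
  proof -
    note [measurable] = test_functions_measurable[OF u]
    define k where "k = c * r powr (?N - s * p) / (s * (1 - s))"
    define h where "h = K * r powr (- (s * p)) / (s * (1 - s))"
    have k: "0 < k" and h: "0 < h" using s r c K by (simp_all add: k_def h_def)
    let ?X = "\<integral>\<^sup>+x. ennreal (\<bar>u x\<bar> powr p) \<partial>lborel"
    let ?A = "\<lambda>z. \<integral>\<^sup>+y. (if norm (z - y) < 2 * r then gagliardo_density s p u y else 0) \<partial>lborel"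
    have pt: "ennreal k * ennreal \<gamma> * ennreal (\<bar>u z\<bar> powr p)
      \<le> ennreal (2 powr (p - 1)) * (?A z + 2 * ennreal h * local_increment p u z (2 * r))" for z
    proof -
      have "ennreal k * ennreal \<gamma> \<le> ennreal \<gamma> * rel_cap s p (cball z r) (ball z (2 * r))"
        unfolding k_def by (subst mult.commute) (intro mult_left_mono cap s r, simp)
      also have "\<dots> \<le> rel_cap s p (cball z r - \<Omega>) (ball z (2 * r))"
        using thick by (simp add: thick_def)
      finally have "ennreal k * ennreal \<gamma> * ennreal (\<bar>u z\<bar> powr p)
         \<le> rel_cap s p (cball z r - \<Omega>) (ball z (2 * r)) * ennreal (\<bar>u z\<bar> powr p)"
        by (rule mult_right_mono) simp
      also have "\<dots> \<le> gagliardo s p (\<lambda>x. cutoff z r x * (u z - u x))"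
        using capacity_times_value_le[OF u r p, of z s] by (simp add: mult.commute)
      also have "\<dots> \<le> ennreal (2 powr (p - 1)) * (?A z + 2 * ennreal h * local_increment p u z (2 * r))"
        unfolding local_increment_def
        by (rule gagliardo_cutoff_difference[OF _ p r]) (use dens[OF s r] in \<open>simp_all add: h_def\<close>)
      finally show ?thesis .
    qed
    have "ennreal k * (ennreal \<gamma> * ?X) = (\<integral>\<^sup>+z. ennreal k * ennreal \<gamma> * ennreal (\<bar>u z\<bar> powr p) \<partial>lborel)"
      by (simp add: nn_integral_cmult mult.assoc)
    also have "\<dots> \<le> (\<integral>\<^sup>+z. ennreal (2 powr (p - 1)) * (?A z + 2 * ennreal h * local_increment p u z (2 * r)) \<partial>lborel)"
      by (intro nn_integral_mono pt)
    also have "\<dots> = ennreal (2 powr (p - 1)) * ((\<integral>\<^sup>+z. ?A z \<partial>lborel) + 2 * ennreal h * increment p u (2 * r))"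
      by (simp add: nn_integral_cmult nn_integral_add increment_def)
    also have "(\<integral>\<^sup>+z. ?A z \<partial>lborel) = ennreal (w * (2 * r) powr ?N) * gagliardo s p u"
      unfolding w_def using r
      by (subst nn_integral_over_balls) (simp_all add: gagliardo_eq_nn_integral_density)
    finally have "ennreal k * (ennreal \<gamma> * ?X) \<le> ennreal (2 powr (p - 1)) *
      (ennreal (w * (2 * r) powr ?N) * gagliardo s p u + 2 * ennreal h * increment p u (2 * r))" .
    then have "ennreal (1 / (1 / k)) * (ennreal \<gamma> * ?X) \<le> ennreal (2 powr (p - 1)) *
      (ennreal (w * (2 * r) powr ?N) * gagliardo s p u + 2 * ennreal h * increment p u (2 * r))" by simp
    then have "ennreal \<gamma> * ?X \<le> ennreal (1 / k) * (ennreal (2 powr (p - 1)) *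
      (ennreal (w * (2 * r) powr ?N) * gagliardo s p u + 2 * ennreal h * increment p u (2 * r)))"
      using k by (subst ennreal_le_cmult_iff) auto
    also have "\<dots> = ennreal (1 / k * (2 powr (p - 1) * (w * (2 * r) powr ?N))) * gagliardo s p u
        + ennreal (1 / k * (2 powr (p - 1) * (2 * h))) * increment p u (2 * r)"
    proof -
      have gen: "ennreal a * (ennreal b * (ennreal d * G + 2 * ennreal h * I)) =
          ennreal (a * (b * d)) * G + ennreal (a * (b * (2 * h))) * I"
        if "0 \<le> a" "0 \<le> b" "0 \<le> d" "0 \<le> h" for a b d h :: real and G I :: ennreal
        using that by (simp add: ennreal_mult distrib_left mult.assoc)
      show ?thesis by (rule gen) (use k h w in auto)
    qed
    also have "1 / k * (2 powr (p - 1) * (w * (2 * r) powr ?N)) = Ca * (s * (1 - s) * r powr (s * p))"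
    proof -
      have gen: "1 / (c * (RN / RS) / S) * (P * (w * (T * RN))) = P * w * T / c * (S * RS)"
        if "RN \<noteq> 0" "RS \<noteq> 0" for RN RS S P T
        using that c by (cases "S = 0") (simp_all add: field_simps)
      show ?thesis unfolding k_def Ca_def powr_diff[of r] powr_mult[of 2 r] by (rule gen) (use r in auto)
    qed
    also have "1 / k * (2 powr (p - 1) * (2 * h)) = Cb * r powr (- ?N)"
    proof -
      have gen: "1 / (c * (RN / RS) / S) * (P * (2 * (K * inverse RS / S))) = P * 2 * K / c * inverse RN"
        if "RN \<noteq> 0" "RS \<noteq> 0" "S \<noteq> 0" for RN RS S P
        using that c by (simp add: field_simps)
      show ?thesis unfolding k_def Cb_def h_def powr_diff[of r] powr_minus[of r] by (rule gen) (use r s in auto)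
    qed
    also have "ennreal (Ca * (s * (1 - s) * r powr (s * p))) * gagliardo s p u + ennreal (Cb * r powr (- ?N)) * increment p u (2 * r)
       \<le> ennreal ((Ca + Cb) * (s * (1 - s) * r powr (s * p))) * gagliardo s p u
        + ennreal ((Ca + Cb) * r powr (- ?N)) * increment p u (2 * r)"
      using Cab s by (intro add_mono mult_right_mono ennreal_leI) auto
    finally show ?thesis .
  qed
  then show ?thesis using Cab by (intro exI[of _ "Ca + Cb"]) auto
qed

text \<open>The bound with \<open>1 - s\<close> uses the single scale \<open>r\<close>, the bound with \<open>s\<close> all scales beyond \<open>r\<close>. A single scale cannot
give the factor \<open>s\<close>: it is the number of scales, of order \<open>1 / s\<close> up to the size at which \<open>t^(sp)\<close> becomes noticeable,
that has to be gained.\<close>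

lemma capacitary_poincare:
  fixes p :: real
  assumes p: "1 \<le> p"
  shows "\<exists>C>0. \<forall>s \<gamma> r \<Omega> (u :: real ^ 'n \<Rightarrow> real).
    0 < s \<and> s < 1 \<and> 0 \<le> \<gamma> \<and> 0 < r \<and> u \<in> test_functions \<Omega> \<and> (\<forall>t\<ge>r. thick s p \<gamma> \<Omega> t) \<longrightarrow>
    ennreal \<gamma> * (\<integral>\<^sup>+x. ennreal (\<bar>u x\<bar> powr p) \<partial>lborel) \<le> ennreal (C * s * r powr (s * p)) * gagliardo s p u \<and>
    ennreal \<gamma> * (\<integral>\<^sup>+x. ennreal (\<bar>u x\<bar> powr p) \<partial>lborel) \<le> ennreal (C * (1 - s) * r powr (s * p)) * gagliardo s p u"
proof -
  let ?N = "real CARD('n)"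
  obtain A where A: "0 < A" and scale: "\<And>s \<gamma> r \<Omega> (u :: real ^ 'n \<Rightarrow> real).
    0 < s \<Longrightarrow> s < 1 \<Longrightarrow> 0 \<le> \<gamma> \<Longrightarrow> 0 < r \<Longrightarrow> u \<in> test_functions \<Omega> \<Longrightarrow> thick s p \<gamma> \<Omega> r \<Longrightarrow>
    ennreal \<gamma> * (\<integral>\<^sup>+x. ennreal (\<bar>u x\<bar> powr p) \<partial>lborel) \<le>
      ennreal (A * (s * (1 - s) * r powr (s * p))) * gagliardo s p u
      + ennreal (A * r powr (- ?N)) * increment p u (2 * r)"
    using thick_scale_inequality[OF p, where 'n = 'n] by blast
  define D where "D = 2 powr (?N + p)"
  have D: "0 < D" by (simp add: D_def)
  define C1 where "C1 = 2 * p * (A * (1 + D))"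
  define C2 where "C2 = A * (1 + D * p * (2 powr (?N + p)))"
  have C: "0 < C1" "0 < C2" using A D p by (simp_all add: C1_def C2_def add_pos_pos)
  have "ennreal \<gamma> * (\<integral>\<^sup>+x. ennreal (\<bar>u x\<bar> powr p) \<partial>lborel) \<le> ennreal (C1 * s * r powr (s * p)) * gagliardo s p u \<and>
    ennreal \<gamma> * (\<integral>\<^sup>+x. ennreal (\<bar>u x\<bar> powr p) \<partial>lborel) \<le> ennreal (C2 * (1 - s) * r powr (s * p)) * gagliardo s p u"
    if s: "0 < s" "s < 1" and \<gamma>: "0 \<le> \<gamma>" and r: "0 < r" and u: "u \<in> test_functions \<Omega>"
      and thick: "\<And>t. r \<le> t \<Longrightarrow> thick s p \<gamma> \<Omega> t" for s \<gamma> r \<Omega> and u :: "real ^ 'n \<Rightarrow> real"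
  proof
    note [measurable] = test_functions_measurable[OF u]
    let ?X = "ennreal \<gamma> * (\<integral>\<^sup>+x. ennreal (\<bar>u x\<bar> powr p) \<partial>lborel)"
    let ?E = "gagliardo s p u"
    have sp: "0 < s * p" "0 < 2 * s * p" using s p by auto
    have scale_t: "?X \<le> ennreal (A * (s * (1 - s) * t powr (s * p))) * ?E + ennreal (A * t powr (- ?N)) * increment p u (2 * t)"
      if "r \<le> t" for t
      by (rule scale[OF s \<gamma> _ u thick[OF that]]) (use r that in simp)
    show "?X \<le> ennreal (C2 * (1 - s) * r powr (s * p)) * ?E"
    proof -
      have "?X \<le> ennreal (A * (s * (1 - s) * r powr (s * p))) * ?E + ennreal (A * r powr (- ?N)) *
         (ennreal (D * p * (1 - s) * (2 * r) powr (?N + s * p)) * ?E)"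
        unfolding D_def using r
        by (intro order_trans[OF scale_t[OF order_refl]] add_mono mult_left_mono[OF increment_le_gagliardo] order_refl p s) auto
      also have "\<dots> = ennreal (A * (s * (1 - s) * r powr (s * p)) + A * r powr (- ?N) * (D * p * (1 - s) * (2 * r) powr (?N + s * p))) * ?E"
        using A D s p by (simp add: ennreal_plus ennreal_mult distrib_right mult.assoc)
      also have "\<dots> \<le> ennreal (C2 * (1 - s) * r powr (s * p)) * ?E"
      proof (intro mult_right_mono ennreal_leI)
        have e: "r powr (- ?N) * (2 * r) powr (?N + s * p) = 2 powr (?N + s * p) * r powr (s * p)"
        proof -
          have "r powr (- ?N) * r powr (?N + s * p) = r powr (s * p)" by (simp add: powr_add[symmetric])
          then show ?thesis unfolding powr_mult by (metis mult.left_commute)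
        qed
        have le: "2 powr (?N + s * p) \<le> 2 powr (?N + p)"
          using s p by (intro powr_mono) auto
        have "A * (s * (1 - s) * r powr (s * p)) + A * r powr (- ?N) * (D * p * (1 - s) * (2 * r) powr (?N + s * p))
          = A * s * ((1 - s) * r powr (s * p)) + A * (D * p * (1 - s)) * (r powr (- ?N) * (2 * r) powr (?N + s * p))"
          by (simp only: mult_ac)
        also have "\<dots> = A * s * ((1 - s) * r powr (s * p)) + A * (D * p * 2 powr (?N + s * p)) * ((1 - s) * r powr (s * p))"
          unfolding e by (simp only: mult_ac)
        also have "\<dots> \<le> A * 1 * ((1 - s) * r powr (s * p)) + A * (D * p * 2 powr (?N + p)) * ((1 - s) * r powr (s * p))"
          using A D s p by (intro add_mono mult_right_mono mult_left_mono le) auto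
        also have "\<dots> = C2 * (1 - s) * r powr (s * p)"
          unfolding C2_def by (simp only: distrib_left distrib_right mult.assoc mult_1_left)
        finally show "A * (s * (1 - s) * r powr (s * p)) + A * r powr (- ?N) * (D * p * (1 - s) * (2 * r) powr (?N + s * p))
          \<le> C2 * (1 - s) * r powr (s * p)" .
      qed simp
      finally show ?thesis .
    qed
    show "?X \<le> ennreal (C1 * s * r powr (s * p)) * ?E"
    proof -
      \<comment> \<open>The weight: one power \<open>t^(-sp)\<close> absorbs the growth of the energy term and leaves a convergent integral, and for
        \<open>t > r\<close> the bound \<open>t^(-sp) \<le> r^(-sp)\<close> turns the weight in front of the increments into the one of the energy.\<close>
      let ?v = "\<lambda>t. ennreal (t powr (- (2 * s * p) - 1)) * indicator {r<..} t"
      let ?I = "\<lambda>t. ennreal (t powr (- (?N + s * p) - 1)) * indicator {0<..} t * increment p u t"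
      have pt: "?v t * ?X \<le> ennreal A * ?E * (ennreal (s * (1 - s)) * (ennreal (t powr (- (s * p) - 1)) * indicator {r<..} t))
           + ennreal (A * D * r powr (- (s * p))) * ?I t" for t
      proof (cases "r < t")
        case True
        then have t: "0 < t" using r by simp
        have "ennreal (t powr (- (2 * s * p) - 1)) * ?X
            \<le> ennreal (t powr (- (2 * s * p) - 1)) * (ennreal (A * (s * (1 - s) * t powr (s * p))) * ?E
              + ennreal (A * t powr (- ?N)) * (ennreal D * increment p u t))"
          unfolding D_def using True
          by (intro mult_left_mono order_trans[OF scale_t[OF less_imp_le[OF True]]] add_mono mult_left_mono[OF increment_double] order_refl p) auto
        also have "\<dots> = ennreal (t powr (- (2 * s * p) - 1) * (A * (s * (1 - s) * t powr (s * p)))) * ?E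
              + ennreal (t powr (- (2 * s * p) - 1) * (A * t powr (- ?N) * D)) * increment p u t"
        proof -
          have gen: "ennreal a * (ennreal b * E + ennreal d * (ennreal f * I)) = ennreal (a * b) * E + ennreal (a * (d * f)) * I"
            if "0 \<le> a" "0 \<le> b" "0 \<le> d" "0 \<le> f" for a b d f :: real and E I :: ennreal
            using that by (simp add: ennreal_mult distrib_left mult.assoc)
          show ?thesis by (rule gen) (use A D s in auto)
        qed
        also have "t powr (- (2 * s * p) - 1) * (A * (s * (1 - s) * t powr (s * p))) = A * (s * (1 - s) * t powr (- (s * p) - 1))"
        proof -
          have "t powr (- (2 * s * p) - 1) * t powr (s * p) = t powr (- (s * p) - 1)"
            by (simp add: powr_add[symmetric] algebra_simps)
          then show ?thesis by (metis mult.left_commute)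
        qed
        also have "ennreal (t powr (- (2 * s * p) - 1) * (A * t powr (- ?N) * D)) * increment p u t
           \<le> ennreal (A * D * r powr (- (s * p)) * t powr (- (?N + s * p) - 1)) * increment p u t"
        proof (intro mult_right_mono ennreal_leI)
          have "t powr (- (s * p)) \<le> r powr (- (s * p))" using True r s p by (intro powr_mono2') auto
          then have le: "A * D * t powr (- (s * p)) * t powr (- (?N + s * p) - 1) \<le> A * D * r powr (- (s * p)) * t powr (- (?N + s * p) - 1)"
            using A D by (intro mult_right_mono mult_left_mono) auto
          have e: "t powr (- (2 * s * p) - 1) * t powr (- ?N) = t powr (- (s * p)) * t powr (- (?N + s * p) - 1)"
            unfolding powr_add[symmetric] by (rule arg_cong[where f = "(powr) t"]) linarith
          have "t powr (- (2 * s * p) - 1) * (A * t powr (- ?N) * D) = A * D * (t powr (- (2 * s * p) - 1) * t powr (- ?N))"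
            by (simp only: mult_ac)
          then have e2: "t powr (- (2 * s * p) - 1) * (A * t powr (- ?N) * D) = A * D * t powr (- (s * p)) * t powr (- (?N + s * p) - 1)"
            unfolding e by (simp only: mult.assoc)
          show "t powr (- (2 * s * p) - 1) * (A * t powr (- ?N) * D) \<le> A * D * r powr (- (s * p)) * t powr (- (?N + s * p) - 1)"
            unfolding e2 by (rule le)
        qed simp
        finally have "ennreal (t powr (- (2 * s * p) - 1)) * ?X \<le> ennreal (A * (s * (1 - s) * t powr (- (s * p) - 1))) * ?E
          + ennreal (A * D * r powr (- (s * p)) * t powr (- (?N + s * p) - 1)) * increment p u t"
          by (simp add: add_left_mono)
        also have "\<dots> = ennreal A * ?E * (ennreal (s * (1 - s)) * ennreal (t powr (- (s * p) - 1)))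
          + ennreal (A * D * r powr (- (s * p))) * (ennreal (t powr (- (?N + s * p) - 1)) * increment p u t)"
        proof -
          have gen: "ennreal (a * (b * d)) * E + ennreal (f * g) * I = ennreal a * E * (ennreal b * ennreal d) + ennreal f * (ennreal g * I)"
            if "0 \<le> a" "0 \<le> b" "0 \<le> d" "0 \<le> f" "0 \<le> g" for a b d f g :: real and E I :: ennreal
            using that by (simp add: ennreal_mult mult_ac)
          show ?thesis by (rule gen) (use A D s in auto)
        qed
        finally show ?thesis using True t by simp
      qed simp
      have "ennreal (r powr (- (2 * s * p)) / (2 * s * p)) * ?X = (\<integral>\<^sup>+t. ?v t \<partial>lborel) * ?X"
        by (subst nn_integral_powr_tail[OF sp(2) r]) simp
      also have "\<dots> = (\<integral>\<^sup>+t. ?v t * ?X \<partial>lborel)" by (rule nn_integral_multc[symmetric]) measurable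
      also have "\<dots> \<le> (\<integral>\<^sup>+t. ennreal A * ?E * (ennreal (s * (1 - s)) * (ennreal (t powr (- (s * p) - 1)) * indicator {r<..} t))
           + ennreal (A * D * r powr (- (s * p))) * ?I t \<partial>lborel)"
        by (intro nn_integral_mono pt)
      also have "\<dots> = ennreal A * ?E * (ennreal (s * (1 - s)) * (\<integral>\<^sup>+t. ennreal (t powr (- (s * p) - 1)) * indicator {r<..} t \<partial>lborel))
           + ennreal (A * D * r powr (- (s * p))) * (\<integral>\<^sup>+t. ?I t \<partial>lborel)"
        by (simp add: nn_integral_add nn_integral_cmult)
      also have "\<dots> \<le> ennreal A * ?E * (ennreal (s * (1 - s)) * ennreal (r powr (- (s * p)) / (s * p)))
           + ennreal (A * D * r powr (- (s * p))) * ?E"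
        by (intro add_mono mult_left_mono layers_le_gagliardo p s) (simp_all add: nn_integral_powr_tail[OF sp(1) r])
      also have "\<dots> = ennreal (A * (s * (1 - s) * (r powr (- (s * p)) / (s * p))) + A * D * r powr (- (s * p))) * ?E"
      proof -
        have gen: "ennreal a * E * (ennreal b * ennreal d) + ennreal f * E = ennreal (a * (b * d) + f) * E"
          if "0 \<le> a" "0 \<le> b" "0 \<le> d" "0 \<le> f" for a b d f :: real and E :: ennreal
          using that by (simp add: ennreal_mult ennreal_plus distrib_left mult_ac)
        show ?thesis by (rule gen) (use A D s p in auto)
      qed
      also have "\<dots> \<le> ennreal (A * (1 + D) * r powr (- (s * p))) * ?E"
      proof (intro mult_right_mono ennreal_leI)
        have "(1 - s) / p * r powr (- (s * p)) \<le> 1 * r powr (- (s * p))" using s p by (intro mult_right_mono) auto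
        moreover have "s * (1 - s) * (R / (s * p)) = (1 - s) / p * R" for R using s p by (simp add: field_simps)
        ultimately have "A * (s * (1 - s) * (r powr (- (s * p)) / (s * p))) \<le> A * (1 * r powr (- (s * p)))"
          using A by (intro mult_left_mono) auto
        moreover have "A * (1 + D) * R = A * (1 * R) + A * D * R" for R by (simp add: algebra_simps)
        ultimately show "A * (s * (1 - s) * (r powr (- (s * p)) / (s * p))) + A * D * r powr (- (s * p))
          \<le> A * (1 + D) * r powr (- (s * p))" by simp
      qed simp
      finally have "ennreal (1 / (2 * s * p / r powr (- (2 * s * p)))) * ?X \<le> ennreal (A * (1 + D) * r powr (- (s * p))) * ?E"
        by simp
      then have "?X \<le> ennreal (2 * s * p / r powr (- (2 * s * p))) * (ennreal (A * (1 + D) * r powr (- (s * p))) * ?E)"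
        using s p r by (subst ennreal_le_cmult_iff) auto
      also have "\<dots> = ennreal (2 * s * p / r powr (- (2 * s * p)) * (A * (1 + D) * r powr (- (s * p)))) * ?E"
        using A D by (subst ennreal_mult'') (simp_all add: mult.assoc)
      also have "2 * s * p / r powr (- (2 * s * p)) * (A * (1 + D) * r powr (- (s * p))) = C1 * s * r powr (s * p)"
      proof -
        have e: "r powr (- (s * p)) / r powr (- (2 * s * p)) = r powr (s * p)"
            by (simp add: powr_diff[symmetric] algebra_simps)
        have gen: "2 * s * p / Y * (A * (1 + D) * Z) = 2 * p * (A * (1 + D)) * s * (Z / Y)" for Y Z :: real by simp
        show ?thesis unfolding C1_def gen e ..
      qed
      finally show ?thesis .
    qed
  qed
  note both = this
  have "ennreal \<gamma> * (\<integral>\<^sup>+x. ennreal (\<bar>u x\<bar> powr p) \<partial>lborel) \<le> ennreal ((C1 + C2) * s * r powr (s * p)) * gagliardo s p u \<and>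
    ennreal \<gamma> * (\<integral>\<^sup>+x. ennreal (\<bar>u x\<bar> powr p) \<partial>lborel) \<le> ennreal ((C1 + C2) * (1 - s) * r powr (s * p)) * gagliardo s p u"
    if "0 < s" "s < 1" "0 \<le> \<gamma>" "0 < r" "u \<in> test_functions \<Omega>"
      "\<And>t. r \<le> t \<Longrightarrow> thick s p \<gamma> \<Omega> t" for s \<gamma> r \<Omega> and u :: "real ^ 'n \<Rightarrow> real"
  proof -
    have "ennreal (C1 * s * r powr (s * p)) * gagliardo s p u \<le> ennreal ((C1 + C2) * s * r powr (s * p)) * gagliardo s p u"
      and "ennreal (C2 * (1 - s) * r powr (s * p)) * gagliardo s p u \<le> ennreal ((C1 + C2) * (1 - s) * r powr (s * p)) * gagliardo s p u"
      using C that by (intro mult_right_mono ennreal_leI; simp)+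
    with both[OF that] show ?thesis using order_trans by blast
  qed
  then show ?thesis using C by (intro exI[of _ "C1 + C2"]) auto
qed

section \<open>Sobolev interpolation\<close>

lemma powr_threshold_le:
  fixes a \<kappa> p q :: real
  assumes "0 \<le> a" "0 < \<kappa>" "0 < p" "p \<le> q"
  shows "a powr p \<le> \<kappa> powr p + \<kappa> powr (p - q) * a powr q"
proof (cases "a \<le> \<kappa>")
  case True
  then have "a powr p \<le> \<kappa> powr p" using assms by (intro powr_mono2) auto
  then show ?thesis by (simp add: add_increasing2)
next
  case False
  then have a: "0 < a" using assms by simp
  have "a powr (p - q) \<le> \<kappa> powr (p - q)" using assms False by (intro powr_mono2') auto
  then have "a powr (p - q) * a powr q \<le> \<kappa> powr (p - q) * a powr q" by (rule mult_right_mono) simp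
  moreover have "a powr (p - q) * a powr q = a powr p" by (simp add: powr_add[symmetric])
  ultimately have "a powr p \<le> \<kappa> powr (p - q) * a powr q" by simp
  then show ?thesis by (simp add: add_increasing)
qed

text \<open>Below the threshold \<open>\<kappa>\<close> the power \<open>p\<close> dominates, above it the power \<open>m\<close>. Together with a good choice of \<open>\<kappa>\<close> this
serves as an interpolation inequality between integrals without Hoelder's inequality.\<close>

lemma powr_between_le:
  fixes a \<kappa> p q m :: real
  assumes "0 \<le> a" "0 < \<kappa>" "0 < p" "p \<le> q" "q \<le> m"
  shows "a powr q \<le> \<kappa> powr (q - p) * a powr p + \<kappa> powr (q - m) * a powr m"
proof (cases "a \<le> \<kappa>")
  case True
  have "a powr q \<le> \<kappa> powr (q - p) * a powr p"
  proof -
    have "a powr q = a powr (q - p) * a powr p" by (simp add: powr_add[symmetric])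
    also have "\<dots> \<le> \<kappa> powr (q - p) * a powr p"
      using True assms by (intro mult_right_mono powr_mono2) auto
    finally show ?thesis .
  qed
  then show ?thesis by (simp add: add_increasing2)
next
  case False
  have "a powr q = a powr (q - m) * a powr m" by (simp add: powr_add[symmetric])
  also have "\<dots> \<le> \<kappa> powr (q - m) * a powr m"
    using False assms by (intro mult_right_mono powr_mono2') auto
  finally show ?thesis by (simp add: add_increasing)
qed

lemma nn_integral_ball_combination:
  fixes F G :: "'a::euclidean_space \<Rightarrow> ennreal"
  assumes [measurable]: "F \<in> borel_measurable borel" "G \<in> borel_measurable borel"
  shows "(\<integral>\<^sup>+y. c * (F y + k * indicator (ball x t) y + d * G y) \<partial>lborel)
    = c * ((\<integral>\<^sup>+y. F y \<partial>lborel) + k * emeasure lborel (ball x t) + d * (\<integral>\<^sup>+y. G y \<partial>lborel))"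
proof -
  have [measurable]: "ball x t \<in> sets borel" by simp
  show ?thesis by (simp add: nn_integral_cmult nn_integral_add)
qed

text \<open>If the volume \<open>W\<close> of the ball is large, the normalisation of \<open>u\<close> forces \<open>|u|\<close> to be small compared with \<open>|u(x)|\<close> on
most of the ball, so the increments at \<open>x\<close> are, up to a constant, as large as if \<open>u\<close> were zero there.\<close>

lemma local_increment_ge_value:
  fixes u :: "real ^ 'n \<Rightarrow> real"
  assumes [measurable]: "u \<in> borel_measurable borel" and p: "1 \<le> p" and q: "p \<le> q" and t: "0 < t"
    and Q: "(\<integral>\<^sup>+y. ennreal (\<bar>u y\<bar> powr q) \<partial>lborel) \<le> 1" and a: "a = \<bar>u x\<bar>" "0 < a"
    and W: "W = unit_ball_vol (real CARD('n)) * t powr real CARD('n)"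
    and large: "2 powr (p + 1) * 8 powr (q - p) * a powr (- q) \<le> W"
  shows "ennreal (2 powr (- p) * a powr p * W) \<le> local_increment p u x t"
proof (cases "local_increment p u x t")
  case (real l)
  \<comment> \<open>The factor 8 makes \<open>2^(p - 1) \<kappa>^p\<close> at most \<open>a^p / 4\<close>, as \<open>p \<ge> 1\<close>; the hypothesis on \<open>W\<close> provides the other quarter.\<close>
  define \<kappa> where "\<kappa> = a / 8"
  have \<kappa>: "0 < \<kappa>" using a by (simp add: \<kappa>_def)
  have W0: "0 \<le> W" unfolding W by simp
  have eW: "emeasure lborel (ball x t) = ennreal W" unfolding W using t by (intro emeasure_lborel_ball) simp
  let ?c = "2 powr (p - 1) :: real"
  have pt: "ennreal (a powr p) * indicator (ball x t) y \<le> ennreal ?c *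
      ((if norm (x - y) < t then ennreal (\<bar>u x - u y\<bar> powr p) else 0)
       + ennreal (\<kappa> powr p) * indicator (ball x t) y + ennreal (\<kappa> powr (p - q)) * ennreal (\<bar>u y\<bar> powr q))" for y
  proof (cases "y \<in> ball x t")
    case True
    have "a powr p \<le> ?c * (\<bar>u x - u y\<bar> powr p + \<bar>u y\<bar> powr p)"
      using abs_add_powr_le[OF p, of "u x - u y" "u y"] by (simp add: a)
    also have "\<dots> \<le> ?c * (\<bar>u x - u y\<bar> powr p + (\<kappa> powr p + \<kappa> powr (p - q) * \<bar>u y\<bar> powr q))"
      using p q \<kappa> by (intro mult_left_mono add_left_mono powr_threshold_le) auto
    finally have "ennreal (a powr p) \<le> ennreal (?c * (\<bar>u x - u y\<bar> powr p + (\<kappa> powr p + \<kappa> powr (p - q) * \<bar>u y\<bar> powr q)))"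
      by (rule ennreal_leI)
    then show ?thesis using True by (simp add: ennreal_mult ennreal_plus dist_norm add.assoc)
  qed simp
  have "ennreal (a powr p * W) = (\<integral>\<^sup>+y. ennreal (a powr p) * indicator (ball x t) y \<partial>lborel)"
    unfolding ennreal_mult[OF powr_ge_zero W0] by (simp add: nn_integral_cmult_indicator eW)
  also have "\<dots> \<le> (\<integral>\<^sup>+y. ennreal ?c *
      ((if norm (x - y) < t then ennreal (\<bar>u x - u y\<bar> powr p) else 0)
       + ennreal (\<kappa> powr p) * indicator (ball x t) y + ennreal (\<kappa> powr (p - q)) * ennreal (\<bar>u y\<bar> powr q)) \<partial>lborel)"
    by (intro nn_integral_mono pt)
  also have "\<dots> = ennreal ?c * (local_increment p u x t + ennreal (\<kappa> powr p * W)
       + ennreal (\<kappa> powr (p - q)) * (\<integral>\<^sup>+y. ennreal (\<bar>u y\<bar> powr q) \<partial>lborel))"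
  proof -
    show ?thesis unfolding local_increment_def ennreal_mult[OF powr_ge_zero W0]
      by (subst nn_integral_ball_combination) (simp_all add: eW)
  qed
  also have "\<dots> \<le> ennreal ?c * (local_increment p u x t + ennreal (\<kappa> powr p * W) + ennreal (\<kappa> powr (p - q)) * 1)"
    by (intro mult_left_mono add_left_mono Q) auto
  also have "\<dots> = ennreal (?c * (l + \<kappa> powr p * W + \<kappa> powr (p - q)))"
    using real W0 by (simp add: ennreal_mult ennreal_plus)
  finally have "ennreal (a powr p * W) \<le> ennreal (?c * (l + \<kappa> powr p * W + \<kappa> powr (p - q)))" .
  then have le: "a powr p * W \<le> ?c * (l + \<kappa> powr p * W + \<kappa> powr (p - q))"
    using real W0 by (subst (asm) ennreal_le_iff) auto
  have k1: "?c * \<kappa> powr p \<le> a powr p / 4"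
  proof -
    have "(2::real) powr (p - 1) * 4 \<le> 8 powr p"
    proof -
      have "(2::real) powr (p - 1) * 4 = 2 powr (p + 1)"
        using powr_add[of 2 "p - 1" 2] by (simp add: add.commute)
      also have "\<dots> \<le> 2 powr (3 * p)" using p by (intro powr_mono) auto
      also have "\<dots> = (2 powr 3) powr p" by (simp only: powr_powr)
      also have "(2::real) powr 3 = 8" by simp
      finally show ?thesis .
    qed
    then have le: "(2::real) powr (p - 1) / 8 powr p \<le> 1 / 4" by (subst pos_divide_le_eq) (simp, linarith)
    have "?c * \<kappa> powr p = 2 powr (p - 1) / 8 powr p * a powr p"
      unfolding \<kappa>_def powr_divide by (simp only: times_divide_eq_right times_divide_eq_left)
    also have "\<dots> \<le> 1 / 4 * a powr p" by (rule mult_right_mono[OF le]) simp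
    finally show ?thesis by (simp only: times_divide_eq_left mult_1_left)
  qed
  have k2: "?c * \<kappa> powr (p - q) \<le> a powr p / 4 * W"
  proof -
    have "?c * \<kappa> powr (p - q) = a powr p / 4 * (2 powr (p + 1) * 8 powr (q - p) * a powr (- q))"
    proof -
      have "\<kappa> powr (p - q) = a powr (p - q) * 8 powr (q - p)"
        unfolding \<kappa>_def powr_divide using powr_minus_divide[of 8 "q - p"] by simp
      moreover have "a powr (p - q) = a powr p * a powr (- q)" by (simp add: powr_add[symmetric])
      moreover have "?c = 2 powr (p + 1) / 4" using powr_add[of 2 "p - 1" 2] by (simp add: add.commute)
      ultimately show ?thesis by simp
    qed
    also have "\<dots> \<le> a powr p / 4 * W" by (intro mult_left_mono large) simp
    finally show ?thesis .
  qed
  have "?c * (\<kappa> powr p * W) \<le> a powr p / 4 * W" using mult_right_mono[OF k1 W0] by (simp only: mult.assoc)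
  with k2 le have "a powr p * W \<le> 2 * (?c * l)" unfolding distrib_left by linarith
  also have "2 * (?c * l) = 2 powr p * l" using powr_add[of 2 "p - 1" 1] by simp
  finally have "2 powr (- p) * (a powr p * W) \<le> l" unfolding powr_minus by (simp add: field_simps)
  then show ?thesis using real by (simp add: mult.assoc)
qed simp

text \<open>By \<open>local_increment_ge_value\<close> all scales beyond a radius \<open>\<rho>\<close> of order \<open>|u(x)|^(-q/N)\<close> contribute to the energy density
at \<open>x\<close>, in total a multiple of \<open>|u(x)|^p \<rho>^(-sp) / s\<close>. The constant is uniform in \<open>s\<close>, and in \<open>q\<close> up to \<open>q1\<close>; this
uniformity is what permits \<open>q\<close> to vary with \<open>s\<close> in the limit \<open>s \<rightarrow> 0\<close>.\<close>

lemma pointwise_sobolev: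
  fixes p q1 :: real
  assumes p: "1 \<le> p"
  shows "\<exists>C>0. \<forall>s q (u :: real ^ 'n \<Rightarrow> real) x.
    0 < s \<and> s < 1 \<and> p \<le> q \<and> q \<le> q1 \<and> u \<in> borel_measurable borel \<and> (\<integral>\<^sup>+y. ennreal (\<bar>u y\<bar> powr q) \<partial>lborel) \<le> 1 \<longrightarrow>
    ennreal (\<bar>u x\<bar> powr (p + s * p * q / real CARD('n))) \<le> ennreal (C * s) * gagliardo_density s p u x"
proof -
  let ?N = "real CARD('n)"
  define w where "w = unit_ball_vol ?N"
  have w: "0 < w" by (simp add: w_def)
  have N: "1 \<le> ?N" by (simp add: Suc_le_eq)
  define H where "H q = 2 powr (p + 1) * 8 powr (q - p) / w" for q :: real
  have H: "0 < H q" for q using w by (simp add: H_def)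
  define C where "C = p * 2 powr p / w * max 1 (H q1) powr p"
  have C: "0 < C" using p w by (simp add: C_def)
  have "ennreal (\<bar>u x\<bar> powr (p + s * p * q / ?N)) \<le> ennreal (C * s) * gagliardo_density s p u x"
    if s: "0 < s" "s < 1" and q: "p \<le> q" "q \<le> q1" and u[measurable]: "u \<in> borel_measurable borel"
      and Q: "(\<integral>\<^sup>+y. ennreal (\<bar>u y\<bar> powr q) \<partial>lborel) \<le> 1" for s q and u :: "real ^ 'n \<Rightarrow> real" and x
  proof (cases "u x = 0")
    case False
    define a where "a = \<bar>u x\<bar>"
    have a: "0 < a" using False by (simp add: a_def)
    have sp: "0 < s * p" using s p by simp
    define \<rho> where "\<rho> = (H q * a powr (- q)) powr (1 / ?N)"
    have \<rho>: "0 < \<rho>" unfolding \<rho>_def using H[of q] a by simp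
    have \<rho>N: "\<rho> powr ?N = H q * a powr (- q)"
      unfolding \<rho>_def powr_powr using H[of q] a by simp
    have inc: "ennreal (2 powr (- p) * a powr p * (w * t powr ?N)) \<le> local_increment p u x t" if "\<rho> < t" for t
    proof (rule local_increment_ge_value[OF u p q(1) _ Q a_def a])
      show "0 < t" using that \<rho> by simp
      show "w * t powr ?N = unit_ball_vol ?N * t powr ?N" by (simp add: w_def)
      have "\<rho> powr ?N \<le> t powr ?N" using that \<rho> by (intro powr_mono2) auto
      then have "H q * a powr (- q) * w \<le> t powr ?N * w" unfolding \<rho>N using w by (intro mult_right_mono) auto
      then show "2 powr (p + 1) * 8 powr (q - p) * a powr (- q) \<le> w * t powr ?N"
        using w by (simp add: H_def mult.commute)
    qed
    have "ennreal (2 powr (- p) * a powr p * w * (\<rho> powr (- (s * p)) / (s * p)))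
       = (\<integral>\<^sup>+t. ennreal (2 powr (- p) * a powr p * w) * (ennreal (t powr (- (s * p) - 1)) * indicator {\<rho><..} t) \<partial>lborel)"
      using w by (subst nn_integral_cmult) (simp_all only: nn_integral_powr_tail[OF sp \<rho>],
        simp_all flip: ennreal_mult')
    also have "\<dots> \<le> (\<integral>\<^sup>+t. ennreal (t powr (- (?N + s * p) - 1)) * indicator {0<..} t * local_increment p u x t \<partial>lborel)"
    proof (intro nn_integral_mono)
      fix t :: real
      show "ennreal (2 powr (- p) * a powr p * w) * (ennreal (t powr (- (s * p) - 1)) * indicator {\<rho><..} t)
        \<le> ennreal (t powr (- (?N + s * p) - 1)) * indicator {0<..} t * local_increment p u x t"
      proof (cases "\<rho> < t")
        case True
        have "t powr (- (s * p) - 1) = t powr (- (?N + s * p) - 1) * t powr ?N"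
          by (simp add: powr_add[symmetric])
        then have "ennreal (2 powr (- p) * a powr p * w) * ennreal (t powr (- (s * p) - 1))
           = ennreal (t powr (- (?N + s * p) - 1)) * ennreal (2 powr (- p) * a powr p * (w * t powr ?N))"
          using w by (simp flip: ennreal_mult add: mult_ac)
        also have "\<dots> \<le> ennreal (t powr (- (?N + s * p) - 1)) * local_increment p u x t"
          by (intro mult_left_mono inc True) simp
        finally show ?thesis using True \<rho> by (auto simp: indicator_def)
      qed auto
    qed
    also have "\<dots> \<le> gagliardo_density s p u x"
    proof -
      have "ennreal 1 \<le> ennreal (?N + s * p)" using N sp by (intro ennreal_leI) linarith
      from mult_right_mono[OF this zero_le] show ?thesis
        unfolding gagliardo_density_layers[OF u p s(1)] by simp
    qed
    finally have dens: "ennreal (2 powr (- p) * a powr p * w * (\<rho> powr (- (s * p)) / (s * p))) \<le> gagliardo_density s p u x" .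
    have \<rho>sp: "\<rho> powr (- (s * p)) = inverse (H q powr (s * p / ?N)) * a powr (s * p * q / ?N)"
    proof -
      have "\<rho> powr (- (s * p)) = (H q * a powr (- q)) powr (- (s * p / ?N))"
        unfolding \<rho>_def powr_powr by simp
      also have "\<dots> = H q powr (- (s * p / ?N)) * a powr (- q * - (s * p / ?N))"
        unfolding powr_mult powr_powr ..
      also have "- q * - (s * p / ?N) = s * p * q / ?N" by simp
      finally show ?thesis by (simp only: powr_minus)
    qed
    have Hle: "H q powr (s * p / ?N) \<le> max 1 (H q1) powr p"
    proof -
      have "(8::real) powr (q - p) \<le> 8 powr (q1 - p)" using q by (intro powr_mono) auto
      then have "H q \<le> H q1" unfolding H_def using w by (intro divide_right_mono mult_left_mono) auto
      then have "H q powr (s * p / ?N) \<le> max 1 (H q1) powr (s * p / ?N)"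
        using H[of q] sp by (intro powr_mono2) (auto simp: less_imp_le)
      also have "\<dots> \<le> max 1 (H q1) powr p"
      proof (rule powr_mono)
        have "s * p / ?N \<le> s * p / 1" using sp N by (intro divide_left_mono) auto
        also have "\<dots> \<le> p" using s p by simp
        finally show "s * p / ?N \<le> p" .
      qed simp
      finally show ?thesis .
    qed
    define A where "A = s * p * 2 powr p / w * H q powr (s * p / ?N)"
    have A: "0 < A" unfolding A_def using sp w H[of q] by simp
    have "2 powr (- p) * a powr p * w * (\<rho> powr (- (s * p)) / (s * p)) = 1 / A * a powr (p + s * p * q / ?N)"
    proof -
      have gen: "inverse P * R * w * (inverse B * S / Z) = 1 / (Z * P / w * B) * (R * S)"
        if "P \<noteq> 0" "B \<noteq> 0" "Z \<noteq> 0" for P R B S Z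
        using that w by (simp add: field_simps)
      show ?thesis unfolding \<rho>sp A_def powr_minus[of 2] powr_add
        by (rule gen) (use H[of q] s p in auto)
    qed
    with dens have "ennreal (1 / A) * ennreal (a powr (p + s * p * q / ?N)) \<le> gagliardo_density s p u x"
      using A by (simp flip: ennreal_mult)
    then have "ennreal (a powr (p + s * p * q / ?N)) \<le> ennreal A * gagliardo_density s p u x"
      using A by (subst ennreal_le_cmult_iff) auto
    also have "\<dots> \<le> ennreal (C * s) * gagliardo_density s p u x"
    proof (intro mult_right_mono ennreal_leI)
      have "A \<le> s * p * 2 powr p / w * max 1 (H q1) powr p"
        unfolding A_def using sp w by (intro mult_left_mono Hle) auto
      also have "\<dots> = C * s" unfolding C_def by simp
      finally show "A \<le> C * s" .
    qed simp
    finally show ?thesis by (simp add: a_def)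
  qed simp
  then show ?thesis using C by blast
qed

lemma sobolev_interpolation:
  fixes p q1 :: real
  assumes p: "1 \<le> p"
  shows "\<exists>C>0. \<forall>s q r (u :: real ^ 'n \<Rightarrow> real).
    0 < s \<and> s < 1 \<and> p \<le> q \<and> q \<le> q1 \<and> q \<le> p + s * p * q / real CARD('n) \<and> 0 < r \<and> u \<in> borel_measurable borel
      \<and> (\<integral>\<^sup>+x. ennreal (\<bar>u x\<bar> powr q) \<partial>lborel) = 1 \<longrightarrow>
    1 \<le> ennreal (r powr (real CARD('n) * p / q - real CARD('n))) * (\<integral>\<^sup>+x. ennreal (\<bar>u x\<bar> powr p) \<partial>lborel)
      + ennreal (C * s * r powr (s * p - real CARD('n) + real CARD('n) * p / q)) * gagliardo s p u"
proof -
  let ?N = "real CARD('n)"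
  have N: "1 \<le> ?N" by (simp add: Suc_le_eq)
  obtain C where C: "0 < C" and pw: "\<And>s q (u :: real ^ 'n \<Rightarrow> real) x.
    0 < s \<Longrightarrow> s < 1 \<Longrightarrow> p \<le> q \<Longrightarrow> q \<le> q1 \<Longrightarrow> u \<in> borel_measurable borel \<Longrightarrow>
      (\<integral>\<^sup>+y. ennreal (\<bar>u y\<bar> powr q) \<partial>lborel) \<le> 1 \<Longrightarrow>
    ennreal (\<bar>u x\<bar> powr (p + s * p * q / ?N)) \<le> ennreal (C * s) * gagliardo_density s p u x"
    using pointwise_sobolev[OF p, where 'n = 'n and ?q1.0 = q1] by blast
  have "1 \<le> ennreal (r powr (?N * p / q - ?N)) * (\<integral>\<^sup>+x. ennreal (\<bar>u x\<bar> powr p) \<partial>lborel)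
      + ennreal (C * s * r powr (s * p - ?N + ?N * p / q)) * gagliardo s p u"
    if s: "0 < s" "s < 1" and q: "p \<le> q" "q \<le> q1" "q \<le> p + s * p * q / ?N" and r: "0 < r"
      and u[measurable]: "u \<in> borel_measurable borel" and Q: "(\<integral>\<^sup>+x. ennreal (\<bar>u x\<bar> powr q) \<partial>lborel) = 1"
    for s q r and u :: "real ^ 'n \<Rightarrow> real"
  proof -
    let ?m = "p + s * p * q / ?N"
    \<comment> \<open>The threshold scales like \<open>u\<close> under dilations that preserve \<open>\<integral>|u|^q\<close>.\<close>
    define \<kappa> where "\<kappa> = r powr (- (?N / q))"
    have \<kappa>: "0 < \<kappa>" using r by (simp add: \<kappa>_def)
    have q0: "0 < q" using p q by simp
    have pt: "ennreal (\<bar>u x\<bar> powr q) \<le> ennreal (\<kappa> powr (q - p)) * ennreal (\<bar>u x\<bar> powr p)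
        + ennreal (\<kappa> powr (q - ?m)) * (ennreal (C * s) * gagliardo_density s p u x)" for x
    proof -
      have "ennreal (\<bar>u x\<bar> powr q) \<le> ennreal (\<kappa> powr (q - p) * \<bar>u x\<bar> powr p + \<kappa> powr (q - ?m) * \<bar>u x\<bar> powr ?m)"
        using p q \<kappa> by (intro ennreal_leI powr_between_le) auto
      also have "\<dots> = ennreal (\<kappa> powr (q - p)) * ennreal (\<bar>u x\<bar> powr p) + ennreal (\<kappa> powr (q - ?m)) * ennreal (\<bar>u x\<bar> powr ?m)"
        by (simp add: ennreal_mult ennreal_plus)
      also have "\<dots> \<le> ennreal (\<kappa> powr (q - p)) * ennreal (\<bar>u x\<bar> powr p)
        + ennreal (\<kappa> powr (q - ?m)) * (ennreal (C * s) * gagliardo_density s p u x)"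
        by (intro add_left_mono mult_left_mono pw s q u) (simp_all add: Q)
      finally show ?thesis .
    qed
    have "1 = (\<integral>\<^sup>+x. ennreal (\<bar>u x\<bar> powr q) \<partial>lborel)" by (simp add: Q)
    also have "\<dots> \<le> (\<integral>\<^sup>+x. ennreal (\<kappa> powr (q - p)) * ennreal (\<bar>u x\<bar> powr p)
        + ennreal (\<kappa> powr (q - ?m)) * (ennreal (C * s) * gagliardo_density s p u x) \<partial>lborel)"
      by (intro nn_integral_mono pt)
    also have "\<dots> = ennreal (\<kappa> powr (q - p)) * (\<integral>\<^sup>+x. ennreal (\<bar>u x\<bar> powr p) \<partial>lborel)
        + ennreal (\<kappa> powr (q - ?m)) * (ennreal (C * s) * gagliardo s p u)"
      by (simp add: nn_integral_add nn_integral_cmult gagliardo_eq_nn_integral_density)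
    also have "\<kappa> powr (q - p) = r powr (?N * p / q - ?N)"
      unfolding \<kappa>_def powr_powr using q0 by (intro arg_cong[where f = "(powr) r"]) (simp add: field_simps)
    also have "ennreal (\<kappa> powr (q - ?m)) * (ennreal (C * s) * gagliardo s p u)
       = ennreal (C * s * r powr (s * p - ?N + ?N * p / q)) * gagliardo s p u"
    proof -
      have "- (?N / q) * (q - ?m) = s * p - ?N + ?N * p / q" using q0 N by (simp add: field_simps)
      then have "\<kappa> powr (q - ?m) = r powr (s * p - ?N + ?N * p / q)" unfolding \<kappa>_def powr_powr by simp
      moreover have "ennreal a * (ennreal b * E) = ennreal (b * a) * E" if "0 \<le> a" "0 \<le> b" for a b E
        using that by (simp add: ennreal_mult mult_ac)
      ultimately show ?thesis using C s by simp
    qed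
    finally show ?thesis .
  qed
  then show ?thesis using C by blast
qed

section \<open>Energies of lower order\<close>

lemma increment_le_norm:
  fixes u :: "real ^ 'n \<Rightarrow> real"
  assumes [measurable]: "u \<in> borel_measurable borel" and p: "1 \<le> p" and t: "0 \<le> t"
  shows "increment p u t \<le> ennreal (2 powr p * unit_ball_vol (real CARD('n)) * t powr real CARD('n))
    * (\<integral>\<^sup>+x. ennreal (\<bar>u x\<bar> powr p) \<partial>lborel)"
proof -
  let ?f = "\<lambda>x. ennreal (\<bar>u x\<bar> powr p)"
  let ?W = "unit_ball_vol (real CARD('n)) * t powr real CARD('n)"
  let ?c = "2 powr (p - 1) :: real"
  have "(if norm (x - y) < t then ennreal (\<bar>u x - u y\<bar> powr p) else 0) \<le> ennreal ?c *
     ((if norm (x - y) < t then ?f x else 0) + (if norm (x - y) < t then ?f y else 0))" for x y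
  proof -
    have "\<bar>u x + - u y\<bar> powr p \<le> ?c * (\<bar>u x\<bar> powr p + \<bar>- u y\<bar> powr p)" by (rule abs_add_powr_le[OF p])
    then have "ennreal (\<bar>u x - u y\<bar> powr p) \<le> ennreal (?c * (\<bar>u x\<bar> powr p + \<bar>u y\<bar> powr p))"
      by (intro ennreal_leI) simp
    then show ?thesis by (simp add: ennreal_mult ennreal_plus)
  qed
  then have "increment p u t \<le> (\<integral>\<^sup>+x. \<integral>\<^sup>+y. ennreal ?c *
     ((if norm (x - y) < t then ?f x else 0) + (if norm (x - y) < t then ?f y else 0)) \<partial>lborel \<partial>lborel)"
    unfolding increment_def local_increment_def by (intro nn_integral_mono)
  also have "\<dots> = ennreal ?c * ((\<integral>\<^sup>+x. \<integral>\<^sup>+y. (if norm (x - y) < t then ?f x else 0) \<partial>lborel \<partial>lborel)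
     + (\<integral>\<^sup>+x. \<integral>\<^sup>+y. (if norm (x - y) < t then ?f y else 0) \<partial>lborel \<partial>lborel))"
    by (simp add: nn_integral_cmult nn_integral_add)
  also have "(\<integral>\<^sup>+x. \<integral>\<^sup>+y. (if norm (x - y) < t then ?f x else 0) \<partial>lborel \<partial>lborel)
     = (\<integral>\<^sup>+y. \<integral>\<^sup>+x. (if norm (x - y) < t then ?f x else 0) \<partial>lborel \<partial>lborel)"
    by (rule lborel_pair.Fubini'[symmetric]) measurable
  also have "\<dots> = (\<integral>\<^sup>+x. \<integral>\<^sup>+y. (if norm (x - y) < t then ?f y else 0) \<partial>lborel \<partial>lborel)"
    by (simp add: norm_minus_commute)
  also have "(\<integral>\<^sup>+x. \<integral>\<^sup>+y. (if norm (x - y) < t then ?f y else 0) \<partial>lborel \<partial>lborel) = ennreal ?W * (\<integral>\<^sup>+x. ?f x \<partial>lborel)"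
    by (rule nn_integral_over_balls[OF _ t]) measurable
  also have "ennreal ?c * (ennreal ?W * (\<integral>\<^sup>+x. ?f x \<partial>lborel) + ennreal ?W * (\<integral>\<^sup>+x. ?f x \<partial>lborel))
     = ennreal (?c * (2 * ?W)) * (\<integral>\<^sup>+x. ?f x \<partial>lborel)"
  proof -
    have gen: "ennreal c * (ennreal W * X + ennreal W * X) = ennreal (c * (2 * W)) * X" if "0 \<le> c" "0 \<le> W" for c W X
      using that by (simp add: ennreal_mult mult_2[symmetric] mult.assoc)
    show ?thesis by (rule gen) auto
  qed
  also have "?c * (2 * ?W) = 2 powr p * unit_ball_vol (real CARD('n)) * t powr real CARD('n)"
    using powr_add[of 2 "p - 1" 1] by simp
  finally show ?thesis .
qed

text \<open>In the integral over scales that represents the energy of order \<open>s0\<close>, scales up to \<open>r\<close> are estimated by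
\<open>increment_le_gagliardo\<close> at order \<open>s\<close>, which brings the factor \<open>1 - s\<close>, and scales beyond \<open>r\<close> trivially by \<open>\<integral>|u|^p\<close>. The
small scales contribute the integral of \<open>t^((s - s0) p - 1)\<close>; keeping \<open>s\<close> above the midpoint of \<open>s0\<close> and 1 bounds it
uniformly.\<close>

lemma lower_order_seminorm:
  fixes p s0 :: real
  assumes p: "1 \<le> p" and s0: "0 < s0" "s0 < 1"
  shows "\<exists>C>0. \<forall>s r (u :: real ^ 'n \<Rightarrow> real).
    (1 + s0) / 2 \<le> s \<and> s < 1 \<and> 0 < r \<and> u \<in> borel_measurable borel \<longrightarrow>
    gagliardo s0 p u \<le> ennreal (C * (1 - s) * r powr ((s - s0) * p)) * gagliardo s p u
      + ennreal (C * r powr (- (s0 * p))) * (\<integral>\<^sup>+x. ennreal (\<bar>u x\<bar> powr p) \<partial>lborel)"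
proof -
  let ?N = "real CARD('n)"
  define w where "w = unit_ball_vol ?N"
  have w: "0 < w" by (simp add: w_def)
  define A where "A = 2 powr (?N + p) * p"
  define B where "B = 2 powr p * w"
  have AB: "0 < A" "0 < B" using p w by (simp_all add: A_def B_def)
  define C1 where "C1 = (?N + p) * (A * (2 / ((1 - s0) * p)))"
  define C2 where "C2 = (?N + p) * (B / (s0 * p))"
  have C: "0 < C1" "0 < C2" using AB p s0 by (simp_all add: C1_def C2_def)
  have "gagliardo s0 p u \<le> ennreal (C1 * (1 - s) * r powr ((s - s0) * p)) * gagliardo s p u
      + ennreal (C2 * r powr (- (s0 * p))) * (\<integral>\<^sup>+x. ennreal (\<bar>u x\<bar> powr p) \<partial>lborel)"
    if s: "(1 + s0) / 2 \<le> s" "s < 1" and r: "0 < r" and u[measurable]: "u \<in> borel_measurable borel"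
    for s r and u :: "real ^ 'n \<Rightarrow> real"
  proof -
    let ?E = "gagliardo s p u" and ?X = "\<integral>\<^sup>+x. ennreal (\<bar>u x\<bar> powr p) \<partial>lborel"
    have s_pos: "0 < s" using s s0 by simp
    have b: "0 < (s - s0) * p" using s s0 p by simp
    have b2: "(1 - s0) * p / 2 \<le> (s - s0) * p"
    proof -
      have "(1 - s0) / 2 \<le> s - s0" using s by (simp add: field_simps)
      then have "(1 - s0) / 2 * p \<le> (s - s0) * p" using p by (intro mult_right_mono) auto
      then show ?thesis by simp
    qed
    have c: "0 < s0 * p" using s0 p by simp
    have pt: "ennreal (t powr (- (?N + s0 * p) - 1)) * indicator {0<..} t * increment p u t
       \<le> ennreal (A * (1 - s)) * ?E * (ennreal (t powr ((s - s0) * p - 1)) * indicator {0<..r} t)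
        + ennreal B * ?X * (ennreal (t powr (- (s0 * p) - 1)) * indicator {r<..} t)" for t
    proof (cases "0 < t")
      case t: True
      show ?thesis
      proof (cases "t \<le> r")
        case True
        have "ennreal (t powr (- (?N + s0 * p) - 1)) * increment p u t \<le>
          ennreal (t powr (- (?N + s0 * p) - 1)) * (ennreal (A * (1 - s) * t powr (?N + s * p)) * ?E)"
          unfolding A_def by (intro mult_left_mono increment_le_gagliardo u p s_pos s t) simp
        also have "\<dots> = ennreal (A * (1 - s) * (t powr (- (?N + s0 * p) - 1) * t powr (?N + s * p))) * ?E"
        proof -
          have gen: "ennreal a * (ennreal (k * d) * E) = ennreal (k * (a * d)) * E" if "0 \<le> a" "0 \<le> d" "0 \<le> k" for a k d E
            using that by (simp add: ennreal_mult mult_ac)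
          show ?thesis by (rule gen) (use AB s in auto)
        qed
        also have "t powr (- (?N + s0 * p) - 1) * t powr (?N + s * p) = t powr ((s - s0) * p - 1)"
          unfolding powr_add[symmetric] by (rule arg_cong[where f = "(powr) t"]) (simp add: algebra_simps)
        also have "ennreal (A * (1 - s) * t powr ((s - s0) * p - 1)) * ?E = ennreal (A * (1 - s)) * ?E * ennreal (t powr ((s - s0) * p - 1))"
          using AB s by (subst ennreal_mult) (auto simp: mult_ac)
        finally show ?thesis using True t by simp
      next
        case False
        have "ennreal (t powr (- (?N + s0 * p) - 1)) * increment p u t \<le>
          ennreal (t powr (- (?N + s0 * p) - 1)) * (ennreal (B * t powr ?N) * ?X)"
          unfolding B_def w_def using t by (intro mult_left_mono increment_le_norm u p) auto
        also have "\<dots> = ennreal (B * (t powr (- (?N + s0 * p) - 1) * t powr ?N)) * ?X"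
        proof -
          have gen: "ennreal a * (ennreal (k * d) * E) = ennreal (k * (a * d)) * E" if "0 \<le> a" "0 \<le> d" "0 \<le> k" for a k d E
            using that by (simp add: ennreal_mult mult_ac)
          show ?thesis by (rule gen) (use AB in auto)
        qed
        also have "t powr (- (?N + s0 * p) - 1) * t powr ?N = t powr (- (s0 * p) - 1)"
          by (simp add: powr_add[symmetric])
        also have "ennreal (B * t powr (- (s0 * p) - 1)) * ?X = ennreal B * ?X * ennreal (t powr (- (s0 * p) - 1))"
          using AB by (subst ennreal_mult) (auto simp: mult_ac)
        finally show ?thesis using False t by simp
      qed
    qed simp
    have "gagliardo s0 p u = ennreal (?N + s0 * p) *
      (\<integral>\<^sup>+t. ennreal (t powr (- (?N + s0 * p) - 1)) * indicator {0<..} t * increment p u t \<partial>lborel)"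
      by (rule gagliardo_layers[OF u p s0(1)])
    also have "\<dots> \<le> ennreal (?N + p) * (\<integral>\<^sup>+t.
        ennreal (A * (1 - s)) * ?E * (ennreal (t powr ((s - s0) * p - 1)) * indicator {0<..r} t)
        + ennreal B * ?X * (ennreal (t powr (- (s0 * p) - 1)) * indicator {r<..} t) \<partial>lborel)"
      using s0 p by (intro mult_mono nn_integral_mono pt ennreal_leI) auto
    also have "\<dots> = ennreal (?N + p) * (ennreal (A * (1 - s)) * ?E * ennreal (r powr ((s - s0) * p) / ((s - s0) * p))
        + ennreal B * ?X * ennreal (r powr (- (s0 * p)) / (s0 * p)))"
      using r by (simp add: nn_integral_add nn_integral_cmult nn_integral_powr_head[OF b] nn_integral_powr_tail[OF c])
    also have "\<dots> = ennreal ((?N + p) * (A * (1 - s) * (r powr ((s - s0) * p) / ((s - s0) * p)))) * ?E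
       + ennreal ((?N + p) * (B * (r powr (- (s0 * p)) / (s0 * p)))) * ?X"
    proof -
      have gen: "ennreal k * (ennreal a * E * ennreal d + ennreal f * X * ennreal g) = ennreal (k * (a * d)) * E + ennreal (k * (f * g)) * X"
        if "0 \<le> k" "0 \<le> a" "0 \<le> d" "0 \<le> f" "0 \<le> g" for k a d f g E X
        using that by (simp add: ennreal_mult distrib_left mult_ac)
      show ?thesis by (rule gen) (use AB s s0 p b in auto)
    qed
    also have "(?N + p) * (B * (r powr (- (s0 * p)) / (s0 * p))) = C2 * r powr (- (s0 * p))"
      unfolding C2_def by simp
    also have "ennreal ((?N + p) * (A * (1 - s) * (r powr ((s - s0) * p) / ((s - s0) * p)))) * ?E
       \<le> ennreal (C1 * (1 - s) * r powr ((s - s0) * p)) * ?E"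
    proof (intro mult_right_mono ennreal_leI)
      have "r powr ((s - s0) * p) / ((s - s0) * p) \<le> r powr ((s - s0) * p) / ((1 - s0) * p / 2)"
        using b b2 s0 p by (intro divide_left_mono) auto
      then have "(?N + p) * (A * (1 - s) * (r powr ((s - s0) * p) / ((s - s0) * p)))
         \<le> (?N + p) * (A * (1 - s) * (r powr ((s - s0) * p) / ((1 - s0) * p / 2)))"
        using AB s p by (intro mult_left_mono) auto
      also have "\<dots> = C1 * (1 - s) * r powr ((s - s0) * p)" unfolding C1_def by simp
      finally show "(?N + p) * (A * (1 - s) * (r powr ((s - s0) * p) / ((s - s0) * p)))
        \<le> C1 * (1 - s) * r powr ((s - s0) * p)" .
    qed simp
    finally show ?thesis by (simp add: add_right_mono)
  qed
  note both = this
  have "gagliardo s0 p u \<le> ennreal ((C1 + C2) * (1 - s) * r powr ((s - s0) * p)) * gagliardo s p u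
      + ennreal ((C1 + C2) * r powr (- (s0 * p))) * (\<integral>\<^sup>+x. ennreal (\<bar>u x\<bar> powr p) \<partial>lborel)"
    if "(1 + s0) / 2 \<le> s" "s < 1" "0 < r" "u \<in> borel_measurable borel" for s r and u :: "real ^ 'n \<Rightarrow> real"
    by (rule order_trans[OF both[OF that]]) (use C that in \<open>intro add_mono mult_right_mono ennreal_leI; simp\<close>)
  then show ?thesis using C by (intro exI[of _ "C1 + C2"]) auto
qed

section \<open>The lower bound\<close>

text \<open>Multiply \<open>sobolev_interpolation\<close> by \<open>\<gamma>\<close>, bound \<open>\<gamma> \<integral>|u|^p\<close> by \<open>capacitary_poincare\<close>, and use \<open>\<gamma> \<le> 1\<close> in the other term.
Both terms have the same power of \<open>r\<close>.\<close>

lemma normalized_lower_bound: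
  fixes p q1 :: real
  assumes p: "1 \<le> p"
  shows "\<exists>C>0. \<forall>s q \<gamma> r \<Omega> (u :: real ^ 'n \<Rightarrow> real).
    0 < s \<and> s < 1 \<and> p \<le> q \<and> q \<le> q1 \<and> q \<le> p + s * p * q / real CARD('n) \<and> 0 < \<gamma> \<and> \<gamma> \<le> 1 \<and> 0 < r
      \<and> u \<in> test_functions \<Omega> \<and> (\<integral>\<^sup>+x. ennreal (\<bar>u x\<bar> powr q) \<partial>lborel) = 1 \<and> (\<forall>t\<ge>r. thick s p \<gamma> \<Omega> t) \<longrightarrow>
    ennreal \<gamma> \<le> ennreal (C * s * r powr (s * p - real CARD('n) + real CARD('n) * p / q)) * gagliardo s p u"
proof -
  let ?N = "real CARD('n)"
  obtain A where A: "0 < A" and poin: "\<And>s \<gamma> r \<Omega> (u :: real ^ 'n \<Rightarrow> real).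
    0 < s \<Longrightarrow> s < 1 \<Longrightarrow> 0 \<le> \<gamma> \<Longrightarrow> 0 < r \<Longrightarrow> u \<in> test_functions \<Omega> \<Longrightarrow> \<forall>t\<ge>r. thick s p \<gamma> \<Omega> t \<Longrightarrow>
    ennreal \<gamma> * (\<integral>\<^sup>+x. ennreal (\<bar>u x\<bar> powr p) \<partial>lborel) \<le> ennreal (A * s * r powr (s * p)) * gagliardo s p u"
    using capacitary_poincare[OF p, where 'n = 'n] by blast
  obtain B where B: "0 < B" and sob: "\<And>s q r (u :: real ^ 'n \<Rightarrow> real).
    0 < s \<Longrightarrow> s < 1 \<Longrightarrow> p \<le> q \<Longrightarrow> q \<le> q1 \<Longrightarrow> q \<le> p + s * p * q / ?N \<Longrightarrow> 0 < r \<Longrightarrow> u \<in> borel_measurable borel \<Longrightarrow>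
      (\<integral>\<^sup>+x. ennreal (\<bar>u x\<bar> powr q) \<partial>lborel) = 1 \<Longrightarrow>
    1 \<le> ennreal (r powr (?N * p / q - ?N)) * (\<integral>\<^sup>+x. ennreal (\<bar>u x\<bar> powr p) \<partial>lborel)
      + ennreal (B * s * r powr (s * p - ?N + ?N * p / q)) * gagliardo s p u"
    using sobolev_interpolation[OF p, where 'n = 'n and ?q1.0 = q1] by blast
  have "ennreal \<gamma> \<le> ennreal ((A + B) * s * r powr (s * p - ?N + ?N * p / q)) * gagliardo s p u"
    if s: "0 < s" "s < 1" and q: "p \<le> q" "q \<le> q1" "q \<le> p + s * p * q / ?N" and \<gamma>: "0 < \<gamma>" "\<gamma> \<le> 1"
      and r: "0 < r" and u: "u \<in> test_functions \<Omega>" and Q: "(\<integral>\<^sup>+x. ennreal (\<bar>u x\<bar> powr q) \<partial>lborel) = 1"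
      and thick: "\<forall>t\<ge>r. thick s p \<gamma> \<Omega> t" for s q \<gamma> r \<Omega> and u :: "real ^ 'n \<Rightarrow> real"
  proof -
    let ?X = "\<integral>\<^sup>+x. ennreal (\<bar>u x\<bar> powr p) \<partial>lborel" and ?E = "gagliardo s p u"
    let ?b = "r powr (?N * p / q - ?N)" and ?a = "r powr (s * p - ?N + ?N * p / q)"
    have "ennreal \<gamma> * 1 \<le> ennreal \<gamma> * (ennreal ?b * ?X + ennreal (B * s * ?a) * ?E)"
      by (intro mult_left_mono sob s q r test_functions_measurable[OF u] Q) simp
    also have "\<dots> = ennreal ?b * (ennreal \<gamma> * ?X) + ennreal \<gamma> * (ennreal (B * s * ?a) * ?E)"
      by (simp add: distrib_left mult_ac)
    also have "\<dots> \<le> ennreal ?b * (ennreal (A * s * r powr (s * p)) * ?E) + 1 * (ennreal (B * s * ?a) * ?E)"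
      using \<gamma> by (intro add_mono mult_left_mono mult_right_mono poin[OF _ _ _ _ u thick] s r) (auto simp: ennreal_le_1)
    also have "\<dots> = ennreal (?b * (A * s * r powr (s * p)) + B * s * ?a) * ?E"
    proof -
      have gen: "ennreal b * (ennreal c * E) + 1 * (ennreal d * E) = ennreal (b * c + d) * E"
        if "0 \<le> b" "0 \<le> c" "0 \<le> d" for b c d E
        using that by (simp add: ennreal_mult ennreal_plus distrib_right mult.assoc)
      show ?thesis by (rule gen) (use A B s in auto)
    qed
    also have "?b * (A * s * r powr (s * p)) + B * s * ?a = (A + B) * s * ?a"
    proof -
      have e: "?a = r powr (s * p) * ?b"
        unfolding powr_add[symmetric] by (rule arg_cong[where f = "(powr) r"]) simp
      have "b * (A * s * c) + B * s * (c * b) = (A + B) * s * (c * b)" for b c by (simp add: algebra_simps)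
      then show ?thesis unfolding e .
    qed
    finally show ?thesis by simp
  qed
  then show ?thesis using A B by (intro exI[of _ "A + B"]) auto
qed

text \<open>As \<open>normalized_lower_bound\<close>, but with the Sobolev inequality of the fixed order \<open>s0\<close>, whose energy is bounded by
\<open>lower_order_seminorm\<close>. The pointwise Sobolev inequality at order \<open>s\<close> itself could not give the factor \<open>1 - s\<close>, which is
gained only after integration over \<open>x\<close>.\<close>

lemma normalized_lower_bound_near_1:
  fixes p q s0 :: real
  assumes p: "1 \<le> p" and s0: "0 < s0" "s0 < 1" and q: "p \<le> q" "q \<le> p + s0 * p * q / real CARD('n)"
  shows "\<exists>C>0. \<forall>s \<gamma> r \<Omega> (u :: real ^ 'n \<Rightarrow> real).
    (1 + s0) / 2 \<le> s \<and> s < 1 \<and> 0 < \<gamma> \<and> \<gamma> \<le> 1 \<and> 0 < r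
      \<and> u \<in> test_functions \<Omega> \<and> (\<integral>\<^sup>+x. ennreal (\<bar>u x\<bar> powr q) \<partial>lborel) = 1 \<and> (\<forall>t\<ge>r. thick s p \<gamma> \<Omega> t) \<longrightarrow>
    ennreal \<gamma> \<le> ennreal (C * (1 - s) * r powr (s * p - real CARD('n) + real CARD('n) * p / q)) * gagliardo s p u"
proof -
  let ?N = "real CARD('n)"
  obtain A where A: "0 < A" and poin: "\<And>s \<gamma> r \<Omega> (u :: real ^ 'n \<Rightarrow> real).
    0 < s \<Longrightarrow> s < 1 \<Longrightarrow> 0 \<le> \<gamma> \<Longrightarrow> 0 < r \<Longrightarrow> u \<in> test_functions \<Omega> \<Longrightarrow> \<forall>t\<ge>r. thick s p \<gamma> \<Omega> t \<Longrightarrow>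
    ennreal \<gamma> * (\<integral>\<^sup>+x. ennreal (\<bar>u x\<bar> powr p) \<partial>lborel) \<le> ennreal (A * (1 - s) * r powr (s * p)) * gagliardo s p u"
    using capacitary_poincare[OF p, where 'n = 'n] by blast
  obtain B where B: "0 < B" and sob: "\<And>r (u :: real ^ 'n \<Rightarrow> real). 0 < r \<Longrightarrow> u \<in> borel_measurable borel \<Longrightarrow>
      (\<integral>\<^sup>+x. ennreal (\<bar>u x\<bar> powr q) \<partial>lborel) = 1 \<Longrightarrow>
    1 \<le> ennreal (r powr (?N * p / q - ?N)) * (\<integral>\<^sup>+x. ennreal (\<bar>u x\<bar> powr p) \<partial>lborel)
      + ennreal (B * s0 * r powr (s0 * p - ?N + ?N * p / q)) * gagliardo s0 p u"
    using sobolev_interpolation[OF p, where 'n = 'n and ?q1.0 = q] s0 q by blast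
  obtain D where D: "0 < D" and low: "\<And>s r (u :: real ^ 'n \<Rightarrow> real).
    (1 + s0) / 2 \<le> s \<Longrightarrow> s < 1 \<Longrightarrow> 0 < r \<Longrightarrow> u \<in> borel_measurable borel \<Longrightarrow>
    gagliardo s0 p u \<le> ennreal (D * (1 - s) * r powr ((s - s0) * p)) * gagliardo s p u
      + ennreal (D * r powr (- (s0 * p))) * (\<integral>\<^sup>+x. ennreal (\<bar>u x\<bar> powr p) \<partial>lborel)"
    using lower_order_seminorm[OF p s0, where 'n = 'n] by blast
  define K where "K = B * s0 * D"
  have K: "0 < K" using B D s0 by (simp add: K_def)
  define C where "C = (1 + K) * A + K"
  have C: "0 < C" using A K by (simp add: C_def add_pos_pos)
  have "ennreal \<gamma> \<le> ennreal (C * (1 - s) * r powr (s * p - ?N + ?N * p / q)) * gagliardo s p u"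
    if s: "(1 + s0) / 2 \<le> s" "s < 1" and \<gamma>: "0 < \<gamma>" "\<gamma> \<le> 1"
      and r: "0 < r" and u: "u \<in> test_functions \<Omega>" and Q: "(\<integral>\<^sup>+x. ennreal (\<bar>u x\<bar> powr q) \<partial>lborel) = 1"
      and thick: "\<forall>t\<ge>r. thick s p \<gamma> \<Omega> t" for s \<gamma> r \<Omega> and u :: "real ^ 'n \<Rightarrow> real"
  proof -
    let ?X = "\<integral>\<^sup>+x. ennreal (\<bar>u x\<bar> powr p) \<partial>lborel" and ?E = "gagliardo s p u"
    define b where "b = r powr (?N * p / q - ?N)"
    have b: "0 \<le> b" by (simp add: b_def)
    have s_pos: "0 < s" using s s0 by simp
    have a0: "r powr (s0 * p - ?N + ?N * p / q) = b * r powr (s0 * p)"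
      and a: "r powr (s * p - ?N + ?N * p / q) = b * r powr (s * p)"
      unfolding b_def powr_add[symmetric] by (rule arg_cong[where f = "(powr) r"], simp)+
    have "ennreal \<gamma> * 1 \<le> ennreal \<gamma> * (ennreal b * ?X + ennreal (B * s0 * (b * r powr (s0 * p))) * gagliardo s0 p u)"
      unfolding a0[symmetric] unfolding b_def
      by (intro mult_left_mono sob r test_functions_measurable[OF u] Q) simp
    also have "\<dots> \<le> ennreal \<gamma> * (ennreal b * ?X + ennreal (B * s0 * (b * r powr (s0 * p))) *
        (ennreal (D * (1 - s) * r powr ((s - s0) * p)) * ?E + ennreal (D * r powr (- (s0 * p))) * ?X))"
      by (intro mult_left_mono add_left_mono low s r test_functions_measurable[OF u]) auto
    also have "\<dots> = ennreal (b + B * s0 * (b * r powr (s0 * p)) * (D * r powr (- (s0 * p)))) * (ennreal \<gamma> * ?X)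
        + ennreal \<gamma> * (ennreal (B * s0 * (b * r powr (s0 * p)) * (D * (1 - s) * r powr ((s - s0) * p))) * ?E)"
    proof -
      have gen: "g * (ennreal b * X + ennreal c * (ennreal d * E + ennreal e * X))
        = ennreal (b + c * e) * (g * X) + g * (ennreal (c * d) * E)"
        if "0 \<le> b" "0 \<le> c" "0 \<le> d" "0 \<le> e" for b c d e and g X E :: ennreal
        using that by (simp add: ennreal_mult ennreal_plus distrib_left distrib_right mult_ac add_ac)
      show ?thesis by (rule gen) (use b B D s s0 in auto)
    qed
    also have "B * s0 * (b * r powr (s0 * p)) * (D * r powr (- (s0 * p))) = K * b"
    proof -
      have "r powr (s0 * p) * r powr (- (s0 * p)) = 1" using r by (simp add: powr_add[symmetric])
      moreover have "B * s0 * (b * c) * (D * d) = B * s0 * D * b * (c * d)" for c d by (simp only: mult_ac)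
      ultimately show ?thesis by (simp only: K_def mult_1_right)
    qed
    also have "B * s0 * (b * r powr (s0 * p)) * (D * (1 - s) * r powr ((s - s0) * p)) = K * (1 - s) * (b * r powr (s * p))"
    proof -
      have e: "r powr (s0 * p) * r powr ((s - s0) * p) = r powr (s * p)"
        unfolding powr_add[symmetric] by (rule arg_cong[where f = "(powr) r"]) (simp add: algebra_simps)
      have "B * s0 * (b * c) * (D * (1 - s) * d) = B * s0 * D * (1 - s) * (b * (c * d))" for c d by (simp only: mult_ac)
      then show ?thesis by (simp only: K_def e)
    qed
    also have "ennreal (b + K * b) * (ennreal \<gamma> * ?X) + ennreal \<gamma> * (ennreal (K * (1 - s) * (b * r powr (s * p))) * ?E)
      \<le> ennreal (b + K * b) * (ennreal (A * (1 - s) * r powr (s * p)) * ?E) + 1 * (ennreal (K * (1 - s) * (b * r powr (s * p))) * ?E)"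
      using \<gamma> by (intro add_mono mult_left_mono mult_right_mono poin[OF _ _ _ _ u thick] s_pos s r) (auto simp: ennreal_le_1)
    also have "\<dots> = ennreal ((b + K * b) * (A * (1 - s) * r powr (s * p)) + K * (1 - s) * (b * r powr (s * p))) * ?E"
    proof -
      have gen: "ennreal b * (ennreal c * E) + 1 * (ennreal d * E) = ennreal (b * c + d) * E"
        if "0 \<le> b" "0 \<le> c" "0 \<le> d" for b c d E
        using that by (simp add: ennreal_mult ennreal_plus distrib_right mult.assoc)
      show ?thesis by (rule gen) (use A K b s in auto)
    qed
    also have "(b + K * b) * (A * (1 - s) * r powr (s * p)) + K * (1 - s) * (b * r powr (s * p)) = C * (1 - s) * (b * r powr (s * p))"
    proof -
      have "(b + K * b) * (A * e * c) + K * e * (b * c) = ((1 + K) * A + K) * e * (b * c)" for c e :: real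
        by (simp add: algebra_simps)
      then show ?thesis unfolding C_def .
    qed
    finally show ?thesis unfolding a by simp
  qed
  then show ?thesis using C by blast
qed

text \<open>A Bochner integral equal to 1 cannot be that of a non-integrable function, whose value is 0 by default; so the
normalisation alone provides integrability.\<close>

lemma Lq_norm_eq_1_imp_nn_integral:
  fixes u :: "real ^ 'n \<Rightarrow> real"
  assumes u: "u \<in> test_functions \<Omega>" and q: "0 < q" and norm: "Lq_norm q \<Omega> u = 1"
  shows "(\<integral>\<^sup>+x. ennreal (\<bar>u x\<bar> powr q) \<partial>lborel) = 1"
proof -
  let ?I = "LINT x|lborel. \<bar>u x\<bar> powr q"
  have "(\<lambda>x. indicator \<Omega> x *\<^sub>R \<bar>u x\<bar> powr q) = (\<lambda>x. \<bar>u x\<bar> powr q)"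
    using test_functions_outside[OF u] q by (intro ext) (auto simp: indicator_def)
  then have I: "?I powr (1 / q) = 1" using norm by (simp add: Lq_norm_def set_lebesgue_integral_def)
  have "0 \<le> ?I" by simp
  then have "(?I powr (1 / q)) powr q = ?I" using q by (simp add: powr_powr)
  then have I1: "?I = 1" unfolding I by simp
  then have "integrable lborel (\<lambda>x. \<bar>u x\<bar> powr q)"
    using not_integrable_integral_eq by fastforce
  then have "(\<integral>\<^sup>+x. ennreal (\<bar>u x\<bar> powr q) \<partial>lborel) = ennreal ?I"
    by (intro nn_integral_eq_integral) auto
  then show ?thesis by (simp add: I1)
qed

lemma thick_above_cap_inradius:
  assumes \<Omega>: "open \<Omega>" and t: "0 < t" "cap_inradius s p \<gamma> \<Omega> < ennreal t"
  shows "thick s p \<gamma> \<Omega> t"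
proof -
  have "\<not> negligible_set s p \<gamma> z t (cball z t - \<Omega>)" for z
  proof
    assume "negligible_set s p \<gamma> z t (cball z t - \<Omega>)"
    then have "ennreal t \<le> cap_inradius s p \<gamma> \<Omega>"
      unfolding cap_inradius_def using t(1) by (intro Sup_upper) blast
    with t(2) show False by simp
  qed
  moreover have "compact (cball z t - \<Omega>)" for z
    by (intro compact_diff compact_cball \<Omega>)
  ultimately show ?thesis
    unfolding thick_def negligible_set_def by (metis Diff_subset linear)
qed

text \<open>The bound holds for all \<open>r\<close> above the inradius, and \<open>r\<close> tends to the inradius. If this is 0, the limit shows that
no competitor has finite energy; if it is infinite, the left-hand side is 0.\<close>

lemma frac_lambda_lower_bound:
  fixes \<Omega> :: "(real ^ 'n) set"
  assumes \<Omega>: "open \<Omega>" and \<gamma>: "0 < \<gamma>" and A: "0 < A" and \<alpha>: "0 < \<alpha>" and q: "0 < q"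
    and bound: "\<And>r u. 0 < r \<Longrightarrow> u \<in> test_functions \<Omega> \<Longrightarrow> (\<integral>\<^sup>+x. ennreal (\<bar>u x\<bar> powr q) \<partial>lborel) = 1 \<Longrightarrow>
      \<forall>t\<ge>r. thick s p \<gamma> \<Omega> t \<Longrightarrow> ennreal \<gamma> \<le> ennreal (A * r powr \<alpha>) * gagliardo s p u"
  shows "ennreal (\<gamma> * (1 / A)) * ennreal_powr (1 / cap_inradius s p \<gamma> \<Omega>) \<alpha> \<le> frac_lambda s p q \<Omega>"
  unfolding frac_lambda_def
proof (rule INF_greatest)
  fix u assume "u \<in> {u \<in> test_functions \<Omega>. Lq_norm q \<Omega> u = 1}"
  then have u: "u \<in> test_functions \<Omega>" and Q: "(\<integral>\<^sup>+x. ennreal (\<bar>u x\<bar> powr q) \<partial>lborel) = 1"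
    using Lq_norm_eq_1_imp_nn_integral[OF _ q] by auto
  let ?R = "cap_inradius s p \<gamma> \<Omega>"
  show "ennreal (\<gamma> * (1 / A)) * ennreal_powr (1 / ?R) \<alpha> \<le> gagliardo s p u"
  proof (cases "?R")
    case top
    then show ?thesis by (simp add: ennreal_powr_def)
  next
    case (real \<rho>)
    show ?thesis
    proof (cases "gagliardo s p u")
      case E: (real e)
      have le: "\<gamma> \<le> A * r powr \<alpha> * e" if "\<rho> < r" for r
      proof -
        have r: "0 < r" using that real by simp
        have "\<forall>t\<ge>r. thick s p \<gamma> \<Omega> t"
        proof (intro allI impI)
          fix t assume "r \<le> t"
          then show "thick s p \<gamma> \<Omega> t"
            using that real r by (intro thick_above_cap_inradius[OF \<Omega>]) (auto simp: ennreal_less_iff)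
        qed
        from bound[OF r u Q this] have "ennreal \<gamma> \<le> ennreal (A * r powr \<alpha> * e)"
          using A E by (simp add: ennreal_mult)
        then show ?thesis using A E by (subst (asm) ennreal_le_iff) auto
      qed
      have "((\<lambda>r. A * r powr \<alpha> * e) \<longlongrightarrow> A * \<rho> powr \<alpha> * e) (at_right \<rho>)"
        using \<alpha> real
        by (intro tendsto_intros tendsto_powr'[OF tendsto_ident_at tendsto_const])
           (auto simp: eventually_at_filter intro: always_eventually)
      then have lim: "\<gamma> \<le> A * \<rho> powr \<alpha> * e"
        by (rule tendsto_lowerbound) (auto simp: eventually_at_right_less le intro: eventually_mono[OF eventually_at_right_less])
      then have "\<rho> \<noteq> 0" using \<gamma> \<alpha> by auto
      then have \<rho>: "0 < \<rho>" using real by simp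
      have "1 / ?R = ennreal (1 / \<rho>)"
        using \<rho> real by (simp add: divide_ennreal flip: ennreal_1)
      then have "ennreal_powr (1 / ?R) \<alpha> = ennreal ((1 / \<rho>) powr \<alpha>)"
        using \<rho> by (simp add: ennreal_powr_def)
      moreover have "\<gamma> * (1 / A) * (1 / \<rho>) powr \<alpha> \<le> e"
        using lim A \<rho> by (simp add: powr_divide divide_le_eq mult_ac)
      ultimately show ?thesis using E \<gamma> A by (simp add: ennreal_leI flip: ennreal_mult)
    qed simp
  qed
qed

lemma comparable_at_if_eventually_proportional:
  assumes F: "F \<noteq> bot" and c: "0 < c" and ev: "\<forall>\<^sub>F x in F. u x / v x = c"
  shows "comparable_at F u v"
proof -
  have ev': "\<forall>\<^sub>F x in F. ereal (u x / v x) = ereal c" using ev by (auto elim: eventually_mono)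
  have "Liminf F (\<lambda>x. ereal (u x / v x)) = ereal c"
    using Liminf_eq[OF ev'] Liminf_const[of F "ereal c"] F by simp
  moreover have "Limsup F (\<lambda>x. ereal (u x / v x)) = ereal c"
    using Limsup_eq[OF ev'] Limsup_const[of F "ereal c"] F by simp
  ultimately show ?thesis using c by (simp add: comparable_at_def)
qed

lemma admissible_imp_subcritical:
  assumes adm: "admissible N p s q" and N: "0 < N"
  shows "q < p + s * p * q / real N" "0 < s * p - real N + real N * p / q"
proof -
  have q: "0 < q" using adm by (simp add: admissible_def)
  have p: "1 \<le> p" and s: "s * p \<le> real N" using adm by (simp_all add: admissible_def)
  have "q * (real N - s * p) < real N * p"
  proof (cases "s * p < real N")
    case True
    then have "q < real N * p / (real N - s * p)" using adm by (simp add: admissible_def crit_exponent_def)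
    then show ?thesis using True by (simp add: pos_less_divide_eq)
  next
    case False
    then have "s * p = real N" using s by simp
    then show ?thesis using N p by simp
  qed
  then have *: "q * real N < real N * p + s * p * q" by (simp add: algebra_simps)
  then show "q < p + s * p * q / real N" using N by (simp add: field_simps)
  show "0 < s * p - real N + real N * p / q" using * q by (simp add: field_simps)
qed

text \<open>If \<open>sp \<le> N/2\<close>, the critical exponent is at most \<open>2p\<close>; so one constant serves all admissible exponents as
\<open>s \<rightarrow> 0\<close>.\<close>

lemma admissible_exponent_le:
  assumes "admissible N p s q" and "2 * (s * p) \<le> real N" and N: "0 < N"
  shows "q \<le> 2 * p"
proof -
  have p: "1 \<le> p" and q: "0 < q" using assms by (simp_all add: admissible_def)
  have "q * (s * p) \<le> q * (real N / 2)" using assms q by (intro mult_left_mono) auto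
  moreover have "q * real N < real N * p + q * (s * p)"
    using admissible_imp_subcritical(1)[OF assms(1) N] N by (simp add: field_simps)
  ultimately have "real N * q < real N * (2 * p)" by (simp add: algebra_simps)
  then show ?thesis using N by simp
qed

theorem theorem1p4:
  shows "\<exists>\<sigma> :: real \<Rightarrow> real \<Rightarrow> real \<Rightarrow> real.
    (\<forall>p s q. admissible CARD('n::finite) p s q \<longrightarrow>
       0 < \<sigma> p s q \<and>
       (\<forall>\<gamma> (\<Omega> :: (real ^ 'n) set). 0 < \<gamma> \<and> \<gamma> < 1 \<and> open \<Omega> \<longrightarrow>
          ennreal (\<gamma> * \<sigma> p s q) *
            ennreal_powr (1 / cap_inradius s p \<gamma> \<Omega>)
              (s * p - real CARD('n) + real CARD('n) * p / q)
          \<le> frac_lambda s p q \<Omega>)) \<and>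
    (\<forall>p (q :: real \<Rightarrow> real).
       1 \<le> p \<and> (\<forall>\<^sub>F s in at_right 0. admissible CARD('n) p s (q s)) \<longrightarrow>
       comparable_at (at_right 0) (\<lambda>s. \<sigma> p s (q s)) (\<lambda>s. 1 / s)) \<and>
    (\<forall>p q.
       1 \<le> p \<and> p \<le> real CARD('n) \<and> (\<forall>\<^sub>F s in at_left 1. admissible CARD('n) p s q) \<longrightarrow>
       comparable_at (at_left 1) (\<lambda>s. \<sigma> p s q) (\<lambda>s. 1 / (1 - s)))"
proof -
  let ?N = "CARD('n)"
  let ?\<alpha> = "\<lambda>p s q. s * p - real ?N + real ?N * p / q"
  have N: "0 < ?N" by simp
  let ?A = "\<lambda>p q1 C. 0 < C \<and> (\<forall>s q \<gamma> r \<Omega> (u :: real ^ 'n \<Rightarrow> real).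
    0 < s \<and> s < 1 \<and> p \<le> q \<and> q \<le> q1 \<and> q \<le> p + s * p * q / real ?N \<and> 0 < \<gamma> \<and> \<gamma> \<le> 1 \<and> 0 < r
      \<and> u \<in> test_functions \<Omega> \<and> (\<integral>\<^sup>+x. ennreal (\<bar>u x\<bar> powr q) \<partial>lborel) = 1 \<and> (\<forall>t\<ge>r. thick s p \<gamma> \<Omega> t) \<longrightarrow>
    ennreal \<gamma> \<le> ennreal (C * s * r powr ?\<alpha> p s q) * gagliardo s p u)"
  let ?B = "\<lambda>p q s0 C. 0 < C \<and> (\<forall>s \<gamma> r \<Omega> (u :: real ^ 'n \<Rightarrow> real).
    (1 + s0) / 2 \<le> s \<and> s < 1 \<and> 0 < \<gamma> \<and> \<gamma> \<le> 1 \<and> 0 < r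
      \<and> u \<in> test_functions \<Omega> \<and> (\<integral>\<^sup>+x. ennreal (\<bar>u x\<bar> powr q) \<partial>lborel) = 1 \<and> (\<forall>t\<ge>r. thick s p \<gamma> \<Omega> t) \<longrightarrow>
    ennreal \<gamma> \<le> ennreal (C * (1 - s) * r powr ?\<alpha> p s q) * gagliardo s p u)"
  define CA where "CA p q1 = (SOME C. ?A p q1 C)" for p q1
  have CA: "?A p q1 (CA p q1)" if "1 \<le> p" for p q1
    unfolding CA_def by (rule someI_ex, rule normalized_lower_bound[OF that])
  \<comment> \<open>A fixed order at which \<open>q\<close> is subcritical. It depends on \<open>p\<close> and \<open>q\<close> only, so that the constant \<open>CB p q\<close> below is
    the same for all \<open>s\<close> near 1.\<close>
  define S where "S p q = (SOME s0. admissible ?N p s0 q)" for p q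
  have S: "admissible ?N p (S p q) q" if "admissible ?N p s q" for p s q
    unfolding S_def using that by (rule someI)
  define CB where "CB p q = (SOME C. ?B p q (S p q) C)" for p q
  have CB: "?B p q (S p q) (CB p q)" if "admissible ?N p s q" for p s q
    unfolding CB_def
  proof (rule someI_ex, rule normalized_lower_bound_near_1)
    show "1 \<le> p" "0 < S p q" "S p q < 1" "p \<le> q" using S[OF that] by (simp_all add: admissible_def)
    show "q \<le> p + S p q * p * q / real ?N" using admissible_imp_subcritical(1)[OF S[OF that] N] by simp
  qed
  \<comment> \<open>The first case occurs only for \<open>s > 1/2\<close>, as \<open>S p q\<close> is positive for admissible exponents. The maximum with \<open>2p\<close>
    makes the second constant independent of \<open>q\<close> once \<open>q \<le> 2p\<close>, which holds for all small \<open>s\<close>.\<close>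
  define \<sigma> where "\<sigma> p s q = (if (1 + S p q) / 2 \<le> s then 1 / (CB p q * (1 - s)) else 1 / (CA p (max q (2 * p)) * s))"
    for p s q
  have main: "0 < \<sigma> p s q \<and> (\<forall>\<gamma> (\<Omega> :: (real ^ 'n) set). 0 < \<gamma> \<and> \<gamma> < 1 \<and> open \<Omega> \<longrightarrow>
      ennreal (\<gamma> * \<sigma> p s q) * ennreal_powr (1 / cap_inradius s p \<gamma> \<Omega>) (?\<alpha> p s q) \<le> frac_lambda s p q \<Omega>)"
    if adm: "admissible ?N p s q" for p s q
  proof -
    have p: "1 \<le> p" and s: "0 < s" "s < 1" and q: "p \<le> q" "0 < q" using adm by (auto simp: admissible_def)
    note sub = admissible_imp_subcritical[OF adm N]
    show ?thesis
    proof (cases "(1 + S p q) / 2 \<le> s")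
      case True
      note B = CB[OF adm]
      have \<sigma>: "\<sigma> p s q = 1 / (CB p q * (1 - s))" using True by (simp add: \<sigma>_def)
      have pos: "0 < CB p q * (1 - s)" using B s by simp
      have "ennreal (\<gamma> * \<sigma> p s q) * ennreal_powr (1 / cap_inradius s p \<gamma> \<Omega>) (?\<alpha> p s q) \<le> frac_lambda s p q \<Omega>"
        if "0 < \<gamma>" "\<gamma> < 1" "open \<Omega>" for \<gamma> and \<Omega> :: "(real ^ 'n) set"
        unfolding \<sigma> using B True that s
        by (intro frac_lambda_lower_bound pos sub q) auto
      then show ?thesis using pos by (simp add: \<sigma>)
    next
      case False
      note A = CA[OF p, of "max q (2 * p)"]
      have \<sigma>: "\<sigma> p s q = 1 / (CA p (max q (2 * p)) * s)" using False by (simp add: \<sigma>_def)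
      have pos: "0 < CA p (max q (2 * p)) * s" using A s by simp
      have "ennreal (\<gamma> * \<sigma> p s q) * ennreal_powr (1 / cap_inradius s p \<gamma> \<Omega>) (?\<alpha> p s q) \<le> frac_lambda s p q \<Omega>"
        if "0 < \<gamma>" "\<gamma> < 1" "open \<Omega>" for \<gamma> and \<Omega> :: "(real ^ 'n) set"
        unfolding \<sigma> using A that s q sub
        by (intro frac_lambda_lower_bound pos sub q) auto
      then show ?thesis using pos by (simp add: \<sigma>)
    qed
  qed
  have near0: "comparable_at (at_right 0) (\<lambda>s. \<sigma> p s (q s)) (\<lambda>s. 1 / s)"
    if p: "1 \<le> p" and ev: "\<forall>\<^sub>F s in at_right 0. admissible ?N p s (q s)" for p and q :: "real \<Rightarrow> real"
  proof (rule comparable_at_if_eventually_proportional)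
    show "0 < 1 / CA p (2 * p)" using CA[OF p] by simp
    have "\<forall>\<^sub>F s in at_right 0. s < min (1 / 2) (real ?N / (2 * p))"
      using p N by (intro eventually_mono[OF eventually_at_right_real[of 0 "min (1 / 2) (real ?N / (2 * p))"]]) auto
    then show "\<forall>\<^sub>F s in at_right 0. \<sigma> p s (q s) / (1 / s) = 1 / CA p (2 * p)"
      using ev eventually_at_right_less[of 0]
    proof eventually_elim
      case (elim s)
      have "0 < S p (q s)" using S[OF elim(2)] by (simp add: admissible_def)
      then have "\<not> (1 + S p (q s)) / 2 \<le> s" using elim by simp
      moreover have "2 * (s * p) \<le> real ?N" using elim p by (simp add: field_simps)
      then have "max (q s) (2 * p) = 2 * p"
        using admissible_exponent_le[OF elim(2) _ N] by simp
      ultimately show ?case using elim by (simp add: \<sigma>_def)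
    qed
  qed simp
  have near1: "comparable_at (at_left 1) (\<lambda>s. \<sigma> p s q) (\<lambda>s. 1 / (1 - s))"
    if ev: "\<forall>\<^sub>F s in at_left 1. admissible ?N p s q" for p q
  proof (rule comparable_at_if_eventually_proportional)
    obtain s where adm: "admissible ?N p s q" using eventually_happens'[OF _ ev] by auto
    show "0 < 1 / CB p q" using CB[OF adm] by simp
    have "(1 + S p q) / 2 < 1" using S[OF adm] by (simp add: admissible_def)
    then have "\<forall>\<^sub>F s in at_left 1. s \<in> {(1 + S p q) / 2<..<1}" by (rule eventually_at_left_real)
    then show "\<forall>\<^sub>F s in at_left 1. \<sigma> p s q / (1 / (1 - s)) = 1 / CB p q"
      by (rule eventually_mono) (simp add: \<sigma>_def)
  qed simp
  show ?thesis using main near0 near1 by (intro exI[of _ \<sigma>]) blast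
qed

end
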